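(* Let $n\ge 5$ and let $G\in\mathcal{G}(n,n-3)$. Then $G$ is determined by its distance Laplacian spectrum; that is, every connected graph $H$ whose distance Laplacian spectrum (as a multiset) equals that of $G$ is isomorphic to $G$.
   Context: All graphs are finite and simple. For a connected graph $G$ with vertices $v_1,\dots,v_n$, $d_G(v_i,v_j)$ is the length of a shortest path between $v_i$ and $v_j$; the distance matrix is $\mathcal{D}(G)=(d_G(v_i,v_j))_{i,j}$; the transmission of $v_i$ is $Tr(v_i)=\sum_{j=1}^n d_G(v_i,v_j)$; the distance Laplacian matrix is $\mathcal{D}^L(G)=\mathrm{diag}(Tr(v_1),\dots,Tr(v_n))-\mathcal{D}(G)$, with eigenvalues $\partial^L_1\ge\partial^L_2\ge\cdots\ge\partial^L_n=0$. These eigenvalues together with their multiplicities form the distance Laplacian spectrum of $G$. $m(\partial^L_1)$ denotes the multiplicity of the largest eigenvalue $\partial^L_1$. $\mathcal{G}(n,k)$ is the set of connected graphs on $n$ vertices with $m(\partial^L_1)=k$. *)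

theory Defs
  imports
    "Graph_Theory.Graph_Theory"
    "Jordan_Normal_Form.Char_Poly"
begin

text \<open>
  Finite simple graphs are the locale \<open>graph\<close> (symmetric loop-free finite digraphs without
  parallel arcs, an undirected edge being a pair of opposite arcs), and for
  these \<open>digraph_iso\<close> is isomorphism of simple graphs. \<open>connected\<close> is qualified
  because the name is shared with topological connectedness.
\<close>

text \<open>
  For vertices not joined by any path this is the least element of an empty set and carries no
  meaning; it is only used for connected graphs.
\<close>
definition graph_dist :: "('a, 'b) pre_digraph \<Rightarrow> 'a \<Rightarrow> 'a \<Rightarrow> nat" where
  "graph_dist G u v = (LEAST k. \<exists>p. pre_digraph.apath G u p v \<and> length p = k)"

definition transmission :: "('a, 'b) pre_digraph \<Rightarrow> 'a \<Rightarrow> nat" where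
  "transmission G v = (\<Sum>w\<in>verts G. graph_dist G v w)"

definition vertex_enum :: "('a, 'b) pre_digraph \<Rightarrow> 'a list \<Rightarrow> bool" where
  "vertex_enum G vs \<longleftrightarrow> distinct vs \<and> set vs = verts G"

definition dist_mat :: "('a, 'b) pre_digraph \<Rightarrow> 'a list \<Rightarrow> real mat" where
  "dist_mat G vs = mat (length vs) (length vs) (\<lambda>(i, j). real (graph_dist G (vs ! i) (vs ! j)))"

definition transmission_mat :: "('a, 'b) pre_digraph \<Rightarrow> 'a list \<Rightarrow> real mat" where
  "transmission_mat G vs =
     mat (length vs) (length vs) (\<lambda>(i, j). if i = j then real (transmission G (vs ! i)) else 0)"

definition dist_laplacian_mat :: "('a, 'b) pre_digraph \<Rightarrow> 'a list \<Rightarrow> real mat" where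
  "dist_laplacian_mat G vs = transmission_mat G vs - dist_mat G vs"

text \<open>
  The eigenvalues with their multiplicities are the real roots of the characteristic polynomial.
  The matrix is real symmetric, so no eigenvalue is lost by working over the reals and algebraic
  and geometric multiplicities agree. The choice of the enumeration is immaterial, see
  \<open>dist_laplacian_spectrum_eq\<close> below.
\<close>
definition dist_laplacian_spectrum :: "('a, 'b) pre_digraph \<Rightarrow> real multiset" where
  "dist_laplacian_spectrum G =
     proots (char_poly (dist_laplacian_mat G (SOME vs. vertex_enum G vs)))"

definition largest_eigenvalue_multiplicity :: "('a, 'b) pre_digraph \<Rightarrow> nat" where
  "largest_eigenvalue_multiplicity G =
     count (dist_laplacian_spectrum G) (Max (set_mset (dist_laplacian_spectrum G)))"

definition graph_class :: "nat \<Rightarrow> nat \<Rightarrow> ('a, 'b) pre_digraph set" where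
  "graph_class n k =
     {G. graph G \<and> Digraph_Component.connected G \<and> card (verts G) = n \<and>
         largest_eigenvalue_multiplicity G = k}"

lemma dist_laplacian_mat_index:
  assumes "i < length vs" "j < length vs"
  shows "dist_laplacian_mat G vs $$ (i, j) =
    (if i = j then real (transmission G (vs ! i)) else 0) - real (graph_dist G (vs ! i) (vs ! j))"
  using assms by (simp add: dist_laplacian_mat_def transmission_mat_def dist_mat_def)

lemma dist_laplacian_mat_carrier:
  "dist_laplacian_mat G vs \<in> carrier_mat (length vs) (length vs)"
  by (rule carrier_matI) (simp_all add: dist_laplacian_mat_def transmission_mat_def dist_mat_def)

lemma dist_laplacian_mat_similar:
  assumes "vertex_enum G vs" "vertex_enum G ws"
  shows "similar_mat (dist_laplacian_mat G vs) (dist_laplacian_mat G ws)"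
proof -
  let ?n = "length vs"
  have dv: "distinct vs" and dw: "distinct ws" and sets: "set vs = set ws"
    using assms by (auto simp: vertex_enum_def)
  have len: "length ws = ?n"
    using dv dw sets by (metis distinct_card)
  define p where "p i = (THE j. j < ?n \<and> ws ! j = vs ! i)" for i
  have p: "p i < ?n \<and> ws ! p i = vs ! i" if "i < ?n" for i
  proof -
    have "\<exists>j < ?n. ws ! j = vs ! i"
      using that sets len by (metis in_set_conv_nth nth_mem)
    moreover have "j = k" if "j < ?n" "k < ?n" "ws ! j = vs ! i" "ws ! k = vs ! i" for j k
      using that dw len by (simp add: nth_eq_iff_index_eq[symmetric])
    ultimately have "\<exists>!j. j < ?n \<and> ws ! j = vs ! i" by blast
    from theI'[OF this] show ?thesis unfolding p_def .
  qed
  have inj: "inj_on p {..<?n}"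
  proof (rule inj_onI)
    fix i j assume "i \<in> {..<?n}" "j \<in> {..<?n}" "p i = p j"
    then have "vs ! i = vs ! j" using p by (metis lessThan_iff)
    with \<open>i \<in> _\<close> \<open>j \<in> _\<close> dv show "i = j" by (simp add: nth_eq_iff_index_eq)
  qed
  have img: "p ` {..<?n} = {..<?n}"
    using inj p by (intro card_subset_eq) (auto simp: card_image)
  define P :: "real mat" where "P = mat ?n ?n (\<lambda>(i, j). if p i = j then 1 else 0)"
  define Q :: "real mat" where "Q = mat ?n ?n (\<lambda>(i, j). if p j = i then 1 else 0)"
  let ?A = "dist_laplacian_mat G vs" and ?B = "dist_laplacian_mat G ws"
  have A: "?A \<in> carrier_mat ?n ?n" by (rule dist_laplacian_mat_carrier)
  have B: "?B \<in> carrier_mat ?n ?n" using dist_laplacian_mat_carrier[of G ws] len by simp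
  have P: "P \<in> carrier_mat ?n ?n" and Q: "Q \<in> carrier_mat ?n ?n" by (auto simp: P_def Q_def)
  have PQ: "P * Q = 1\<^sub>m ?n"
  proof (rule eq_matI)
    fix i j assume "i < dim_row (1\<^sub>m ?n :: real mat)" "j < dim_col (1\<^sub>m ?n :: real mat)"
    then have ij: "i < ?n" "j < ?n" by auto
    then have "(P * Q) $$ (i, j) =
        (\<Sum>k\<in>{0..<?n}. (if p i = k then 1 else 0) * (if p j = k then 1 else 0))"
      by (simp add: P_def Q_def scalar_prod_def)
    also have "\<dots> = (\<Sum>k\<in>{0..<?n}. if p i = k then (if p j = k then 1 else 0) else 0)"
      by (rule sum.cong) auto
    also have "\<dots> = (if p j = p i then 1 else 0)" using p ij by simp
    also have "\<dots> = (1\<^sub>m ?n :: real mat) $$ (i, j)"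
      using ij inj by (auto dest: inj_onD)
    finally show "(P * Q) $$ (i, j) = (1\<^sub>m ?n :: real mat) $$ (i, j)" .
  qed (auto simp: P_def Q_def)
  have QP: "Q * P = 1\<^sub>m ?n"
    using mat_mult_left_right_inverse[OF P Q PQ] .
  have "P * ?B * Q = ?A"
  proof (rule eq_matI)
    fix i j assume "i < dim_row ?A" "j < dim_col ?A"
    then have ij: "i < ?n" "j < ?n" using A by auto
    have PB: "(P * ?B) $$ (i, k) = ?B $$ (p i, k)" if k: "k < ?n" for k
    proof -
      have "(P * ?B) $$ (i, k) = (\<Sum>l\<in>{0..<?n}. (if p i = l then 1 else 0) * ?B $$ (l, k))"
        using ij k B by (auto simp: P_def scalar_prod_def)
      also have "\<dots> = (\<Sum>l\<in>{0..<?n}. if p i = l then ?B $$ (l, k) else 0)"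
        by (rule sum.cong) auto
      also have "\<dots> = ?B $$ (p i, k)" using p ij by simp
      finally show ?thesis .
    qed
    have "(P * ?B * Q) $$ (i, j) =
        (\<Sum>k\<in>{0..<?n}. (P * ?B) $$ (i, k) * (if p j = k then 1 else 0))"
      using ij P B by (auto simp: Q_def scalar_prod_def)
    also have "\<dots> = (\<Sum>k\<in>{0..<?n}. if p j = k then ?B $$ (p i, k) else 0)"
      by (rule sum.cong) (auto simp: PB)
    also have "\<dots> = ?B $$ (p i, p j)" using p ij by simp
    also have "\<dots> = ?A $$ (i, j)"
      using p ij len inj by (auto simp: dist_laplacian_mat_index dest: inj_onD)
    finally show "(P * ?B * Q) $$ (i, j) = ?A $$ (i, j)" .
  qed (use A B P Q in auto)
  then have "similar_mat_wit ?A ?B P Q"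
    using A B P Q PQ QP by (auto simp: similar_mat_wit_def Let_def)
  then show ?thesis by (auto simp: similar_mat_def)
qed

lemma dist_laplacian_spectrum_eq:
  assumes "vertex_enum G vs"
  shows "dist_laplacian_spectrum G = proots (char_poly (dist_laplacian_mat G vs))"
proof -
  have "vertex_enum G (SOME vs. vertex_enum G vs)" using assms by (rule someI)
  from char_poly_similar[OF dist_laplacian_mat_similar[OF this assms]]
  show ?thesis by (simp add: dist_laplacian_spectrum_def)
qed

end

theory Submission
  imports
    Defs
    "HOL-Combinatorics.Transposition"
    "Jordan_Normal_Form.Schur_Decomposition"
begin

text \<open>
  Let \<open>\<mu>\<close> be the largest eigenvalue of the distance Laplacian \<open>L\<close>. If it has multiplicity \<open>n - 3\<close>, then
  \<open>\<mu>I - L - (\<mu>/n)J\<close> is positive semidefinite of rank two and annihilates the all-ones vector, so it is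
  the Gram matrix of spanning vectors \<open>x v\<close> in the plane that sum to zero, and
  \<open>x u \<bullet> x v = d u v - \<mu>/n\<close> for \<open>u \<noteq> v\<close>. Writing \<open>a = \<mu>/n - 1\<close>, one first excludes \<open>a \<ge> 1\<close>; then two vertices are
  adjacent if and only if their vectors form an obtuse angle. A triangle of the graph gives a positive
  linear relation between three vectors, which fixes the neighbourhoods of all other vertices; a
  triangle-free graph is complete bipartite or contains an induced path on four vertices, which can
  only be completed to a pentagon. In every case \<open>n\<close>, \<open>a\<close> and the trace of \<open>L\<close> determine the graph, and all three
  can be read off the spectrum.
\<close>

section \<open>Plane vectors\<close>

text \<open>The all-ones vector is an eigenvector of \<mu>I - L for \<mu>, and subtracting
  (\<mu>/n)J removes exactly this one of its three nonzero eigenvalues; that is why multiplicity n -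
  3 leads to a plane. In a plane signs suffice: the product of two determinants with a common vector
  depends on inner products alone (\<open>crs_mult_crs\<close>), so distances tell on which side of
  a line a vector lies. The obstacle is that nothing bounds the diameter beforehand. Inner products
  are -a at distance 1 and 1 - a at distance 2, but larger distances are unknown. For 0 < a < 1 the
  sign separates distance 1 from all others, so this range has to be secured before any case
  distinction; for a \<ge> 1 the signs instead bound the degrees. The classification is used in one
  direction only: two cospectral graphs share n, a and the trace, these numbers fit at most one
  entry of the list, and its class sizes fix the graph up to isomorphism.\<close>

definition dot :: "complex \<Rightarrow> complex \<Rightarrow> real" where
  "dot p q = Re p * Re q + Im p * Im q"

text \<open>The 2x2 determinant, whose sign tells the side of the line spanned by \<open>p\<close>
  on which \<open>q\<close> lies. In this geometry \<open>complex\<close> is just the real plane;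
  its product occurs only with real scalars and as the quarter turn \<open>\<i> * z\<close>.\<close>

definition crs :: "complex \<Rightarrow> complex \<Rightarrow> real" where
  "crs p q = Re p * Im q - Im p * Re q"

lemma dot_commute: "dot p q = dot q p"
  by (simp add: dot_def mult.commute)

lemma dot_add_left: "dot (p + q) r = dot p r + dot q r"
  by (simp add: dot_def algebra_simps)

lemma dot_diff_left: "dot (p - q) r = dot p r - dot q r"
  by (simp add: dot_def algebra_simps)

lemma dot_scale_left: "dot (of_real c * p) r = c * dot p r"
  by (simp add: dot_def algebra_simps)

lemma dot_sum_left: "dot (sum f A) r = (\<Sum>i\<in>A. dot (f i) r)"
  by (simp add: dot_def Re_sum Im_sum sum_distrib_right sum.distrib)

lemma dot_zero_left [simp]: "dot 0 r = 0"
  by (simp add: dot_def)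

lemma dot_self_nonneg: "dot p p \<ge> 0"
  by (simp add: dot_def)

lemma dot_self_eq_0: "dot p p = 0 \<longleftrightarrow> p = 0"
  by (simp add: dot_def complex_eq_iff sum_squares_eq_zero_iff)

lemma dot_self_pos: "p \<noteq> 0 \<Longrightarrow> dot p p > 0"
  using dot_self_nonneg[of p] dot_self_eq_0[of p] by linarith

lemma crs_sum_right: "crs p (sum f A) = (\<Sum>i\<in>A. crs p (f i))"
  by (simp add: crs_def Re_sum Im_sum sum_distrib_left sum_subtractf)

lemma crs_self [simp]: "crs p p = 0"
  by (simp add: crs_def)

lemma crs_swap: "crs p q = - crs q p"
  by (simp add: crs_def)

lemma crs_eq_dot: "crs z p = dot p (\<i> * z)"
  by (simp add: crs_def dot_def)

text \<open>A Binet-Cauchy identity. It turns a question of sides into known inner products: the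
  left side is positive exactly when \<open>p\<close> and \<open>q\<close> lie strictly on the same
  side of the line spanned by \<open>v\<close>.\<close>

lemma crs_mult_crs: "crs v p * crs v q = dot v v * dot p q - dot p v * dot q v"
  by (simp add: crs_def dot_def algebra_simps)

text \<open>Cramer's rule in homogeneous form, an explicit linear relation between any three plane
  vectors.\<close>

lemma crs_relation:
  "of_real (crs q r) * p + of_real (crs r p) * q + of_real (crs p q) * r = 0"
  by (simp add: crs_def complex_eq_iff algebra_simps)

lemma dot_eq_0_both:
  assumes "dot z p = 0" "dot z q = 0" "crs p q \<noteq> 0"
  shows "z = 0"
proof -
  have "crs p q * Re z = 0" "crs p q * Im z = 0"
    using assms(1,2) unfolding crs_def dot_def by Groebner_Basis.algebra+
  then show ?thesis using assms(3) by (simp add: complex_eq_iff)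
qed

text \<open>Pairwise obtuse vectors go once around the origin, so consecutive determinants share
  their sign. In \<open>crs_mult_crs\<close> at \<open>q\<close> both terms push in the same
  direction.\<close>

lemma crs_obtuse_ne_0:
  assumes "dot p q < 0" "dot q r < 0" "dot p r < 0"
  shows "crs p q * crs q r > 0"
proof -
  have "crs q p * crs q r = dot q q * dot p r - dot p q * dot r q" by (rule crs_mult_crs)
  moreover have "dot q q * dot p r \<le> 0"
    using assms(3) dot_self_nonneg[of q] by (simp add: mult_nonneg_nonpos)
  moreover have "dot p q * dot r q > 0"
    using assms by (simp add: mult_neg_neg dot_commute[of r])
  ultimately show ?thesis using crs_swap[of q p] by simp
qed

text \<open>The origin lies inside the triangle of the three vectors. Its barycentric coordinates
  are the determinants of \<open>crs_relation\<close> divided by their sum; since these have equal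
  signs, the quotients are positive for either orientation.\<close>

lemma obtuse_triple:
  assumes "dot p q < 0" "dot q r < 0" "dot p r < 0"
  obtains \<alpha> \<beta> \<gamma> :: real where "\<alpha> > 0" "\<beta> > 0" "\<gamma> > 0" "\<alpha> + \<beta> + \<gamma> = 1"
    "of_real \<alpha> * p + of_real \<beta> * q + of_real \<gamma> * r = 0"
proof -
  define A B C where "A = crs q r" and "B = crs r p" and "C = crs p q"
  define s where "s = A + B + C"
  have "C * A > 0" "A * B > 0"
    using crs_obtuse_ne_0[of p q r] crs_obtuse_ne_0[of q r p] assms
    by (simp_all add: A_def B_def C_def dot_commute)
  then have "A / s > 0" "B / s > 0" "C / s > 0" "s \<noteq> 0"
    by (auto simp: s_def zero_less_mult_iff zero_less_divide_iff)
  moreover from this have "A / s + B / s + C / s = 1"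
    by (simp add: s_def add_divide_distrib[symmetric])
  moreover have "of_real (A / s) * p + of_real (B / s) * q + of_real (C / s) * r
      = (of_real A * p + of_real B * q + of_real C * r) / of_real s"
    by (simp add: add_divide_distrib)
  then have "of_real (A / s) * p + of_real (B / s) * q + of_real (C / s) * r = 0"
    using crs_relation[of q r p] by (simp add: A_def B_def C_def)
  ultimately show ?thesis using that by blast
qed

text \<open>Used for components orthogonal to a fixed vector. If \<open>f u\<close> is nonzero, the
  products with \<open>u\<close> force one common value at all other points, and the product of two
  of these points leaves only 0 or \<open>f u\<close> for it. Either way the sum is a nonzero
  multiple of \<open>f u\<close>.\<close>

lemma const_products_zero:
  fixes f :: "'a \<Rightarrow> real"
  assumes P: "finite P" "card P \<ge> 3"
    and prod: "\<And>u v. u \<in> P \<Longrightarrow> v \<in> P \<Longrightarrow> u \<noteq> v \<Longrightarrow> f u * f v = c"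
    and sum: "sum f P = 0" and u: "u \<in> P"
  shows "f u = 0"
proof (rule ccontr)
  assume fu: "f u \<noteq> 0"
  have "\<not> P \<subseteq> {u}" using P card_mono[of "{u}" P] by auto
  then obtain v where v: "v \<in> P" "v \<noteq> u" by auto
  have "\<not> P \<subseteq> {u, v}" using P card_mono[of "{u, v}" P] v by auto
  then obtain w where w: "w \<in> P" "w \<noteq> u" "w \<noteq> v" by auto
  have eq: "f y = f v" if "y \<in> P" "y \<noteq> u" for y
  proof -
    have "f u * f y = f u * f v" using prod[of u y] prod[of u v] u v that by simp
    then show ?thesis using fu by simp
  qed
  have "f v * f w = f u * f v" using prod[of v w] prod[of u v] u v w by simp
  then have or: "f v = 0 \<or> f v = f u" using eq[of w] w by auto
  have "sum f P = f u + sum f (P - {u})" using P u by (simp add: sum.remove)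
  also have "sum f (P - {u}) = real (card (P - {u})) * f v" using eq by simp
  finally have e: "sum f P = f u + real (card (P - {u})) * f v" .
  from or show False
  proof
    assume "f v = 0" then show False using e sum fu by simp
  next
    assume "f v = f u"
    then have "(1 + real (card (P - {u}))) * f u = 0" using e sum by (simp add: algebra_simps)
    then show False using fu by (simp add: add_nonneg_eq_0_iff)
  qed
qed

section \<open>Distance functions realised by planar vectors\<close>

text \<open>The combinatorial data are a metric on a finite set, with \<open>cut\<close> expressing
  connectedness of the relation "distance 1". \<open>gram\<close> is silent on the diagonal, because
  the squared norms involve the unknown transmissions.\<close>

locale planar_distance =
  fixes V :: "'a set" and d :: "'a \<Rightarrow> 'a \<Rightarrow> nat" and a :: real and x :: "'a \<Rightarrow> complex"
  assumes fin: "finite V" and card5: "card V \<ge> 5"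
    and d_eq_0: "u \<in> V \<Longrightarrow> v \<in> V \<Longrightarrow> d u v = 0 \<longleftrightarrow> u = v"
    and d_sym: "u \<in> V \<Longrightarrow> v \<in> V \<Longrightarrow> d u v = d v u"
    and d_tri: "u \<in> V \<Longrightarrow> v \<in> V \<Longrightarrow> w \<in> V \<Longrightarrow> d u w \<le> d u v + d v w"
    and cut: "S \<subseteq> V \<Longrightarrow> S \<noteq> {} \<Longrightarrow> S \<noteq> V \<Longrightarrow> \<exists>u\<in>S. \<exists>v\<in>V - S. d u v = 1"
    and gram: "u \<in> V \<Longrightarrow> v \<in> V \<Longrightarrow> u \<noteq> v \<Longrightarrow> dot (x u) (x v) = real (d u v) - 1 - a"
    and sum_zero: "sum x V = 0"
    and spanning: "z \<noteq> 0 \<Longrightarrow> \<exists>v\<in>V. dot (x v) z \<noteq> 0"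
begin

abbreviation E :: "'a \<Rightarrow> 'a \<Rightarrow> bool" where "E u v \<equiv> d u v = 1"

lemma E_sym: "u \<in> V \<Longrightarrow> v \<in> V \<Longrightarrow> E u v \<longleftrightarrow> E v u"
  using d_sym by simp

lemma E_irrefl: "u \<in> V \<Longrightarrow> \<not> E u u"
  using d_eq_0[of u u] by simp

lemma E_neq: "u \<in> V \<Longrightarrow> E u v \<Longrightarrow> u \<noteq> v"
  using E_irrefl by auto

lemma gram_E: "u \<in> V \<Longrightarrow> v \<in> V \<Longrightarrow> E u v \<Longrightarrow> dot (x u) (x v) = - a"
  using gram[of u v] E_neq[of u v] by simp

lemma d_eq_2:
  assumes "u \<in> V" "v \<in> V" "w \<in> V" "E u v" "E v w" "u \<noteq> w" "\<not> E u w"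
  shows "d u w = 2"
proof -
  have "d u w \<noteq> 0" using assms d_eq_0 by simp
  moreover have "d u w \<le> 2" using d_tri[of u v w] assms by simp
  ultimately show ?thesis using assms(7) by linarith
qed

lemma gram_2:
  assumes "u \<in> V" "v \<in> V" "w \<in> V" "E u v" "E v w" "u \<noteq> w" "\<not> E u w"
  shows "dot (x u) (x w) = 1 - a"
  using gram[of u w] d_eq_2[of u v w] assms by simp

lemma not_col:
  assumes "z \<noteq> 0" shows "\<exists>v\<in>V. crs z (x v) \<noteq> 0"
  using spanning[of "\<i> * z"] assms by (simp add: crs_eq_dot)

lemma sum_dot: "(\<Sum>v\<in>V. dot (x v) z) = 0"
  using dot_sum_left[of x V z] sum_zero by simp

text \<open>The main use of \<open>card5\<close>: at most four vertices never exhaust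
  \<open>V\<close>, so connectedness provides an edge to a new vertex.\<close>

lemma escape:
  assumes "set us \<subseteq> V" "us \<noteq> []" "length us < 5"
  obtains u v where "u \<in> set us" "v \<in> V" "v \<notin> set us" "E u v"
proof -
  have "set us \<noteq> V" using assms card5 card_length[of us] by auto
  then show ?thesis using cut[of "set us"] assms that by auto
qed

section \<open>Bounds on \<open>a\<close>\<close>

text \<open>Distinct vertices have distance at least 1. For a \<le> 0 all inner products with
  \<open>x v\<close> would be nonnegative, and the norm of \<open>x v\<close> could not cancel in
  the zero sum.\<close>

lemma a_pos: "a > 0"
proof (rule ccontr)
  assume a: "\<not> a > 0"
  obtain v where v: "v \<in> V" "dot (x v) 1 \<noteq> 0" using spanning[of 1] by auto
  then have "x v \<noteq> 0" by (auto simp: dot_def)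
  have "(\<Sum>u\<in>V. dot (x u) (x v)) = dot (x v) (x v) + (\<Sum>u\<in>V - {v}. dot (x u) (x v))"
    using fin v by (simp add: sum.remove)
  moreover have "(\<Sum>u\<in>V - {v}. dot (x u) (x v)) \<ge> 0"
  proof (rule sum_nonneg)
    fix u assume u: "u \<in> V - {v}"
    then have "d u v \<noteq> 0" using d_eq_0 v by auto
    then show "dot (x u) (x v) \<ge> 0" using gram[of u v] u v a by simp
  qed
  ultimately show False using dot_self_pos[OF \<open>x v \<noteq> 0\<close>] sum_dot[of "x v"] by linarith
qed

lemma nbr: 
  assumes "u \<in> V" obtains v where "v \<in> V" "E u v"
  using escape[of "[u]"] assms by auto

lemma x_neq_0: 
  assumes "u \<in> V" shows "x u \<noteq> 0"
proof -
  obtain v where "v \<in> V" "E u v" using nbr assms by blast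
  then have "dot (x u) (x v) < 0" using gram_E assms a_pos by simp
  then show ?thesis by auto
qed

lemma x_pos: "u \<in> V \<Longrightarrow> dot (x u) (x u) > 0"
  using x_neq_0 dot_self_pos by simp

text \<open>For a \<ge> 1 two neighbours of \<open>v\<close>, being at distance at most 2, have a
  nonpositive inner product, so \<open>crs_mult_crs\<close> puts them strictly on opposite sides of
  the line spanned by \<open>x v\<close>. A line has only two sides.\<close>

lemma degree_le_2:
  assumes a: "a \<ge> 1" and V: "v \<in> V" "p \<in> V" "q \<in> V" "r \<in> V"
    and E: "E v p" "E v q" "E v r" and ne: "p \<noteq> q" "q \<noteq> r" "p \<noteq> r"
  shows False
proof -
  have *: "crs (x v) (x p) * crs (x v) (x q) < 0"
    if "p \<in> V" "q \<in> V" "E v p" "E v q" "p \<noteq> q" for p q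
  proof -
    have "d p q \<le> 2" using d_tri[of p v q] that V E_sym[of p v] by simp
    then have "dot (x p) (x q) \<le> 0" using gram[of p q] that a by simp
    then have "dot (x v) (x v) * dot (x p) (x q) \<le> 0"
      by (simp add: mult_nonneg_nonpos dot_self_nonneg)
    moreover have "dot (x p) (x v) = - a" "dot (x q) (x v) = - a"
      using gram_E that V dot_commute by metis+
    moreover have "a * a > 0" using a by simp
    ultimately show ?thesis using crs_mult_crs[of "x v" "x p" "x q"] by simp
  qed
  show False using *[of p q] *[of q r] *[of p r] assms
    by (auto simp: mult_less_0_iff)
qed

text \<open>Relative to the line spanned by \<open>x v\<close>, both \<open>u\<close> and
  \<open>y\<close> lie opposite to \<open>w\<close>, hence on the same side. This makes their inner
  product positive, so their distance exceeds 1 + a, which is at least 2.\<close>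

lemma path4_dist_3:
  assumes a: "a \<ge> 1" and V: "u \<in> V" "v \<in> V" "w \<in> V" "y \<in> V"
    and E: "E u v" "E v w" "E w y" and ne: "\<not> E u w" "u \<noteq> w" "y \<noteq> v" "y \<noteq> u"
  shows "\<not> E v y" "d u y = 3"
proof -
  show vy: "\<not> E v y"
    using degree_le_2[OF a, of v u w y] V E ne E_sym[of u v] E_neq[of w y] by auto
  let ?f = "\<lambda>p. crs (x v) (x p)"
  let ?W = "dot (x v) (x v)"
  have W: "?W > 0" using x_pos V by simp
  have uv: "dot (x u) (x v) = - a" and wv: "dot (x w) (x v) = - a" and yw: "dot (x y) (x w) = - a"
    using gram_E V E E_sym by auto
  have uw: "dot (x u) (x w) = 1 - a" using gram_2[of u v w] V E ne by simp
  have yv: "dot (x y) (x v) = 1 - a" using gram_2[of y w v] V E ne vy E_sym by simp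
  have "?f u * ?f w = ?W * (1 - a) - a * a"
    using crs_mult_crs[of "x v" "x u" "x w"] uv uw wv by simp
  moreover have "?W * (1 - a) \<le> 0" using a W by (simp add: mult_nonneg_nonpos)
  moreover have "a * a > 0" using a by simp
  ultimately have 1: "?f u * ?f w < 0" by linarith
  have "?f y * ?f w = - (a * ?W) - (1 - a) * (- a)"
    using crs_mult_crs[of "x v" "x y" "x w"] yv yw wv by simp
  moreover have "a * ?W > 0" "(1 - a) * (- a) \<ge> 0"
    using a W by (auto simp: mult_nonpos_nonpos mult_nonneg_nonpos mult_nonpos_nonneg)
  ultimately have 2: "?f y * ?f w < 0" by linarith
  have "?f u * ?f y > 0" using 1 2 by (auto simp: mult_less_0_iff zero_less_mult_iff)
  moreover have "?f u * ?f y = ?W * dot (x u) (x y) - (1 - a) * (- a)"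
    using crs_mult_crs[of "x v" "x u" "x y"] uv yv by simp
  moreover have "(1 - a) * (- a) \<ge> 0" using a by (auto simp: mult_nonpos_nonpos mult_nonneg_nonpos mult_nonpos_nonneg)
  ultimately have "?W * dot (x u) (x y) > 0" by linarith
  then have "dot (x u) (x y) > 0" using W by (simp add: zero_less_mult_iff)
  then have "d u y > 2" using gram[of u y] V ne a by simp
  moreover have "d u y \<le> 3"
    using d_tri[of u v y] d_tri[of v w y] V E by simp
  ultimately show "d u y = 3" by simp
qed

text \<open>Along five vertices every inner product of distinct vectors is known except that of the
  two ends. The determinants with the middle vector are then overdetermined, its squared norm
  \<open>W\<close> being the only other unknown.\<close>

lemma no_path5:
  assumes a: "a \<ge> 1" and V: "u \<in> V" "v \<in> V" "w \<in> V" "y \<in> V" "z \<in> V"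
    and E: "E u v" "E v w" "E w y" "E y z" and ne: "\<not> E u w" "u \<noteq> w" "y \<noteq> v" "y \<noteq> u"
      "z \<noteq> u" "z \<noteq> v" "z \<noteq> w"
  shows False
proof -
  note p1 = path4_dist_3[OF a V(1-4) E(1-3) ne(1-4)]
  have p2: "\<not> E w z" "d v z = 3"
    using path4_dist_3[OF a V(2-5) E(2-4)] p1 ne E_sym V by auto
  have uz: "d u z \<ge> 2"
  proof -
    have "d u z \<noteq> 1" using d_tri[of u z y] p1 V E E_sym[of y z] by auto
    then show ?thesis using d_eq_0[of u z] V ne by (cases "d u z") auto
  qed
  let ?g = "\<lambda>p. crs (x w) (x p)"
  define W where "W = dot (x w) (x w)"
  have W: "W > 0" using x_pos V by (simp add: W_def)
  have g: "?g p * ?g q = W * dot (x p) (x q) - dot (x p) (x w) * dot (x q) (x w)" for p q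
    unfolding W_def by (rule crs_mult_crs)
  have vw: "dot (x v) (x w) = - a" and yw: "dot (x y) (x w) = - a"
    and uv: "dot (x u) (x v) = - a" and zy: "dot (x z) (x y) = - a"
    using gram_E V E E_sym by auto
  have uw: "dot (x u) (x w) = 1 - a" using gram_2[of u v w] V E ne by simp
  have zw: "dot (x z) (x w) = 1 - a" using gram_2[of z y w] V E ne p2 E_sym by simp
  have vy: "dot (x v) (x y) = 1 - a" using gram_2[of v w y] V E ne p1 by simp
  have uy: "dot (x u) (x y) = 2 - a" using gram[of u y] V ne p1 by simp
  have zv: "dot (x z) (x v) = 2 - a" using gram[of z v] V ne p2 d_sym[of z v] by simp
  have 1: "?g u * ?g v = - a * W + a * (1 - a)" "?g z * ?g y = - a * W + a * (1 - a)"
    "?g u * ?g y = (2 - a) * W + a * (1 - a)" "?g z * ?g v = (2 - a) * W + a * (1 - a)"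
    "?g v * ?g y = W * (1 - a) - a * a"
    "?g u * ?g z = W * (real (d u z) - 1 - a) - (1 - a) * (1 - a)"
    using g[of u v] g[of z y] g[of u y] g[of z v] g[of v y] g[of u z] gram[of u z] V ne
    by (simp_all add: vw yw uv zy uw zw vy uy zv algebra_simps)
  \<comment> \<open>Pairing the four determinants in two ways gives an equation in \<open>a\<close>
    and \<open>W\<close> alone, which leaves a = 1.\<close>
  have "(?g u * ?g v) * (?g z * ?g y) = (?g u * ?g y) * (?g z * ?g v)" by simp
  then have "(- a * W + a * (1 - a))^2 = ((2 - a) * W + a * (1 - a))^2"
    unfolding 1 power2_eq_square .
  then have "((1 - a) * 4) * (W * (W + a)) = 0" by Groebner_Basis.algebra
  moreover have "W * (W + a) \<noteq> 0" using W a by simp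
  ultimately have a1: "a = 1" by simp
  \<comment> \<open>The third pairing involves the distance of the ends. At a = 1 it reads W + d u z
    - 2 = 0, although \<open>W\<close> is positive and the ends have distance at least 2.\<close>
  have "(?g u * ?g z) * (?g v * ?g y) = (?g u * ?g v) * (?g z * ?g y)" by simp
  then have "W * (real (d u z) - 2 + W) = 0" unfolding 1 a1 by Groebner_Basis.algebra
  then show False using W uz by simp
qed

text \<open>Otherwise all degrees are at most 2. Adding an outside neighbour each time, an edge
  grows to a path on three, four and finally five vertices, which \<open>no_path5\<close> forbids; a
  triangle cannot grow at all.\<close>

lemma a_less_1: "a < 1"
proof (rule ccontr)
  assume "\<not> a < 1"
  then have a: "a \<ge> 1" by simp
  have step: False if V: "u \<in> V" "v \<in> V" "w \<in> V" "y \<in> V"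
    and E: "E u v" "E v w" "E w y" and ne: "\<not> E u w" "u \<noteq> w" "y \<noteq> v" "y \<noteq> u" for u v w y
  proof -
    note p = path4_dist_3[OF a V E ne]
    obtain s z where z: "s \<in> {u, v, w, y}" "z \<in> V" "z \<notin> {u, v, w, y}" "E s z"
      using escape[of "[u, v, w, y]"] V by auto
    have "\<not> E v z" "\<not> E w z"
      using degree_le_2[OF a, of v u w z] degree_le_2[OF a, of w v y z] V E ne z E_sym by auto
    then consider "E y z" | "E u z" using z by auto
    then show False
    proof cases
      case 1 then show False using no_path5[OF a V] z E ne by auto
    next
      case 2
      have "\<not> E y v" "w \<noteq> y" "u \<noteq> v" using p V E_sym E E_neq by auto
      then show False using no_path5[OF a V(4,3,2,1), of z] z E ne 2 E_sym V p by auto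
    qed
  qed
  have tri: False if V: "u \<in> V" "v \<in> V" "w \<in> V" and E: "E u v" "E v w" "E u w" for u v w
  proof -
    obtain s z where z: "s \<in> {u, v, w}" "z \<in> V" "z \<notin> {u, v, w}" "E s z"
      using escape[of "[u, v, w]"] V by auto
    have "u \<noteq> v" "v \<noteq> w" "u \<noteq> w" using E E_neq V by auto
    then show False
      using degree_le_2[OF a, of u v w z] degree_le_2[OF a, of v u w z] degree_le_2[OF a, of w u v z]
        E V z E_sym by auto
  qed
  have wedge: False if V: "u \<in> V" "v \<in> V" "w \<in> V" and E: "E u v" "E v w" and ne: "u \<noteq> w" for u v w
  proof -
    have nuw: "\<not> E u w" using tri[OF V] E by auto
    obtain s z where z: "s \<in> {u, v, w}" "z \<in> V" "z \<notin> {u, v, w}" "E s z"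
      using escape[of "[u, v, w]"] V by auto
    have "\<not> E v z" using degree_le_2[OF a, of v u w z] V E ne z E_sym by auto
    then consider "E w z" | "E u z" using z by auto
    then show False
    proof cases
      case 1 then show False using step[OF V, of z] z E ne nuw by auto
    next
      case 2
      then show False using step[OF V(3,2,1), of z] z E ne nuw E_sym V by auto
    qed
  qed
  obtain s where s: "s \<in> V" using card5 by fastforce
  obtain r where r: "r \<in> V" "E s r" using nbr s by blast
  obtain q z where z: "q \<in> {s, r}" "z \<in> V" "z \<notin> {s, r}" "E q z"
    using escape[of "[s, r]"] s r by auto
  then show False using wedge[of r s z] wedge[of s r z] r s E_sym by auto
qed

lemma not_E_dot:
  assumes "u \<in> V" "v \<in> V" "u \<noteq> v" "\<not> E u v"
  shows "dot (x u) (x v) > 0"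
proof -
  have "d u v \<ge> 2" using d_eq_0[of u v] assms by (cases "d u v") auto
  then show ?thesis using gram[of u v] assms a_less_1 by simp
qed

text \<open>The bridge between graph and geometry. Non-neighbours may have any distance from 2 on.
  In particular, distinct vertices with equal vectors are non-adjacent and have the same
  neighbours.\<close>

lemma E_iff_dot:
  assumes "u \<in> V" "v \<in> V" "u \<noteq> v"
  shows "E u v \<longleftrightarrow> dot (x u) (x v) < 0"
  using gram_E[of u v] not_E_dot[of u v] assms a_pos by fastforce

end

section \<open>Graphs with a triangle\<close>

text \<open>\<open>R\<close> may relate a class index to itself, which makes that class a clique;
  otherwise the class is independent. Sizes are prescribed for all indices, 0 beyond the list, so
  that \<open>R\<close> and \<open>sizes\<close> determine a simple graph up to isomorphism.\<close>

definition blowup :: "'a set \<Rightarrow> ('a \<Rightarrow> 'a \<Rightarrow> bool) \<Rightarrow> (nat \<Rightarrow> nat \<Rightarrow> bool) \<Rightarrow> nat list \<Rightarrow> ('a \<Rightarrow> nat) \<Rightarrow> bool" where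
  "blowup V adj R sizes \<phi> \<longleftrightarrow>
     (\<forall>y\<in>V. \<forall>z\<in>V. y \<noteq> z \<longrightarrow> (adj y z \<longleftrightarrow> R (\<phi> y) (\<phi> z))) \<and>
     (\<forall>c. card {y \<in> V. \<phi> y = c} = (if c < length sizes then sizes ! c else 0))"

lemma blowupI:
  assumes "\<And>y z. y \<in> V \<Longrightarrow> z \<in> V \<Longrightarrow> y \<noteq> z \<Longrightarrow> adj y z \<longleftrightarrow> R (\<phi> y) (\<phi> z)"
    and "\<And>c. c < length sizes \<Longrightarrow> card {y \<in> V. \<phi> y = c} = sizes ! c"
    and range: "\<And>y. y \<in> V \<Longrightarrow> \<phi> y < length sizes"
  shows "blowup V adj R sizes \<phi>"
proof -
  have "card {y \<in> V. \<phi> y = c} = 0" if "\<not> c < length sizes" for c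
  proof -
    have "{y \<in> V. \<phi> y = c} = {}" using that range by auto
    then show ?thesis by (simp only: card.empty)
  qed
  then show ?thesis using assms by (simp add: blowup_def)
qed

text \<open>With class sizes \<open>[p, 2, q]\<close> this is the complete bipartite graph with parts of sizes \<open>p\<close> and \<open>q + 2\<close>
  and one additional edge inside the second part.\<close>

definition plus_edge :: "nat \<Rightarrow> nat \<Rightarrow> bool" where
  "plus_edge i j \<longleftrightarrow> i + j < 3 \<and> i \<noteq> j \<or> i = 1 \<and> j = 1"

context planar_distance begin

text \<open>The coefficients are the barycentric coordinates from \<open>obtuse_triple\<close>. They
  are carried along so that rotations and swaps reduce each case to one corner.\<close>

definition triangle :: "'a \<Rightarrow> 'a \<Rightarrow> 'a \<Rightarrow> real \<Rightarrow> real \<Rightarrow> real \<Rightarrow> bool" where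
  "triangle u v w \<alpha> \<beta> \<gamma> \<longleftrightarrow> u \<in> V \<and> v \<in> V \<and> w \<in> V \<and> E u v \<and> E v w \<and> E u w \<and>
     \<alpha> > 0 \<and> \<beta> > 0 \<and> \<gamma> > 0 \<and> \<alpha> + \<beta> + \<gamma> = 1 \<and>
     of_real \<alpha> * x u + of_real \<beta> * x v + of_real \<gamma> * x w = 0"

lemma triangle_rotate: "triangle u v w \<alpha> \<beta> \<gamma> \<Longrightarrow> triangle v w u \<beta> \<gamma> \<alpha>"
  unfolding triangle_def using E_sym[of u v] E_sym[of u w] by (simp add: ac_simps)

lemma triangle_swap: "triangle u v w \<alpha> \<beta> \<gamma> \<Longrightarrow> triangle u w v \<alpha> \<gamma> \<beta>"
  unfolding triangle_def using E_sym[of v w] by (simp add: ac_simps)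

lemma triangle_ex:
  assumes "u \<in> V" "v \<in> V" "w \<in> V" "E u v" "E v w" "E u w"
  obtains \<alpha> \<beta> \<gamma> where "triangle u v w \<alpha> \<beta> \<gamma>"
proof -
  have "dot (x u) (x v) < 0" "dot (x v) (x w) < 0" "dot (x u) (x w) < 0"
    using gram_E assms a_pos by auto
  from obtuse_triple[OF this] show ?thesis
    using assms that unfolding triangle_def by metis
qed

lemma triangle_dot:
  assumes "triangle u v w \<alpha> \<beta> \<gamma>"
  shows "\<alpha> * dot (x u) z + \<beta> * dot (x v) z + \<gamma> * dot (x w) z = 0"
proof -
  have "dot (of_real \<alpha> * x u + of_real \<beta> * x v + of_real \<gamma> * x w) z = 0"
    using assms by (simp add: triangle_def)
  then show ?thesis by (simp add: dot_add_left dot_scale_left)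
qed

lemma triangle_self:
  assumes "triangle u v w \<alpha> \<beta> \<gamma>"
  shows "\<alpha> * dot (x u) (x u) = a * (1 - \<alpha>)"
proof -
  have "dot (x v) (x u) = - a" "dot (x w) (x u) = - a"
    using assms gram_E E_sym unfolding triangle_def by auto
  then have "\<alpha> * dot (x u) (x u) = a * (\<beta> + \<gamma>)"
    using triangle_dot[OF assms, of "x u"] by (simp add: algebra_simps)
  moreover have "\<beta> + \<gamma> = 1 - \<alpha>" using assms by (simp add: triangle_def)
  ultimately show ?thesis by simp
qed

lemma triangle_crs:
  assumes "triangle u v w \<alpha> \<beta> \<gamma>"
  shows "crs (x v) (x w) \<noteq> 0"
proof -
  have "dot (x u) (x v) < 0" "dot (x v) (x w) < 0" "dot (x u) (x w) < 0"
    using gram_E assms a_pos by (auto simp: triangle_def)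
  from crs_obtuse_ne_0[OF this] show ?thesis by auto
qed

section \<open>How other vertices attach to a triangle\<close>

text \<open>A vertex adjacent to no corner would have three positive inner products, against the
  positive relation. So some corner is adjacent and all corners are within distance 2; the relation
  paired with \<open>x y\<close> then says that the weights of the corners not adjacent to
  \<open>y\<close> add up to \<open>a\<close>.\<close>

lemma triangle_outside:
  assumes t: "triangle u v w \<alpha> \<beta> \<gamma>" and y: "y \<in> V" "y \<notin> {u, v, w}"
  shows "s \<in> {u, v, w} \<Longrightarrow> dot (x s) (x y) = (if E y s then 0 else 1) - a"
    and "(if E y u then 0 else \<alpha>) + (if E y v then 0 else \<beta>) + (if E y w then 0 else \<gamma>) = a"
proof -
  note T = t[unfolded triangle_def]
  have ex: "\<exists>r\<in>{u, v, w}. E y r"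
  proof (rule ccontr)
    assume "\<not> ?thesis"
    then have "dot (x u) (x y) > 0" "dot (x v) (x y) > 0" "dot (x w) (x y) > 0"
      using not_E_dot T y E_sym by auto
    then show False using triangle_dot[OF t, of "x y"] T
      by (smt (verit) mult_pos_pos)
  qed
  show dot: "dot (x s) (x y) = (if E y s then 0 else 1) - a" if s: "s \<in> {u, v, w}" for s
  proof (cases "E y s")
    case True
    then show ?thesis using gram_E[of y s] T y s by (auto simp: dot_commute)
  next
    case False
    obtain r where r: "r \<in> {u, v, w}" "E y r" using ex by auto
    then have "r \<noteq> s" using False by auto
    then have "E r s" using r s T E_sym by auto
    then show ?thesis using gram_2[of y r s] False r s T y by (auto simp: dot_commute)
  qed
  have "\<alpha> * dot (x u) (x y) + \<beta> * dot (x v) (x y) + \<gamma> * dot (x w) (x y) =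
    (if E y u then 0 else \<alpha>) + (if E y v then 0 else \<beta>) + (if E y w then 0 else \<gamma>) - a * (\<alpha> + \<beta> + \<gamma>)"
    by (simp add: dot[of u] dot[of v] dot[of w] algebra_simps)
  then show "(if E y u then 0 else \<alpha>) + (if E y v then 0 else \<beta>) + (if E y w then 0 else \<gamma>) = a"
    using triangle_dot[OF t] T by simp
qed

lemma triangle_twin:
  assumes t: "triangle u v w \<alpha> \<beta> \<gamma>" and y: "y \<in> V" "E y v" "E y w"
  shows "x y = x u"
proof -
  note T = t[unfolded triangle_def]
  have "dot (x y) (x v) = - a" "dot (x y) (x w) = - a" "dot (x u) (x v) = - a" "dot (x u) (x w) = - a"
    using gram_E y T by auto
  then have "x y - x u = 0"
    by (intro dot_eq_0_both[of _ "x v" "x w"] triangle_crs[OF t]) (auto simp: dot_diff_left)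
  then show ?thesis by simp
qed

text \<open>The corner \<open>u\<close> must be adjacent to \<open>y\<close>, as otherwise all three
  weights would count and \<open>a\<close> would be 1. On the basis \<open>x v\<close>,
  \<open>x w\<close> the vector \<open>x y\<close> has products 1 - a where \<open>x u\<close> has
  -a, so the two point in opposite directions.\<close>

lemma triangle_pendant:
  assumes t: "triangle u v w \<alpha> \<beta> \<gamma>" and y: "y \<in> V" "y \<noteq> u" "\<not> E y v" "\<not> E y w" "y \<notin> {u, v, w}"
  shows "x y = of_real (- ((1 - a) / a)) * x u" "\<alpha> = 1 - a" "\<beta> + \<gamma> = a" "E y u"
proof -
  note T = t[unfolded triangle_def]
  let ?k = "(1 - a) / a"
  note o = triangle_outside[OF t y(1,5)]
  show yu: "E y u"
    using o(2) y T a_less_1 by (auto split: if_splits)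
  show bc: "\<beta> + \<gamma> = a" using o(2) yu y by simp
  then show "\<alpha> = 1 - a" using T by simp
  have "dot (x y) (x v) = 1 - a" "dot (x y) (x w) = 1 - a" "dot (x u) (x v) = - a" "dot (x u) (x w) = - a"
    using o(1)[of v] o(1)[of w] gram_E y T by (auto simp: dot_commute)
  moreover have "?k * a = 1 - a" using a_pos by simp
  ultimately have "dot (x y - of_real (- ?k) * x u) (x v) = 0" "dot (x y - of_real (- ?k) * x u) (x w) = 0"
    unfolding dot_diff_left dot_scale_left by simp_all
  then have "x y - of_real (- ?k) * x u = 0"
    by (rule dot_eq_0_both[OF _ _ triangle_crs[OF t]])
  then show "x y = of_real (- ?k) * x u" by (simp only: right_minus_eq)
qed

text \<open>Pendants at two corners point opposite to two vectors that form an obtuse angle, so they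
  are adjacent themselves. Then the factor (1 - a)/a is 1, hence a = 1/2, and the third weight 2a -
  1 vanishes.\<close>

lemma two_pendants:
  assumes t: "triangle u v w \<alpha> \<beta> \<gamma>" and y: "y \<in> V" "\<not> E y v" "\<not> E y w" "y \<notin> {u, v, w}"
    and z: "z \<in> V" "\<not> E z u" "\<not> E z w" "z \<notin> {u, v, w}"
  shows False
proof -
  note T = t[unfolded triangle_def]
  let ?k = "(1 - a) / a"
  have t': "triangle v u w \<beta> \<alpha> \<gamma>"
    using t triangle_rotate triangle_swap by blast
  have y': "x y = of_real (- ?k) * x u" "\<alpha> = 1 - a" "E y u"
    using triangle_pendant[OF t, of y] y by auto
  have z': "x z = of_real (- ?k) * x v" "\<beta> = 1 - a" "E z v"
    using triangle_pendant[OF t', of z] z by auto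
  have yz: "y \<noteq> z" using y' z by auto
  have g: "\<gamma> = 2 * a - 1" "\<gamma> > 0" using T y' z' by auto
  have k: "?k > 0" using a_pos a_less_1 by simp
  have "dot (x y) (x z) = - ?k * (- ?k * dot (x v) (x u))"
    unfolding y' z' dot_scale_left dot_commute[of "x u"] dot_scale_left by simp
  also have "dot (x v) (x u) = - a" using gram_E T E_sym by auto
  finally have d: "dot (x y) (x z) = - (?k * ?k * a)" by simp
  moreover have "?k * ?k * a > 0" using k a_pos by (intro mult_pos_pos)
  ultimately have "E y z" using E_iff_dot[of y z] y z yz by simp
  then have "?k * ?k * a = a" using d gram_E y z by simp
  then have "?k * ?k = 1" using a_pos by simp
  then have "?k = 1 \<or> ?k = - 1" by (simp only: square_eq_1_iff)
  then have "?k = 1" using k by linarith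
  then show False using g a_pos by simp
qed

section \<open>Class sizes, and the graphs that contain a triangle\<close>

text \<open>Pairing the zero sum with \<open>x u\<close> gives the first equation. Two members of
  \<open>C\<close> are non-adjacent with a common neighbour, so their inner product 1 - a, which is
  also the squared norm, becomes available.\<close>

lemma class_size:
  assumes C: "C \<subseteq> V" "u \<in> C" "C \<noteq> V" and same: "\<And>y. y \<in> C \<Longrightarrow> x y = x u"
    and nbr: "\<And>y. y \<in> V - C \<Longrightarrow> E u y"
  shows "card C * dot (x u) (x u) = a * (real (card V) - real (card C))"
    and "card C \<ge> 2 \<Longrightarrow> dot (x u) (x u) = 1 - a \<and> card C = a * card V"
proof -
  let ?N = "dot (x u) (x u)"
  have finC: "finite C" using C fin finite_subset by blast
  have le: "card C \<le> card V" using C fin by (simp add: card_mono)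
  have "0 = (\<Sum>y\<in>V. dot (x y) (x u))" using sum_dot by simp
  also have "\<dots> = (\<Sum>y\<in>V - C. dot (x y) (x u)) + (\<Sum>y\<in>C. dot (x y) (x u))"
    using C fin by (simp add: sum.subset_diff)
  also have "(\<Sum>y\<in>C. dot (x y) (x u)) = card C * ?N" using same by simp
  also have "(\<Sum>y\<in>V - C. dot (x y) (x u)) = (\<Sum>y\<in>V - C. - a)"
    using gram_E[of u] nbr C by (intro sum.cong) (auto simp: dot_commute[of _ "x u"])
  also have "\<dots> = - (a * (real (card V) - real (card C)))"
    using C fin finC le by (simp add: card_Diff_subset of_nat_diff)
  finally show s: "card C * ?N = a * (real (card V) - real (card C))" by simp
  assume "card C \<ge> 2"
  then have "\<not> C \<subseteq> {u}" using card_mono[of "{u}" C] by auto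
  then obtain y where y: "y \<in> C" "y \<noteq> u" by auto
  obtain v where v: "v \<in> V" "v \<notin> C" using C by auto
  then have uv: "E u v" using nbr by simp
  have V: "u \<in> V" "y \<in> V" "u \<noteq> v" "y \<noteq> v" using C y v by auto
  have "E y v" using E_iff_dot[of y v] E_iff_dot[of u v] uv same[OF y(1)] V v by simp
  moreover have "\<not> E y u" using E_iff_dot[of y u] x_pos[of u] same[OF y(1)] V y by simp
  ultimately have "dot (x y) (x u) = 1 - a"
    using gram_2[of y v u] y v V uv E_sym[of u v] by simp
  then have "?N = 1 - a" using same[OF y(1)] by simp
  with s show "?N = 1 - a \<and> card C = a * card V" using le by (simp add: of_nat_diff algebra_simps)
qed

text \<open>Class 0 consists of \<open>u\<close> and its twins, class 1 of \<open>v\<close> and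
  \<open>w\<close>, class 2 of the pendants, whose vectors are one negative multiple of
  \<open>x u\<close>. Comparing the norm from \<open>triangle_self\<close> with
  \<open>class_size\<close> leaves two families.\<close>

lemma pendant_case:
  assumes t: "triangle u v w \<alpha> \<beta> \<gamma>" and y0: "y0 \<in> V" "\<not> E y0 v" "\<not> E y0 w" "y0 \<notin> {u, v, w}"
  obtains \<phi> p q where "blowup V E plus_edge [p, 2, q] \<phi>" "p + q + 2 = card V"
    "p = 1 \<and> a = (real (card V) - 1) / real (card V) \<or> p = q + 2 \<and> a = 1 / 2"
proof -
  note T = t[unfolded triangle_def]
  have ne: "u \<noteq> v" "v \<noteq> w" "u \<noteq> w" using T E_neq by auto
  have t': "triangle u w v \<alpha> \<gamma> \<beta>" using triangle_swap[OF t] .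
  let ?k = "(1 - a) / a"
  have k: "?k > 0" using a_pos a_less_1 by simp
  have ag: "\<alpha> = 1 - a" "\<beta> + \<gamma> = a"
    using triangle_pendant[OF t, of y0] y0 by auto
  define \<phi> where "\<phi> y = (if y \<in> {v, w} then 1 else if E y v then 0 else 2 :: nat)" for y
  have out: "E y v \<longleftrightarrow> E y w" "E y u \<or> E y v" if y: "y \<in> V" "y \<notin> {v, w}" "y \<noteq> u" for y
  proof -
    have y': "y \<notin> {u, v, w}" using y by simp
    note o = triangle_outside(2)[OF t y(1) y']
    show "E y v \<longleftrightarrow> E y w"
    proof (cases "E y u")
      case True
      \<comment> \<open>The weights of the non-neighbours add up to a = \<beta> + \<gamma>, which
        neither \<beta> nor \<gamma> reaches alone.\<close>
      have "\<not> (E y v \<and> \<not> E y w)" "\<not> (E y w \<and> \<not> E y v)"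
        using o ag(2) T True by (smt (verit))+
      then show ?thesis by blast
    next
      case False
      show ?thesis
        using two_pendants[OF t, of y0 y] two_pendants[OF t', of y0 y] False y0 y by auto
    qed
    show "E y u \<or> E y v"
      using o ag T \<open>E y v \<longleftrightarrow> E y w\<close> a_less_1 by (auto split: if_splits)
  qed
  have x0: "x y = x u" "E y v" "E y w" if "y \<in> V" "\<phi> y = 0" for y
  proof -
    have *: "y \<notin> {v, w}" "E y v" using that by (auto simp: \<phi>_def split: if_splits)
    then have "y \<noteq> u \<Longrightarrow> E y w" using out that by auto
    then show "E y w" "E y v" using * T by auto
    then show "x y = x u" using triangle_twin[OF t, of y] that by auto
  qed
  have x2: "x y = of_real (- ?k) * x u" "y \<notin> {u, v, w}" "\<not> E y v" "\<not> E y w" "E y u" if "y \<in> V" "\<phi> y = 2" for y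
  proof -
    have *: "y \<notin> {v, w}" "\<not> E y v" using that by (auto simp: \<phi>_def split: if_splits)
    then show o: "y \<notin> {u, v, w}" using T by auto
    then have **: "\<not> E y w" using out(1)[of y] that * by auto
    then show "x y = of_real (- ?k) * x u" "\<not> E y v" "\<not> E y w" "E y u"
      using triangle_pendant[OF t, of y] that * o by auto
  qed
  have x1: "y = v \<or> y = w" if "\<phi> y = 1" for y
    using that by (auto simp: \<phi>_def split: if_splits)
  have ph: "\<phi> y = 0 \<or> \<phi> y = 1 \<or> \<phi> y = 2" for y by (auto simp: \<phi>_def)
  have phi_uvw: "\<phi> u = 0" "\<phi> v = 1" "\<phi> w = 1" using ne T by (auto simp: \<phi>_def)
  let ?N = "dot (x u) (x u)"
  have N: "?N > 0" using x_pos T by simp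
  have N': "(1 - a) * ?N = a * a" using triangle_self[OF t] ag by simp
  have adj: "E y z \<longleftrightarrow> plus_edge (\<phi> y) (\<phi> z)" if y: "y \<in> V" "z \<in> V" "y \<noteq> z" for y z
  proof -
    have 00: "\<not> E y z" if "\<phi> y = 0" "\<phi> z = 0"
      using E_iff_dot[OF y] x0(1)[OF y(1)] x0(1)[OF y(2)] that N by simp
    have 22: "\<not> E y z" if "\<phi> y = 2" "\<phi> z = 2"
    proof -
      have "dot (x y) (x z) = - ?k * (- ?k * ?N)"
        unfolding x2(1)[OF y(1) that(1)] x2(1)[OF y(2) that(2)] dot_scale_left
          dot_commute[of "x u" "of_real _ * _"] ..
      then have "dot (x y) (x z) = ?k * ?k * ?N" by simp
      moreover have "?k * ?k * ?N > 0" using k N by (intro mult_pos_pos)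
      ultimately show ?thesis using E_iff_dot[OF y] by simp
    qed
    have 02: "E y z" if "y \<in> V" "z \<in> V" "y \<noteq> z" "\<phi> y = 0" "\<phi> z = 2" for y z
    proof -
      have "dot (x y) (x z) = dot (x u) (x z)" using x0(1)[of y] that by simp
      also have "\<dots> = - a" using gram_E[of z u] x2(5)[of z] that T by (simp add: dot_commute)
      finally show ?thesis using E_iff_dot[of y z] that a_pos by simp
    qed
    have 01: "E y z" if "y \<in> V" "z \<in> V" "\<phi> y = 0" "\<phi> z = 1" for y z
      using x0[of y] x1[of z] that by auto
    have 21: "\<not> E y z" if "y \<in> V" "z \<in> V" "\<phi> y = 2" "\<phi> z = 1" for y z
      using x2[of y] x1[of z] that by auto
    have 11: "E y z" if "\<phi> y = 1" "\<phi> z = 1"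
      using x1[of y] x1[of z] that y T E_sym[of v w] by auto
    have s: "E y z \<longleftrightarrow> E z y" using E_sym y by simp
    show ?thesis
      using ph[of y] ph[of z] 00 22 02[of y z] 02[of z y] 01[of y z] 01[of z y] 21[of y z] 21[of z y] 11 s y
      by (auto simp: plus_edge_def)
  qed
  define p where "p = card {y \<in> V. \<phi> y = 0}"
  define q where "q = card {y \<in> V. \<phi> y = 2}"
  have c1: "{y \<in> V. \<phi> y = 1} = {v, w}" using x1 phi_uvw T by auto
  have V: "V = {y \<in> V. \<phi> y = 0} \<union> ({v, w} \<union> {y \<in> V. \<phi> y = 2})"
    using ph c1 by auto
  have card: "p + q + 2 = card V"
  proof -
    have "card V = card {y \<in> V. \<phi> y = 0} + card ({v, w} \<union> {y \<in> V. \<phi> y = 2})"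
      by (subst V, subst card_Un_disjoint) (use fin phi_uvw in auto)
    also have "card ({v, w} \<union> {y \<in> V. \<phi> y = 2}) = card {v, w} + q"
      unfolding q_def by (subst card_Un_disjoint) (use fin phi_uvw in auto)
    finally show ?thesis using ne by (simp add: p_def)
  qed
  have b: "blowup V E plus_edge [p, 2, q] \<phi>"
  proof (rule blowupI)
    fix c assume "c < length [p, 2, q]"
    then have "c = 0 \<or> c = 1 \<or> c = 2" by auto
    then show "card {y \<in> V. \<phi> y = c} = [p, 2, q] ! c"
    proof (elim disjE)
      assume "c = 0" then show ?thesis by (simp add: p_def)
    next
      assume "c = 1" then show ?thesis using c1 ne by simp
    next
      assume "c = 2" then show ?thesis by (simp add: q_def)
    qed
  next
    fix y show "\<phi> y < length [p, 2, q]" using ph[of y] by auto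
  qed (use adj in blast)
  let ?C = "{y \<in> V. \<phi> y = 0}"
  have "v \<in> V" "v \<notin> ?C" using T phi_uvw by auto
  then have C: "u \<in> ?C" "?C \<noteq> V" "?C \<subseteq> V" using T phi_uvw by blast+
  have Eu: "E u y" if "y \<in> V - ?C" for y
  proof -
    have y: "y \<in> V" "\<phi> y = 1 \<or> \<phi> y = 2" using that ph[of y] by auto
    then have "E y u" using x1[of y] x2(5)[of y] T E_sym by blast
    then show ?thesis using E_sym y T by blast
  qed
  have "x y = x u" if "y \<in> ?C" for y using x0(1) that by blast
  note size = class_size[OF C(3,1,2) this Eu, folded p_def]
  have "p \<noteq> 0"
  proof
    assume "p = 0"
    then have "?C = {}" unfolding p_def using fin by (simp add: card_eq_0_iff)
    then show False using C(1) by blast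
  qed
  \<comment> \<open>With N the squared norm of \<open>x u\<close>, (1 - a) N = a^2 holds in both
    cases. A singleton class has N = a (n - 1); from two members on N = 1 - a, which forces a =
    1/2.\<close>
  then consider "p = 1" | "p \<ge> 2" by linarith
  then have "p = 1 \<and> a = (real (card V) - 1) / real (card V) \<or> p = q + 2 \<and> a = 1 / 2"
  proof cases
    case 1
    have "?N = a * (real (card V) - 1)" using size(1) unfolding 1 by simp
    then have "(1 - a) * (a * (real (card V) - 1)) = a * a" using N' by simp
    then have "a * ((1 - a) * (real (card V) - 1)) = a * a" by (simp only: mult.left_commute)
    then have "(1 - a) * (real (card V) - 1) = a" using a_pos by (simp only: mult_cancel_left) simp
    then have "a * real (card V) = real (card V) - 1" by (simp add: algebra_simps)
    then have "a = (real (card V) - 1) / real (card V)" using card5 by (simp add: nonzero_eq_divide_eq)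
    then show ?thesis using 1 by blast
  next
    case 2
    then have N1: "?N = 1 - a" and pa: "p = a * card V" using size(2) by blast+
    then have "(1 - a)^2 = a^2" using N' by (simp add: power2_eq_square)
    then have "1 - a = a" using a_pos a_less_1 by (simp add: power2_eq_iff)
    then have a2: "a = 1 / 2" by simp
    have "real p = real (card V) / 2" using pa unfolding a2 by simp
    then have "p = q + 2" unfolding card[symmetric] by simp
    then show ?thesis using a2 by blast
  qed
  then show ?thesis using that b card by blast
qed

text \<open>No outside vertex is adjacent to all three corners, since the missing weights add up to
  a > 0. So each is adjacent to exactly two and has the vector of the third, which makes the graph
  complete tripartite.\<close>

lemma tripartite_case:
  assumes t: "triangle u v w \<alpha> \<beta> \<gamma>"
    and two: "\<And>y. y \<in> V \<Longrightarrow> y \<notin> {u, v, w} \<Longrightarrow> E y u \<and> E y v \<or> E y v \<and> E y w \<or> E y u \<and> E y w"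
  obtains \<phi> p q r where "blowup V E (\<noteq>) [p, q, r] \<phi>" "p + q + r = card V" "p \<ge> 1" "q \<ge> 1" "r \<ge> 1"
    "\<forall>s\<in>{p, q, r}. s \<ge> 2 \<longrightarrow> real s = a * card V" "(\<Sum>y\<in>V. dot (x y) (x y)) = 2 * a * card V"
proof -
  note T = t[unfolded triangle_def]
  have t1: "triangle v w u \<beta> \<gamma> \<alpha>" and t2: "triangle w u v \<gamma> \<alpha> \<beta>"
    using t triangle_rotate by blast+
  define \<phi> where "\<phi> y = (if \<not> E y u then 0 else if \<not> E y v then 1 else 2 :: nat)" for y
  define X where "X c = (if c = (0::nat) then x u else if c = 1 then x v else x w)" for c
  have ph3: "\<phi> y < 3" for y by (simp add: \<phi>_def)
  have xX: "x y = X (\<phi> y)" if y: "y \<in> V" for y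
  proof (cases "y \<in> {u, v, w}")
    case True
    then show ?thesis using T E_irrefl E_sym by (auto simp: \<phi>_def X_def)
  next
    case False
    then have n: "\<not> (E y u \<and> E y v \<and> E y w)"
      using triangle_outside(2)[OF t y False] a_pos by (smt (verit))
    from two[OF y False] consider "E y v" "E y w" | "E y w" "E y u" | "E y u" "E y v" by blast
    then show ?thesis
    proof cases
      case 1
      then show ?thesis using n triangle_twin[OF t y 1] by (simp add: \<phi>_def X_def)
    next
      case 2
      then show ?thesis using n triangle_twin[OF t1 y 2] by (simp add: \<phi>_def X_def)
    next
      case 3
      then show ?thesis using triangle_twin[OF t2 y 3] by (simp add: \<phi>_def X_def)
    qed
  qed
  have phi_uvw: "\<phi> u = 0" "\<phi> v = 1" "\<phi> w = 2" using T E_irrefl E_sym by (auto simp: \<phi>_def)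
  have XX: "dot (X c) (X c') = - a" if "c < 3" "c' < 3" "c \<noteq> c'" for c c'
  proof -
    have "dot (x u) (x v) = - a" "dot (x u) (x w) = - a" "dot (x v) (x w) = - a"
      using T gram_E by auto
    moreover have "c = 0 \<or> c = 1 \<or> c = 2" "c' = 0 \<or> c' = 1 \<or> c' = 2" using that by auto
    ultimately show ?thesis using that(3) by (auto simp: X_def dot_commute)
  qed
  have Xpos: "dot (X c) (X c) > 0" for c using T x_pos by (simp add: X_def)
  have adj: "E y z \<longleftrightarrow> \<phi> y \<noteq> \<phi> z" if "y \<in> V" "z \<in> V" "y \<noteq> z" for y z
    using E_iff_dot[OF that] xX that XX[OF ph3[of y] ph3[of z]] Xpos[of "\<phi> z"] a_pos by auto
  define s where "s c = card {y \<in> V. \<phi> y = c}" for c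
  have split: "sum g V = (\<Sum>c<3. \<Sum>y | y \<in> V \<and> \<phi> y = c. g y)" for g :: "'a \<Rightarrow> real"
    using sum.group[of V "{..<3}" \<phi> g] fin ph3 by (simp add: image_subset_iff)
  have rep: "\<exists>y\<in>V. \<phi> y = c" if "c < 3" for c
  proof -
    have "c = 0 \<or> c = 1 \<or> c = 2" using that by auto
    moreover have "u \<in> V" "v \<in> V" "w \<in> V" using T by auto
    ultimately show ?thesis using phi_uvw by blast
  qed
  have "real (card V) = s 0 + s 1 + s 2"
    using split[of "\<lambda>_. 1"] by (simp add: s_def numeral_3_eq_3 numeral_2_eq_2)
  then have cV: "s 0 + s 1 + s 2 = card V" by linarith
  have size: "s c * dot (X c) (X c) = a * (real (card V) - real (s c))" "s c \<ge> 2 \<longrightarrow> s c = a * card V" "s c \<ge> 1"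
    if c: "c < 3" for c
  proof -
    let ?C = "{y \<in> V. \<phi> y = c}"
    obtain y where y: "y \<in> V" "\<phi> y = c" using rep[OF c] by auto
    have "?C \<noteq> V"
    proof
      assume C: "?C = V"
      have "u \<in> ?C" "v \<in> ?C" unfolding C using T by auto
      then show False using phi_uvw by simp
    qed
    moreover have "?C \<subseteq> V" "y \<in> ?C" using y by auto
    moreover have "x z = x y" if "z \<in> ?C" for z using that y xX by simp
    moreover have "E y z" if "z \<in> V - ?C" for z using that y adj[of y z] by (cases "y = z") auto
    ultimately have "card ?C * dot (x y) (x y) = a * (real (card V) - real (card ?C))"
      "card ?C \<ge> 2 \<Longrightarrow> dot (x y) (x y) = 1 - a \<and> card ?C = a * card V"
      using class_size[of ?C y] by blast+
    then show "s c * dot (X c) (X c) = a * (real (card V) - real (s c))" "s c \<ge> 2 \<longrightarrow> s c = a * card V"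
      unfolding s_def using xX[of y] y by simp_all
    show "s c \<ge> 1" unfolding s_def using y fin by (auto simp: Suc_le_eq card_gt_0_iff)
  qed
  have "(\<Sum>y\<in>V. dot (x y) (x y)) = (\<Sum>c<3. s c * dot (X c) (X c))"
    unfolding split[of "\<lambda>y. dot (x y) (x y)"] using xX by (simp add: s_def)
  also have "\<dots> = s 0 * dot (X 0) (X 0) + s 1 * dot (X 1) (X 1) + s 2 * dot (X 2) (X 2)"
    by (simp add: numeral_3_eq_3 numeral_2_eq_2)
  \<comment> \<open>By \<open>class_size\<close> each class contributes \<open>a\<close> times the
    number of vertices outside it, and every vertex is outside two classes.\<close>
  also have "\<dots> = a * (real (card V) - s 0) + a * (real (card V) - s 1) + a * (real (card V) - s 2)"
    using size(1)[of 0] size(1)[of 1] size(1)[of 2] by simp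
  also have "\<dots> = 2 * a * card V" by (simp add: cV[symmetric] algebra_simps)
  finally have "(\<Sum>y\<in>V. dot (x y) (x y)) = 2 * a * card V" .
  moreover have "blowup V E (\<noteq>) [s 0, s 1, s 2] \<phi>"
  proof (rule blowupI)
    fix c assume "c < length [s 0, s 1, s 2]"
    then have "c = 0 \<or> c = 1 \<or> c = 2" by auto
    then show "card {y \<in> V. \<phi> y = c} = [s 0, s 1, s 2] ! c" by (auto simp: s_def)
  next
    fix y show "\<phi> y < length [s 0, s 1, s 2]" using ph3[of y] by simp
  qed (use adj in blast)
  moreover have "\<forall>k\<in>{s 0, s 1, s 2}. k \<ge> 2 \<longrightarrow> real k = a * card V"
    using size(2)[of 0] size(2)[of 1] size(2)[of 2] by simp
  moreover have "s 0 \<ge> 1" "s 1 \<ge> 1" "s 2 \<ge> 1" using size(3) by simp_all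
  ultimately show ?thesis using that cV by blast
qed

end

section \<open>Triangle-free graphs\<close>

definition pentagon :: "nat \<Rightarrow> nat \<Rightarrow> bool" where
  "pentagon i j \<longleftrightarrow> j = (i + 1) mod 5 \<or> i = (j + 1) mod 5"

context planar_distance begin

section \<open>Complete bipartite graphs\<close>

text \<open>When \<open>Q\<close> carries a single vector, the components of the vectors of
  \<open>P\<close> orthogonal to it have constant pairwise products and sum zero. If
  \<open>P\<close> had at least three vertices, or only one, all of these components would vanish,
  contrary to spanning; so \<open>P\<close> has exactly two.\<close>

lemma bipartite_one_sided:
  assumes PQ: "P \<union> Q = V" "P \<inter> Q = {}" "p0 \<in> P" "v \<in> Q"
    and E: "\<And>p q. p \<in> P \<Longrightarrow> q \<in> Q \<Longrightarrow> E p q"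
    and indep: "\<And>p p'. p \<in> P \<Longrightarrow> p' \<in> P \<Longrightarrow> \<not> E p p'" "\<And>q q'. q \<in> Q \<Longrightarrow> q' \<in> Q \<Longrightarrow> \<not> E q q'"
    and same: "\<And>q. q \<in> Q \<Longrightarrow> x q = x v"
  obtains \<phi> where "blowup V E (\<noteq>) [card V - 2, 2] \<phi>" "a = (real (card V) - 2) / real (card V)"
    "(\<Sum>y\<in>V. dot (x y) (x y)) = 2 * real (card V) - 6"
proof -
  have fPQ: "finite P" "finite Q" using PQ fin by (auto intro: finite_subset)
  have cV: "card V = card P + card Q" using PQ fPQ by (metis card_Un_disjoint)
  have EQ: "E q p" if "p \<in> P" "q \<in> Q" for p q using E[OF that] E_sym[of p q] that PQ by auto
  define f where "f y = crs (x v) (x y)" for y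
  have fQ: "f q = 0" if "q \<in> Q" for q using same[OF that] by (simp add: f_def)
  have PP: "dot (x p) (x p') = 1 - a" if "p \<in> P" "p' \<in> P" "p \<noteq> p'" for p p'
    using gram_2[of p v p'] that PQ E EQ indep by auto
  have Pv: "dot (x p) (x v) = - a" if "p \<in> P" for p
    using gram_E[of p v] that PQ E by auto
  have f0: "sum f P = 0"
  proof -
    have "sum f V = 0" unfolding f_def using crs_sum_right[of "x v" x V] sum_zero by (simp add: crs_def)
    moreover have "sum f V = sum f P + sum f Q"
      using PQ fPQ by (metis sum.union_disjoint)
    moreover have "sum f Q = 0" using fQ by simp
    ultimately show ?thesis by simp
  qed
  obtain r where r: "r \<in> V" "f r \<noteq> 0"
    using not_col[of "x v"] x_neq_0[of v] PQ by (auto simp: f_def)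
  then have rP: "r \<in> P" using fQ PQ by auto
  have "\<not> card P \<ge> 3"
  proof
    assume "card P \<ge> 3"
    then have "f r = 0"
    proof (rule const_products_zero[OF fPQ(1) _ _ f0 rP])
      fix p q assume "p \<in> P" "q \<in> P" "p \<noteq> q"
      then show "f p * f q = dot (x v) (x v) * (1 - a) - a * a"
        using crs_mult_crs[of "x v" "x p" "x q"] by (simp add: f_def PP Pv)
    qed
    then show False using r by simp
  qed
  moreover have "card P \<noteq> 1"
  proof
    assume "card P = 1"
    then obtain t where "P = {t}" by (auto simp: card_1_singleton_iff)
    then show False using f0 r rP by auto
  qed
  moreover have "card P \<noteq> 0" using PQ fPQ by auto
  ultimately have cP: "card P = 2" by linarith
  then obtain s t where st: "P = {s, t}" "s \<noteq> t" by (auto simp: card_2_iff)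
  have cQ: "card Q = card V - 2" "card Q \<ge> 2" using cV cP card5 by auto
  have "Q \<subseteq> V" "Q \<noteq> V" using PQ by auto
  from class_size(2)[OF this(1) PQ(4) this(2) same _ cQ(2)]
  have N: "dot (x v) (x v) = 1 - a" and cQa: "card Q = a * card V"
    using EQ PQ by auto
  have P1: "dot (x p) (x p) = a * card Q - (1 - a)" if "p \<in> P" for p
  proof -
    have "0 = (\<Sum>y\<in>V. dot (x y) (x p))" using sum_dot by simp
    also have "\<dots> = (\<Sum>y\<in>P. dot (x y) (x p)) + (\<Sum>y\<in>Q. dot (x y) (x p))"
      using PQ fPQ by (metis sum.union_disjoint)
    also have "(\<Sum>y\<in>Q. dot (x y) (x p)) = (\<Sum>y\<in>Q. - a)"
      using same Pv[OF that] by (intro sum.cong) (auto simp: dot_commute)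
    also have "(\<Sum>y\<in>P. dot (x y) (x p)) = dot (x p) (x p) + (1 - a)"
      using st that PP by (auto simp: dot_commute)
    finally show ?thesis by (simp add: mult.commute)
  qed
  have "(\<Sum>y\<in>V. dot (x y) (x y)) = (\<Sum>y\<in>P. dot (x y) (x y)) + (\<Sum>y\<in>Q. dot (x y) (x y))"
    using PQ fPQ by (metis sum.union_disjoint)
  also have "(\<Sum>y\<in>P. dot (x y) (x y)) = 2 * (a * card Q - (1 - a))" using P1 cP by simp
  also have "(\<Sum>y\<in>Q. dot (x y) (x y)) = card Q * (1 - a)" using same N by simp
  finally have S: "(\<Sum>y\<in>V. dot (x y) (x y)) = 2 * (a * card Q - (1 - a)) + card Q * (1 - a)" .
  have n: "real (card V) = card Q + 2" using cV cP by simp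
  have aq: "card Q = a * card Q + 2 * a" using cQa n by (simp add: algebra_simps)
  have S': "(\<Sum>y\<in>V. dot (x y) (x y)) = 2 * real (card V) - 6"
    unfolding S n using aq by (simp add: algebra_simps)
  have "a = (real (card V) - 2) / real (card V)" using cQa cQ card5 by (simp add: field_simps)
  moreover have "blowup V E (\<noteq>) [card V - 2, 2] (\<lambda>y. if y \<in> Q then 0 else 1)"
  proof (rule blowupI)
    fix c assume "c < length [card V - 2, 2]"
    then have "c = 0 \<or> c = 1" by auto
    moreover have "{y \<in> V. (if y \<in> Q then 0 else 1) = (0::nat)} = Q"
      "{y \<in> V. (if y \<in> Q then 0 else 1) = (1::nat)} = P" using PQ by auto
    ultimately show "card {y \<in> V. (if y \<in> Q then 0 else 1) = c} = [card V - 2, 2] ! c"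
      using cQ cP by (elim disjE) simp_all
  next
    fix y z assume "y \<in> V" "z \<in> V"
    then show "E y z \<longleftrightarrow> (if y \<in> Q then 0 else 1) \<noteq> (if z \<in> Q then 0 else (1::nat))"
      using PQ E EQ indep by auto
  qed auto
  ultimately show ?thesis using that S' by blast
qed

text \<open>One part must carry a single vector: differences within a part are orthogonal to all
  vectors of the other part. If both parts had a nonzero difference, that of \<open>Q\<close> would
  be orthogonal to that of \<open>P\<close> and to \<open>x p\<close>, and these two are
  independent.\<close>

lemma bipartite_case:
  assumes PQ: "P \<union> Q = V" "P \<inter> Q = {}" "P \<noteq> {}" "Q \<noteq> {}"
    and E: "\<And>p q. p \<in> P \<Longrightarrow> q \<in> Q \<Longrightarrow> E p q"
    and indep: "\<And>p p'. p \<in> P \<Longrightarrow> p' \<in> P \<Longrightarrow> \<not> E p p'" "\<And>q q'. q \<in> Q \<Longrightarrow> q' \<in> Q \<Longrightarrow> \<not> E q q'"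
  obtains \<phi> where "blowup V E (\<noteq>) [card V - 2, 2] \<phi>" "a = (real (card V) - 2) / real (card V)"
    "(\<Sum>y\<in>V. dot (x y) (x y)) = 2 * real (card V) - 6"
proof -
  obtain p q where pq: "p \<in> P" "q \<in> Q" using PQ by auto
  have EQ: "E q p" if "p \<in> P" "q \<in> Q" for p q using E[OF that] E_sym[of p q] that PQ by auto
  consider "\<forall>q'\<in>Q. x q' = x q" | "\<forall>p'\<in>P. x p' = x p"
  proof -
    have False if "q' \<in> Q" "x q' \<noteq> x q" "p' \<in> P" "x p' \<noteq> x p" for p' q'
    proof -
      have d: "dot (x r) (x s) = - a" if "r \<in> P" "s \<in> Q" for r s
        using gram_E[of r s] E that PQ by auto
      let ?\<delta> = "x p' - x p" and ?\<epsilon> = "x q' - x q"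
      have "dot ?\<delta> (x q) = 0" using d that pq by (simp add: dot_diff_left)
      then have "crs ?\<delta> (x p) * crs ?\<delta> (x q) = dot ?\<delta> ?\<delta> * (- a)"
        using crs_mult_crs[of ?\<delta> "x p" "x q"] d[OF pq] by (simp add: dot_commute)
      moreover have "dot ?\<delta> ?\<delta> * (- a) \<noteq> 0" using that a_pos by (simp add: dot_self_eq_0)
      ultimately have c: "crs ?\<delta> (x p) \<noteq> 0" by auto
      have "dot (x q') ?\<delta> = 0" "dot (x q) ?\<delta> = 0" "dot (x q') (x p) = - a" "dot (x q) (x p) = - a"
        using d that pq by (simp_all add: dot_diff_left dot_commute[of "x q"] dot_commute[of "x q'"])
      then have "dot ?\<epsilon> ?\<delta> = 0" "dot ?\<epsilon> (x p) = 0" by (simp_all add: dot_diff_left)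
      from dot_eq_0_both[OF this c] show False using that by simp
    qed
    then show thesis using that by blast
  qed
  then show ?thesis
  proof cases
    case 1
    then show ?thesis
      using bipartite_one_sided[OF PQ(1,2) pq(1,2) E indep] that by blast
  next
    case 2
    have "Q \<union> P = V" "Q \<inter> P = {}" using PQ by auto
    then show ?thesis
      using bipartite_one_sided[of Q P q p, OF _ _ pq(2,1) EQ indep(2,1)] 2 that by blast
  qed
qed

section \<open>Induced paths on four vertices\<close>

definition induced_P4 :: "'a \<Rightarrow> 'a \<Rightarrow> 'a \<Rightarrow> 'a \<Rightarrow> bool" where
  "induced_P4 u v w z \<longleftrightarrow> u \<in> V \<and> v \<in> V \<and> w \<in> V \<and> z \<in> V \<and> distinct [u, v, w, z] \<and>
     E u v \<and> E v w \<and> E w z \<and> \<not> E u w \<and> \<not> E v z \<and> \<not> E u z"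

lemma induced_P4_rev: "induced_P4 u v w z \<Longrightarrow> induced_P4 z w v u"
  unfolding induced_P4_def using E_sym by auto

text \<open>\<open>u\<close> and \<open>z\<close> lie on the same side of the line spanned by
  \<open>x w\<close>, which gives the sign of \<beta>; pairing the expansion with \<open>x v\<close>
  gives the equation for \<alpha>.\<close>

lemma P4_cone:
  assumes P: "induced_P4 u v w z"
  obtains \<alpha> \<beta> where "x u = of_real \<alpha> * x w + of_real \<beta> * x z" "a * \<alpha> = a + \<beta> * (1 - a)" "\<beta> > 0"
    "crs (x w) (x z) \<noteq> 0"
proof -
  note p = P[unfolded induced_P4_def]
  let ?c = "crs (x w) (x z)"
  have uz: "dot (x u) (x z) > 0" using not_E_dot p by auto
  have uw: "dot (x u) (x w) > 0" using not_E_dot p by auto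
  have zw: "dot (x z) (x w) = - a" using gram_E[of w z] p by (simp add: dot_commute)
  have vu: "dot (x u) (x v) = - a" "dot (x w) (x v) = - a"
    using gram_E[of u v] gram_E[of v w] p by (auto simp: dot_commute)
  have vz: "dot (x z) (x v) = 1 - a" using gram_2[of v w z] p by (auto simp: dot_commute)
  have "crs (x w) (x u) * ?c = dot (x w) (x w) * dot (x u) (x z) + a * dot (x u) (x w)"
    using crs_mult_crs[of "x w" "x u" "x z"] zw by simp
  also have "\<dots> > 0" using uz uw x_pos[of w] p a_pos by (simp add: add_pos_pos)
  finally have pos: "crs (x w) (x u) * ?c > 0" .
  define \<alpha> where "\<alpha> = crs (x u) (x z) / ?c"
  define \<beta> where "\<beta> = crs (x w) (x u) / ?c"
  have c: "?c \<noteq> 0" using pos by auto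
  have "of_real ?c * x u = of_real (crs (x u) (x z)) * x w + of_real (crs (x w) (x u)) * x z"
    by (simp add: crs_def complex_eq_iff algebra_simps)
  then have eq: "x u = of_real \<alpha> * x w + of_real \<beta> * x z"
    using c by (simp add: \<alpha>_def \<beta>_def divide_simps mult.commute)
  have "\<beta> > 0" using pos c by (auto simp: \<beta>_def zero_less_divide_iff zero_less_mult_iff)
  have "dot (x u) (x v) = \<alpha> * dot (x w) (x v) + \<beta> * dot (x z) (x v)"
    unfolding eq by (simp add: dot_add_left dot_scale_left)
  then have "a * \<alpha> = a + \<beta> * (1 - a)" unfolding vu vz by (simp add: mult.commute)
  with eq \<open>\<beta> > 0\<close> c that show ?thesis by blast
qed

text \<open>The expansion of \<open>x u\<close> paired with \<open>x y\<close>, multiplied by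
  \<open>a\<close> so that \<alpha> can be eliminated. About \<beta> only the sign is kept, which is
  enough to restrict how \<open>y\<close> attaches to the path.\<close>

lemma P4_relation:
  assumes P: "induced_P4 u v w z"
  obtains \<beta> where "\<beta> > 0" "\<And>y. y \<in> V \<Longrightarrow> y \<notin> {u, w, z} \<Longrightarrow>
    a * (real (d y u) - real (d y w)) =
      \<beta> * ((1 - a) * (real (d y w) - 1 - a) + a * (real (d y z) - 1 - a))"
proof -
  note p = P[unfolded induced_P4_def]
  obtain \<alpha> \<beta> where ab: "x u = of_real \<alpha> * x w + of_real \<beta> * x z" "a * \<alpha> = a + \<beta> * (1 - a)" "\<beta> > 0"
    by (rule P4_cone[OF P])
  show ?thesis
  proof (rule that[OF ab(3)])
    fix y assume y: "y \<in> V" "y \<notin> {u, w, z}"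
    have g: "dot (x u) (x y) = real (d y u) - 1 - a" "dot (x w) (x y) = real (d y w) - 1 - a"
      "dot (x z) (x y) = real (d y z) - 1 - a"
      using gram[of y u] gram[of y w] gram[of y z] y p by (auto simp: dot_commute)
    have "dot (x u) (x y) = \<alpha> * dot (x w) (x y) + \<beta> * dot (x z) (x y)"
      by (subst ab(1)) (simp add: dot_add_left dot_scale_left)
    then have "a * (real (d y u) - 1 - a) = (a * \<alpha>) * (real (d y w) - 1 - a) + a * \<beta> * (real (d y z) - 1 - a)"
      unfolding g by Groebner_Basis.algebra
    then show "a * (real (d y u) - real (d y w)) =
      \<beta> * ((1 - a) * (real (d y w) - 1 - a) + a * (real (d y z) - 1 - a))"
      unfolding ab(2) by Groebner_Basis.algebra
  qed
qed

end

locale triangle_free_planar_distance = planar_distance +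
  assumes no_triangle: "u \<in> V \<Longrightarrow> v \<in> V \<Longrightarrow> w \<in> V \<Longrightarrow> E u v \<Longrightarrow> E v w \<Longrightarrow> E u w \<Longrightarrow> False"
begin

text \<open>A comparison of signs in \<open>P4_relation\<close>. For the distances from
  \<open>y\<close> to \<open>w\<close> and \<open>z\<close>, the bracket is 0 at 1 and 2, equals 1 -
  2a at 2 and 1, and is positive if both are at least 2.\<close>

lemma P4_end_types:
  assumes P: "induced_P4 u v w z" and y: "y \<in> V" "y \<notin> {u, v, w, z}"
  shows "E y w \<Longrightarrow> E y u" and "E y u \<Longrightarrow> \<not> E y w \<Longrightarrow> E y z \<and> a > 1 / 2" and "E y v \<Longrightarrow> E y z \<Longrightarrow> a = 1 / 2"
proof -
  note p = P[unfolded induced_P4_def]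
  obtain \<beta> where b: "\<beta> > 0" and rel: "a * (real (d y u) - real (d y w)) =
      \<beta> * ((1 - a) * (real (d y w) - 1 - a) + a * (real (d y z) - 1 - a))"
    using P4_relation[OF P] y by (metis insert_iff)
  show "E y u" if "E y w"
  proof -
    have "\<not> E y z" using no_triangle[of y w z] that y p by auto
    then have "d y z = 2" using d_eq_2[of y w z] that y p by auto
    then have "a * (real (d y u) - 1) = 0" using rel that by simp
    then show ?thesis using a_pos by simp
  qed
  show "E y z \<and> a > 1 / 2" if yu: "E y u" and nw: "\<not> E y w"
  proof -
    have w2: "d y w \<ge> 2" using d_eq_0[of y w] nw y p by (cases "d y w") auto
    have neg: "a * (real (d y u) - real (d y w)) < 0" using yu w2 a_pos by (simp add: mult_pos_neg)
    have yz: "E y z"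
    proof (rule ccontr)
      assume "\<not> E y z"
      then have "d y z \<ge> 2" using d_eq_0[of y z] y p by (cases "d y z") auto
      then have "(1 - a) * (real (d y w) - 1 - a) > 0" "a * (real (d y z) - 1 - a) > 0"
        using w2 a_pos a_less_1 by auto
      then have "\<beta> * ((1 - a) * (real (d y w) - 1 - a) + a * (real (d y z) - 1 - a)) > 0"
        using b by simp
      then show False using rel neg by simp
    qed
    then have "d y w = 2" using d_eq_2[of y z w] E_sym[of w z] nw y p by auto
    then have "\<beta> * ((1 - a) * (1 - a) + a * (- a)) < 0" using rel neg yz by simp
    then have "(1 - a) * (1 - a) + a * (- a) < 0" using b by (simp add: mult_less_0_iff)
    then show ?thesis using yz by (simp add: algebra_simps)
  qed
  show "a = 1 / 2" if yv: "E y v" and yz: "E y z"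
  proof -
    have "\<not> E y u" "\<not> E y w" using no_triangle[of y v u] no_triangle[of y v w] E_sym[of u v] yv y p by auto
    then have "d y u = 2" "d y w = 2"
      using d_eq_2[of y v u] d_eq_2[of y v w] E_sym[of u v] yv y p by auto
    then have "(1 - a) * (1 - a) + a * (- a) = 0" using rel yz b by simp
    then show ?thesis by (simp add: algebra_simps)
  qed
qed

lemma P4_types:
  assumes P: "induced_P4 u v w z" and y: "y \<in> V" "y \<notin> {u, v, w, z}"
  shows "E y u \<and> E y w \<and> \<not> E y v \<and> \<not> E y z \<and> a = 1 / 2 \<or>
    E y v \<and> E y z \<and> \<not> E y u \<and> \<not> E y w \<and> a = 1 / 2 \<or>
    E y u \<and> E y z \<and> \<not> E y v \<and> \<not> E y w \<and> a > 1 / 2 \<or>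
    \<not> E y u \<and> \<not> E y v \<and> \<not> E y w \<and> \<not> E y z"
proof -
  note p = P[unfolded induced_P4_def]
  have "\<not> (E y u \<and> E y v)" "\<not> (E y v \<and> E y w)" "\<not> (E y w \<and> E y z)"
    using no_triangle[of y u v] no_triangle[of y v w] no_triangle[of y w z] y p by auto
  moreover have "y \<notin> {z, w, v, u}" using y by auto
  ultimately show ?thesis
    using P4_end_types[OF P y] P4_end_types[OF induced_P4_rev[OF P] y(1)] by argo
qed

text \<open>At a = 1/2 the values -a and 1 - a cancel. All vertices other than the ends have the
  vector of \<open>v\<close> or of \<open>w\<close> and contribute 0 when the zero sum is paired
  with \<open>x u + x z\<close>, while the two ends together contribute a positive amount.\<close>

lemma P4_half:
  assumes P: "induced_P4 u v w z" and a: "a = 1 / 2"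
  shows False
proof -
  have tw: "x y = x v" if P: "induced_P4 u v w z" and y: "y \<in> V" "E y u" "E y w" for u v w z y
  proof -
    note p = P[unfolded induced_P4_def]
    have c: "crs (x w) (x z) \<noteq> 0" by (rule P4_cone[OF P])
    have "\<not> E y z" using no_triangle[of y w z] y p by auto
    moreover have "y \<noteq> z" using y p E_sym by auto
    ultimately have "dot (x y) (x z) = 1 - a" "dot (x v) (x z) = 1 - a"
      using gram_2[of y w z] gram_2[of v w z] y p by auto
    moreover have "dot (x y) (x w) = - a" "dot (x v) (x w) = - a" using gram_E y p by auto
    ultimately have "x y - x v = 0" by (intro dot_eq_0_both[OF _ _ c]) (auto simp: dot_diff_left)
    then show ?thesis by simp
  qed
  note p = P[unfolded induced_P4_def]
  let ?A = "{y \<in> V. E y u \<and> E y w}" and ?B = "{y \<in> V. E y v \<and> E y z}"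
  have A: "x y = x v" if "y \<in> ?A" for y using tw[OF P] that by auto
  have B: "x y = x w" if "y \<in> ?B" for y using tw[OF induced_P4_rev[OF P]] that by auto
  have vA: "v \<in> ?A" and wB: "w \<in> ?B" using p E_sym by auto
  \<comment> \<open>The set is closed under adjacency: a new vertex next to a twin of
    \<open>v\<close> or \<open>w\<close> would be adjacent to \<open>v\<close> or \<open>w\<close>
    itself, which \<open>P4_types\<close> excludes.\<close>
  have all: "{u, z} \<union> (?A \<union> ?B) = V" (is "?S = V")
  proof (rule ccontr)
    assume "?S \<noteq> V"
    moreover have "?S \<subseteq> V" "?S \<noteq> {}" using p by auto
    ultimately obtain s y where s: "s \<in> ?S" "y \<in> V" "y \<notin> ?S" "E s y"
      using cut[of ?S] by blast
    have sy: "s \<in> V" "s \<noteq> y" using s p by blast+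
    have y: "y \<notin> {u, v, w, z}" using s vA wB by blast
    have "\<not> (E y u \<and> E y w)" "\<not> (E y v \<and> E y z)" "\<not> a > 1 / 2" using s a by auto
    then have n: "\<not> E y u" "\<not> E y v" "\<not> E y w" "\<not> E y z"
      using P4_types[OF P s(2) y] by blast+
    have ne: "v \<noteq> y" "w \<noteq> y" using y by auto
    have nv: "\<not> E v y" "\<not> E w y" "\<not> E u y" "\<not> E z y" using n E_sym p s by blast+
    have "s \<notin> ?A"
    proof
      assume "s \<in> ?A"
      then have "dot (x v) (x y) < 0" using E_iff_dot[OF sy(1) s(2) sy(2)] s(4) A by simp
      then show False using E_iff_dot[of v y] ne nv p s(2) by blast
    qed
    moreover have "s \<notin> ?B"
    proof
      assume "s \<in> ?B"
      then have "dot (x w) (x y) < 0" using E_iff_dot[OF sy(1) s(2) sy(2)] s(4) B by simp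
      then show False using E_iff_dot[of w y] ne nv p s(2) by blast
    qed
    ultimately show False using s(1,4) nv by blast
  qed
  let ?g = "\<lambda>y. dot (x y) (x u) + dot (x y) (x z)"
  have vg: "dot (x v) (x u) = - a" "dot (x v) (x z) = 1 - a"
    and wg: "dot (x w) (x u) = 1 - a" "dot (x w) (x z) = - a"
    using gram_E[of u v] gram_E[of w z] gram_2[of v w z] gram_2[of u v w] p by (simp_all add: dot_commute)
  have "?g v = 0" "?g w = 0" unfolding vg wg a by simp_all
  then have "?g y = 0" if "y \<in> ?A \<union> ?B" for y
    using that by (elim UnE) (simp_all only: A B)
  then have g0: "sum ?g (?A \<union> ?B) = 0" by (rule sum.neutral[OF ballI])
  have "\<not> E u u" "\<not> E z z" "\<not> E z u" using p E_irrefl E_sym by blast+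
  then have disj: "{u, z} \<inter> (?A \<union> ?B) = {}" using p by blast
  have "0 = sum ?g V" by (simp add: sum.distrib sum_dot)
  also have "\<dots> = sum ?g ({u, z} \<union> (?A \<union> ?B))" unfolding all ..
  also have "\<dots> = sum ?g {u, z} + sum ?g (?A \<union> ?B)"
    using fin by (intro sum.union_disjoint disj) simp_all
  also have "\<dots> = sum ?g {u, z}" unfolding g0 by simp
  also have "\<dots> = dot (x u) (x u) + dot (x z) (x z) + 2 * dot (x u) (x z)"
    using p by (simp add: dot_commute[of "x z" "x u"])
  also have "\<dots> > 0" using x_pos[of u] x_pos[of z] not_E_dot[of u z] p by simp
  finally show False by simp
qed

text \<open>With a = 1/2 excluded, an outside vertex adjacent to an induced path is adjacent to
  exactly its two ends. The first such vertex closes a pentagon; a further one would break this rule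
  for some path inside the pentagon.\<close>

lemma P4_pentagon:
  assumes P: "induced_P4 u v w z"
  obtains \<phi> where "blowup V E pentagon [1, 1, 1, 1, 1] \<phi>" "card V = 5" "5 * a\<^sup>2 - 5 * a + 1 = 0"
proof -
  note p = P[unfolded induced_P4_def]
  have types: "E y u \<and> E y z \<and> \<not> E y v \<and> \<not> E y w \<or> \<not> E y u \<and> \<not> E y v \<and> \<not> E y w \<and> \<not> E y z"
    if "induced_P4 u v w z" "y \<in> V" "y \<notin> {u, v, w, z}" for u v w z y
    using P4_types[OF that] P4_half[OF that(1)] by blast
  obtain s y where s: "s \<in> {u, v, w, z}" "y \<in> V" "y \<notin> {u, v, w, z}" "E s y"
    using escape[of "[u, v, w, z]"] p by auto
  then have y: "E y u" "E y z" "\<not> E y v" "\<not> E y w" using types[OF P s(2,3)] E_sym p by auto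
  have sy: "E u y" "E z y" "\<not> E v y" "\<not> E w y" using y E_sym s p by auto
  have rev: "E v u" "E w v" "E z w" "\<not> E w u" "\<not> E z v" "\<not> E z u" using p E_sym by auto
  have ne: "y \<noteq> u" "y \<noteq> v" "y \<noteq> w" "z \<noteq> y" "z \<noteq> u" "z \<noteq> v" using s(3) p by auto
  have P1: "induced_P4 y u v w" and P2: "induced_P4 z y u v"
    unfolding induced_P4_def using p y s(2) sy rev ne by simp_all
  have V: "V = {u, v, w, z, y}" (is "V = ?S")
  proof (rule ccontr)
    assume "V \<noteq> ?S"
    moreover have "?S \<subseteq> V" "?S \<noteq> {}" using p s by auto
    ultimately obtain r g where g: "r \<in> ?S" "g \<in> V" "g \<notin> ?S" "E r g" using cut[of ?S] by blast
    have "r \<in> V" using g(1) s p by blast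
    then have gr: "E g r" using g E_sym by blast
    have n: "\<not> (E g u \<and> E g y)" using no_triangle[of g u y] sy s g p by blast
    have "g \<notin> {u, v, w, z}" "g \<notin> {y, u, v, w}" "g \<notin> {z, y, u, v}" using g(3) by simp_all
    from types[OF P g(2) this(1)] types[OF P1 g(2) this(2)] types[OF P2 g(2) this(3)]
    have "\<not> E g u" "\<not> E g v" "\<not> E g w" "\<not> E g z" "\<not> E g y" using n by blast+
    then show False using g(1) gr by blast
  qed
  have dist: "distinct [u, v, w, z, y]" using p s by auto
  define \<phi> where "\<phi> g = (if g = u then 0 else if g = v then 1 else if g = w then 2 else if g = z then 3 else 4 :: nat)" for g
  have \<phi>: "\<phi> u = 0" "\<phi> v = 1" "\<phi> w = 2" "\<phi> z = 3" "\<phi> y = 4" using dist by (auto simp: \<phi>_def)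
  have "blowup V E pentagon [1, 1, 1, 1, 1] \<phi>"
  proof (rule blowupI)
    fix c assume "c < length [1, 1, 1, 1, 1 :: nat]"
    then have "c = 0 \<or> c = 1 \<or> c = 2 \<or> c = 3 \<or> c = 4" by auto
    moreover have "{g \<in> {u, v, w, z, y}. \<phi> g = 0} = {u}" "{g \<in> {u, v, w, z, y}. \<phi> g = 1} = {v}"
      "{g \<in> {u, v, w, z, y}. \<phi> g = 2} = {w}" "{g \<in> {u, v, w, z, y}. \<phi> g = 3} = {z}"
      "{g \<in> {u, v, w, z, y}. \<phi> g = 4} = {y}"
      using \<phi> by auto
    ultimately show "card {g \<in> V. \<phi> g = c} = [1, 1, 1, 1, 1] ! c"
      unfolding V by (elim disjE) (simp_all only: card_1_singleton_iff, simp_all)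
  next
    fix g h assume "g \<in> V" "h \<in> V" and gh: "g \<noteq> h"
    then have "g = u \<or> g = v \<or> g = w \<or> g = z \<or> g = y" "h = u \<or> h = v \<or> h = w \<or> h = z \<or> h = y"
      using V by blast+
    moreover have "E u v" "E v w" "E w z" "\<not> E u w" "\<not> E v z" "\<not> E u z" using p by blast+
    ultimately show "E g h \<longleftrightarrow> pentagon (\<phi> g) (\<phi> h)"
      using gh rev y sy by (elim disjE) (simp_all add: \<phi> pentagon_def)
  next
    fix g show "\<phi> g < length [1, 1, 1, 1, 1 :: nat]" by (simp add: \<phi>_def)
  qed
  moreover have "card V = 5" using dist by (simp add: V)
  moreover have "5 * a\<^sup>2 - 5 * a + 1 = 0"
  proof -
    obtain \<alpha> \<beta> where ab: "x u = of_real \<alpha> * x w + of_real \<beta> * x z" "a * \<alpha> = a + \<beta> * (1 - a)" "\<beta> > 0"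
      by (rule P4_cone[OF P])
    have ne: "w \<noteq> u" "z \<noteq> u" "w \<noteq> y" using dist by auto
    have d: "dot (x v) (x u) = - a" "dot (x y) (x u) = - a" "dot (x w) (x u) = 1 - a" "dot (x z) (x u) = 1 - a"
      "dot (x w) (x y) = 1 - a" "dot (x z) (x y) = - a"
      using gram_E[of v u] gram_E[of y u] gram_2[of w v u] gram_2[of z y u] gram_2[of w z y] gram_E[of z y]
        p rev y sy s ne by simp_all
    \<comment> \<open>The zero sum fixes the norm of \<open>x u\<close>. The expansion of
      \<open>x u\<close>, paired with \<open>x u\<close> and \<open>x y\<close>, and the relation
      from \<open>P4_cone\<close> then give three equations in a, \<alpha> and \<beta>, which yield
      the quadratic.\<close>
    have "0 = (\<Sum>g\<in>V. dot (x g) (x u))" using sum_dot by simp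
    also have "\<dots> = dot (x u) (x u) + 2 * (1 - a) - 2 * a" using dist by (simp add: V d)
    finally have N: "dot (x u) (x u) = 4 * a - 2" by simp
    have "dot (x u) q = \<alpha> * dot (x w) q + \<beta> * dot (x z) q" for q
      by (subst ab(1)) (simp add: dot_add_left dot_scale_left)
    from this[of "x u"] this[of "x y"]
    have "4 * a - 2 = \<alpha> * (1 - a) + \<beta> * (1 - a)" and 2: "- a = \<alpha> * (1 - a) - \<beta> * a"
      unfolding N d dot_commute[of "x u" "x y"] by simp_all
    then have 1: "4 * a - 2 = (\<alpha> + \<beta>) * (1 - a)" by (simp only: distrib_right)
    have "a * (- a) = (a * \<alpha>) * (1 - a) - a * (\<beta> * a)"
      by (subst 2) (simp add: algebra_simps)
    then have 3: "\<beta> * (2 * a - 1) = a" unfolding ab(2) by (simp add: algebra_simps)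
    have "a * (4 * a - 2) = (a * \<alpha> + a * \<beta>) * (1 - a)" by (subst 1) (simp add: algebra_simps)
    then have "a * (4 * a - 2) = (a + \<beta>) * (1 - a)" unfolding ab(2) by (simp add: algebra_simps)
    then have "a * (4 * a - 2) * (2 * a - 1) = (a + \<beta>) * (1 - a) * (2 * a - 1)" by simp
    also have "\<dots> = (a * (2 * a - 1) + \<beta> * (2 * a - 1)) * (1 - a)" by (simp add: algebra_simps)
    finally have "2 * a * (2 * a - 1)\<^sup>2 = 2 * a * (a * (1 - a))"
      unfolding 3 by (simp add: algebra_simps power2_eq_square)
    then have "(2 * a - 1)\<^sup>2 = a * (1 - a)" using a_pos by (simp only: mult_cancel_left) simp
    then show ?thesis by (simp add: algebra_simps power2_eq_square)
  qed
  ultimately show ?thesis using that by blast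
qed

text \<open>Without triangles the neighbourhoods of the two ends of an edge are disjoint and
  independent. A missing edge between them, or a vertex outside both, yields the induced path;
  otherwise they are the parts of a complete bipartite graph.\<close>

lemma bipartite_or_P4:
  obtains u v w z where "induced_P4 u v w z"
  | P Q where "P \<union> Q = V" "P \<inter> Q = {}" "P \<noteq> {}" "Q \<noteq> {}" "\<And>p q. p \<in> P \<Longrightarrow> q \<in> Q \<Longrightarrow> E p q"
    "\<And>p p'. p \<in> P \<Longrightarrow> p' \<in> P \<Longrightarrow> \<not> E p p'" "\<And>q q'. q \<in> Q \<Longrightarrow> q' \<in> Q \<Longrightarrow> \<not> E q q'"
proof -
  note P4_thesis = that(1)
  obtain v where v: "v \<in> V" using card5 by fastforce
  obtain w where w: "w \<in> V" "E v w" using nbr[OF v] by blast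
  have wv: "E w v" using v w E_sym by simp
  let ?P = "{y \<in> V. E y v}" and ?Q = "{y \<in> V. E y w}"
  have disj: "?P \<inter> ?Q = {}" using no_triangle[of _ v w] v w by auto
  have indP: "\<not> E p p'" if "p \<in> ?P" "p' \<in> ?P" for p p'
    using that no_triangle[of p p' v] v by auto
  have indQ: "\<not> E p p'" if "p \<in> ?Q" "p' \<in> ?Q" for p p'
    using that no_triangle[of p p' w] w by auto
  have wP: "w \<in> ?P" and vQ: "v \<in> ?Q" using v w wv by auto
  consider "\<exists>u\<in>?P. \<exists>z\<in>?Q. \<not> E u z" | "?P \<union> ?Q \<noteq> V"
    | "?P \<union> ?Q = V" "\<forall>u\<in>?P. \<forall>z\<in>?Q. E u z" by blast
  then show ?thesis
  proof cases
    case 1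
    then obtain u z where uz: "u \<in> ?P" "z \<in> ?Q" "\<not> E u z" by blast
    have "\<not> E u w" "\<not> E v z" using indP[OF uz(1) wP] indQ[OF vQ uz(2)] by auto
    moreover have "u \<noteq> w" "v \<noteq> z" "u \<noteq> z" using uz E_sym disj v w by auto
    ultimately have "induced_P4 u v w z"
      using uz v w E_sym[of z w] E_neq[of v w] E_neq[of u v] E_neq[of z w] by (auto simp: induced_P4_def)
    then show ?thesis using that by blast
  next
    case 2
    have step: ?thesis if V: "v \<in> V" "w \<in> V" "y \<in> V" "q \<in> V" and E: "E v w" "E w q" "E q y" "\<not> E y w" "\<not> E y v" "q \<noteq> v" for v w y q
    proof -
      have "\<not> E v q" using no_triangle[of v w q] V E by auto
      moreover have "y \<noteq> w" "y \<noteq> v" using E V E_sym by auto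
      ultimately have "induced_P4 v w q y"
        using V E E_sym[of w y] E_sym[of v y] E_neq[of v w] E_neq[of w q] E_neq[of q y]
        by (auto simp: induced_P4_def)
      then show ?thesis by (rule P4_thesis)
    qed
    have "?P \<union> ?Q \<subseteq> V" "?P \<union> ?Q \<noteq> {}" using wP by auto
    then obtain q y where q: "q \<in> ?P \<union> ?Q" "y \<in> V" "y \<notin> ?P \<union> ?Q" "E q y" using cut[of "?P \<union> ?Q"] 2 by blast
    then have n: "\<not> E y v" "\<not> E y w" "q \<noteq> v" "q \<noteq> w" using E_sym v w by blast+
    from q(1) show ?thesis
    proof
      assume "q \<in> ?P"
      then have "q \<in> V" "E v q" using E_sym v by auto
      then show ?thesis using step[of w v y q] n q v w wv by blast
    next
      assume "q \<in> ?Q"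
      then have "q \<in> V" "E w q" using E_sym w by auto
      then show ?thesis using step[of v w y q] n q v w by blast
    qed
  next
    case 3
    show ?thesis
    proof (rule that(2)[of ?P ?Q])
      show "?P \<noteq> {}" "?Q \<noteq> {}" using wP vQ by blast+
    qed (use 3 disj indP indQ in blast)+
  qed
qed

end

section \<open>Classification\<close>

text \<open>The graphs listed are \<open>K\<^bsub>m,m,m\<^esub>\<close>, \<open>K\<^bsub>m,m,1\<^esub>\<close>, \<open>K\<^bsub>n-2,1,1\<^esub>\<close>, \<open>K\<^bsub>n-2,2\<^esub>\<close>, the star with an additional edge,
  \<open>K\<^bsub>m,m\<^esub>\<close> with an additional edge, and \<open>C\<^sub>5\<close>. The numbers \<open>a\<close> and \<open>s\<close> are the spectral invariants
  \<open>\<mu> / n - 1\<close> and \<open>(n - 1) \<mu> - trace\<close>; \<open>s\<close> is needed only to tell apart \<open>K\<^bsub>n-2,1,1\<^esub>\<close> and \<open>K\<^bsub>n-2,2\<^esub>\<close>.\<close>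

definition shape :: "nat \<Rightarrow> real \<Rightarrow> real \<Rightarrow> (nat \<Rightarrow> nat \<Rightarrow> bool) \<Rightarrow> nat list \<Rightarrow> bool" where
  "shape n a s R l \<longleftrightarrow>
     (\<exists>m. R = (\<noteq>) \<and> n = 3 * m \<and> a * n = m \<and> l = [m, m, m]) \<or>
     (\<exists>m. R = (\<noteq>) \<and> n = 2 * m + 1 \<and> a * n = m \<and> l = [m, m, 1]) \<or>
     R = (\<noteq>) \<and> a * n = real n - 2 \<and> s = 2 * real n - 4 \<and> l = [n - 2, 1, 1] \<or>
     R = (\<noteq>) \<and> a * n = real n - 2 \<and> s = 2 * real n - 6 \<and> l = [n - 2, 2] \<or>
     R = plus_edge \<and> a * n = real n - 1 \<and> l = [1, 2, n - 3] \<or>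
     (\<exists>m. R = plus_edge \<and> n = 2 * m \<and> a * n = m \<and> l = [m, 2, m - 2]) \<or>
     R = pentagon \<and> n = 5 \<and> (a * n)\<^sup>2 - 5 * (a * n) + 5 = 0 \<and> l = [1, 1, 1, 1, 1]"

lemma shape_intros:
  "n = 3 * m \<Longrightarrow> a * n = m \<Longrightarrow> shape n a s (\<noteq>) [m, m, m]"
  "n = 2 * m + 1 \<Longrightarrow> a * n = m \<Longrightarrow> shape n a s (\<noteq>) [m, m, 1]"
  "a * n = real n - 2 \<Longrightarrow> s = 2 * real n - 4 \<Longrightarrow> shape n a s (\<noteq>) [n - 2, 1, 1]"
  "a * n = real n - 2 \<Longrightarrow> s = 2 * real n - 6 \<Longrightarrow> shape n a s (\<noteq>) [n - 2, 2]"
  "a * n = real n - 1 \<Longrightarrow> shape n a s plus_edge [1, 2, n - 3]"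
  "n = 2 * m \<Longrightarrow> a * n = m \<Longrightarrow> shape n a s plus_edge [m, 2, m - 2]"
  "n = 5 \<Longrightarrow> (a * n)\<^sup>2 - 5 * (a * n) + 5 = 0 \<Longrightarrow> shape n a s pentagon [1, 1, 1, 1, 1]"
proof -
  show "n = 3 * m \<Longrightarrow> a * n = m \<Longrightarrow> shape n a s (\<noteq>) [m, m, m]"
    unfolding shape_def by (rule disjI1, intro exI[of _ m] conjI refl)
  show "n = 2 * m + 1 \<Longrightarrow> a * n = m \<Longrightarrow> shape n a s (\<noteq>) [m, m, 1]"
    unfolding shape_def by (rule disjI2, rule disjI1, intro exI[of _ m] conjI refl)
  show "a * n = real n - 2 \<Longrightarrow> s = 2 * real n - 4 \<Longrightarrow> shape n a s (\<noteq>) [n - 2, 1, 1]"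
    unfolding shape_def by (rule disjI2, rule disjI2, rule disjI1, intro conjI refl)
  show "a * n = real n - 2 \<Longrightarrow> s = 2 * real n - 6 \<Longrightarrow> shape n a s (\<noteq>) [n - 2, 2]"
    unfolding shape_def by (rule disjI2, rule disjI2, rule disjI2, rule disjI1, intro conjI refl)
  show "a * n = real n - 1 \<Longrightarrow> shape n a s plus_edge [1, 2, n - 3]"
    unfolding shape_def by (rule disjI2, rule disjI2, rule disjI2, rule disjI2, rule disjI1, intro conjI refl)
  show "n = 2 * m \<Longrightarrow> a * n = m \<Longrightarrow> shape n a s plus_edge [m, 2, m - 2]"
    unfolding shape_def
    by (rule disjI2, rule disjI2, rule disjI2, rule disjI2, rule disjI2, rule disjI1, intro exI[of _ m] conjI refl)
  show "n = 5 \<Longrightarrow> (a * n)\<^sup>2 - 5 * (a * n) + 5 = 0 \<Longrightarrow> shape n a s pentagon [1, 1, 1, 1, 1]"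
    unfolding shape_def
    by (rule disjI2, rule disjI2, rule disjI2, rule disjI2, rule disjI2, rule disjI2, intro conjI refl)
qed

lemma shape_cases:
  assumes "shape n a s R l"
  obtains (tri) m where "R = (\<noteq>)" "n = 3 * m" "a * n = m" "l = [m, m, m]"
  | (bi1) m where "R = (\<noteq>)" "n = 2 * m + 1" "a * n = m" "l = [m, m, 1]"
  | (one) "R = (\<noteq>)" "a * n = real n - 2" "s = 2 * real n - 4" "l = [n - 2, 1, 1]"
  | (two) "R = (\<noteq>)" "a * n = real n - 2" "s = 2 * real n - 6" "l = [n - 2, 2]"
  | (star) "R = plus_edge" "a * n = real n - 1" "l = [1, 2, n - 3]"
  | (bip) m where "R = plus_edge" "n = 2 * m" "a * n = m" "l = [m, 2, m - 2]"
  | (pent) "R = pentagon" "n = 5" "(a * n)\<^sup>2 - 5 * (a * n) + 5 = 0" "l = [1, 1, 1, 1, 1]"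
  using assms unfolding shape_def
  by (elim disjE exE conjE)
    (erule (3) tri, erule (3) bi1, erule (3) one, erule (3) two, erule (2) star, erule (3) bip, erule (3) pent)

section \<open>Separating the shapes by their invariants\<close>

text \<open>Apart from the pentagon, \<open>a * n\<close> is n/3, (n - 1)/2, n/2, n - 2 or n - 1,
  and these differ for n \<ge> 5, whereas n/2 and n - 2 agree at n = 4. For the pentagon
  \<open>a * n\<close> is irrational.\<close>

lemma shape_unique:
  assumes n: "n \<ge> 5" and 1: "shape n a s R l" and 2: "shape n a s R' l'"
  shows "R = R' \<and> l = l'"
proof -
  \<comment> \<open>For k = 2t the quadratic becomes k^2 + 20 = 10k, which keeps k below 10 and
    leaves a finite check.\<close>
  have pent: False if "t\<^sup>2 - 5 * t + 5 = 0" "2 * t = real k" for t :: real and k :: nat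
  proof -
    have "(2 * t)\<^sup>2 - 10 * (2 * t) + 20 = 0" using that(1) by (simp add: power2_eq_square)
    then have "real (k\<^sup>2 + 20) = real (10 * k)" unfolding that(2) by simp
    then have eq: "k\<^sup>2 + 20 = 10 * k" by (simp only: of_nat_eq_iff)
    have "k < 10"
    proof (rule ccontr)
      assume "\<not> k < 10"
      then have "10 * k \<le> k\<^sup>2" by (simp add: power2_eq_square)
      then show False using eq by simp
    qed
    then have "k \<in> {0, 1, 2, 3, 4, 5, 6, 7, 8, 9}" by auto
    then show False using eq by auto
  qed
  define t where "t = a * n"
  show ?thesis
    using 1
  proof (cases rule: shape_cases)
    case a: (tri m)
    have "2 * t = real (2 * m)" using a(3) by (simp add: t_def)
    from pent[OF _ this] have "t\<^sup>2 - 5 * t + 5 \<noteq> 0" by blast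
    with 2 show ?thesis
      by (cases rule: shape_cases) (use a(2,3) n in \<open>simp_all add: a(1,4) t_def\<close>)
  next
    case a: (bi1 m)
    have "2 * t = real (2 * m)" using a(3) by (simp add: t_def)
    from pent[OF _ this] have "t\<^sup>2 - 5 * t + 5 \<noteq> 0" by blast
    with 2 show ?thesis
      by (cases rule: shape_cases) (use a(2,3) n in \<open>simp_all add: a(1,4) t_def\<close>)
  next
    case a: one
    have "2 * t = real (2 * n - 4)" using a(2) n by (simp add: t_def of_nat_diff)
    from pent[OF _ this] have "t\<^sup>2 - 5 * t + 5 \<noteq> 0" by blast
    with 2 show ?thesis
      by (cases rule: shape_cases) (use a(2,3) n in \<open>simp_all add: a(1,4) t_def\<close>)
  next
    case a: two
    have "2 * t = real (2 * n - 4)" using a(2) n by (simp add: t_def of_nat_diff)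
    from pent[OF _ this] have "t\<^sup>2 - 5 * t + 5 \<noteq> 0" by blast
    with 2 show ?thesis
      by (cases rule: shape_cases) (use a(2,3) n in \<open>simp_all add: a(1,4) t_def\<close>)
  next
    case a: star
    have "2 * t = real (2 * n - 2)" using a(2) n by (simp add: t_def of_nat_diff)
    from pent[OF _ this] have "t\<^sup>2 - 5 * t + 5 \<noteq> 0" by blast
    with 2 show ?thesis
      by (cases rule: shape_cases) (use a(2) n in \<open>simp_all add: a(1,3) t_def\<close>)
  next
    case a: (bip m)
    have "2 * t = real (2 * m)" using a(3) by (simp add: t_def)
    from pent[OF _ this] have "t\<^sup>2 - 5 * t + 5 \<noteq> 0" by blast
    with 2 show ?thesis
      by (cases rule: shape_cases) (use a(2,3) n in \<open>simp_all add: a(1,4) t_def\<close>)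
  next
    case a: pent
    have "\<not> 2 * t = real k" for k using pent[of t k] a(3) by (auto simp: t_def)
    note np = this
    from 2 show ?thesis
    proof (cases rule: shape_cases)
      case (tri m) then show ?thesis using np[of "2 * m"] by (simp add: t_def)
    next
      case (bi1 m) then show ?thesis using np[of "2 * m"] by (simp add: t_def)
    next
      case one then show ?thesis using np[of 6] a(2) by (simp add: t_def)
    next
      case two then show ?thesis using np[of 6] a(2) by (simp add: t_def)
    next
      case star then show ?thesis using np[of 8] a(2) by (simp add: t_def)
    next
      case (bip m) then show ?thesis using np[of "2 * m"] by (simp add: t_def)
    qed (use a in simp)
  qed
qed

text \<open>The relation \<open>\<noteq>\<close> survives injective renaming, so the class sizes of
  a complete multipartite graph can be brought into the order in which \<open>shape\<close> lists
  them.\<close>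

lemma blowup_permute:
  assumes b: "blowup V adj (\<noteq>) l \<phi>" and len: "length l' = length l"
    and \<pi>: "inj \<pi>" "\<And>c. c < length l \<Longrightarrow> \<pi> c < length l \<and> l' ! \<pi> c = l ! c"
  shows "blowup V adj (\<noteq>) l' (\<pi> \<circ> \<phi>)"
proof -
  have bij: "\<pi> ` {..<length l} = {..<length l}"
    by (rule endo_inj_surj) (use \<pi> in \<open>auto intro: inj_on_subset\<close>)
  have card: "card {y \<in> V. \<phi> y = c} = (if c < length l then l ! c else 0)" for c
    using b by (simp add: blowup_def)
  have "card {y \<in> V. (\<pi> \<circ> \<phi>) y = c} = (if c < length l' then l' ! c else 0)" for c
  proof (cases "\<exists>c'. c = \<pi> c'")
    case True
    then obtain c' where c': "c = \<pi> c'" by blast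
    have "{y \<in> V. (\<pi> \<circ> \<phi>) y = c} = {y \<in> V. \<phi> y = c'}"
      using \<pi>(1) c' by (auto dest: injD)
    moreover have "c' < length l \<longleftrightarrow> c < length l"
      using bij \<pi>(1) c' by (metis image_iff injD lessThan_iff)
    ultimately show ?thesis using card[of c'] \<pi>(2)[of c'] c' len by simp
  next
    case False
    then have e: "{y \<in> V. (\<pi> \<circ> \<phi>) y = c} = {}" by auto
    have "\<not> c < length l" using False bij by blast
    then show ?thesis unfolding e using len by simp
  qed
  moreover have "\<pi> c \<noteq> \<pi> c' \<longleftrightarrow> c \<noteq> c'" for c c' using \<pi>(1) by (auto dest: injD)
  ultimately show ?thesis using b by (simp add: blowup_def)
qed

lemma blowup_swap:
  assumes "blowup V adj (\<noteq>) [p, q, r] \<phi>"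
  shows "blowup V adj (\<noteq>) [q, p, r] (transpose 0 1 \<circ> \<phi>)" "blowup V adj (\<noteq>) [p, r, q] (transpose 1 2 \<circ> \<phi>)"
    "blowup V adj (\<noteq>) [r, q, p] (transpose 0 2 \<circ> \<phi>)"
  by (rule blowup_permute[OF assms]; auto simp: less_Suc_eq transpose_def numeral_2_eq_2)+

text \<open>Every size other than 1 equals \<open>a * n\<close>, so the number of sizes equal to 1
  decides which of the three tripartite shapes occurs.\<close>

lemma tripartite_shape:
  fixes a s :: real
  assumes b: "blowup V adj (\<noteq>) [p, q, r] \<phi>" and n: "p + q + r = n" "n \<ge> 5" and pos: "p \<ge> 1" "q \<ge> 1" "r \<ge> 1"
    and big: "\<forall>s\<in>{p, q, r}. s \<ge> 2 \<longrightarrow> real s = a * n" and s: "s = 2 * a * n"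
  obtains \<phi> l where "blowup V adj (\<noteq>) l \<phi>" "shape n a s (\<noteq>) l"
proof -
  have s3: "shape n a s (\<noteq>) [t, 1, 1]" if t: "t + 2 = n" "real t = a * n" for t
  proof -
    have n': "real n = real t + 2" using t(1) by linarith
    then have "a * n = real n - 2" using t(2) by linarith
    moreover from this have "s = 2 * real n - 4" using s by linarith
    moreover have "[t, 1, 1] = [n - 2, 1, 1]" using t(1) by simp
    ultimately show ?thesis using shape_intros(3) by simp
  qed
  have s2: "shape n a s (\<noteq>) [t, t, 1]" if t: "t + t + 1 = n" "real t = a * n" for t
  proof -
    have "n = 2 * t + 1" using t(1) by simp
    from shape_intros(2)[OF this t(2)[symmetric]] show ?thesis .
  qed
  have s1: "shape n a s (\<noteq>) [t, t, t]" if t: "t + t + t = n" "real t = a * n" for t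
  proof -
    have "n = 3 * t" using t(1) by simp
    from shape_intros(1)[OF this t(2)[symmetric]] show ?thesis .
  qed
  have P: "p \<ge> 2 \<Longrightarrow> real p = a * n" and Q: "q \<ge> 2 \<Longrightarrow> real q = a * n" and R: "r \<ge> 2 \<Longrightarrow> real r = a * n"
    using big by simp_all
  have one: "p = 1 \<or> p \<ge> 2" "q = 1 \<or> q \<ge> 2" "r = 1 \<or> r \<ge> 2" "\<not> (p = 1 \<and> q = 1 \<and> r = 1)"
    using pos n by auto
  consider "p \<ge> 2" "q \<ge> 2" "r \<ge> 2" | "p \<ge> 2" "q \<ge> 2" "r = 1" | "p \<ge> 2" "q = 1" "r \<ge> 2" | "p = 1" "q \<ge> 2" "r \<ge> 2"
    | "p \<ge> 2" "q = 1" "r = 1" | "p = 1" "q \<ge> 2" "r = 1" | "p = 1" "q = 1" "r \<ge> 2"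
    using one by blast
  then show ?thesis
  proof cases
    case 1
    then have r: "real p = a * n" "q = p" "r = p" using P Q R by linarith+
    have "shape n a s (\<noteq>) [p, q, r]" unfolding r(2,3) by (rule s1) (use r n in simp_all)
    with b show ?thesis by (rule that)
  next
    case 2
    then have r: "real p = a * n" "q = p" using P Q by linarith+
    have "shape n a s (\<noteq>) [p, q, r]" unfolding r(2) 2 by (rule s2) (use r 2 n in simp_all)
    with b show ?thesis by (rule that)
  next
    case 3
    then have r: "real p = a * n" "r = p" using P R by linarith+
    have "shape n a s (\<noteq>) [p, r, q]" unfolding r(2) 3 by (rule s2) (use r 3 n in simp_all)
    with blowup_swap(2)[OF b] show ?thesis by (rule that)
  next
    case 4
    then have r: "real q = a * n" "r = q" using Q R by linarith+
    have "shape n a s (\<noteq>) [r, q, p]" unfolding r(2) 4 by (rule s2) (use r 4 n in simp_all)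
    with blowup_swap(3)[OF b] show ?thesis by (rule that)
  next
    case 5
    then have r: "real p = a * n" using P by blast
    have "shape n a s (\<noteq>) [p, q, r]" unfolding 5 by (rule s3) (use r 5 n in simp_all)
    with b show ?thesis by (rule that)
  next
    case 6
    then have r: "real q = a * n" using Q by blast
    have "shape n a s (\<noteq>) [q, p, r]" unfolding 6 by (rule s3) (use r 6 n in simp_all)
    with blowup_swap(1)[OF b] show ?thesis by (rule that)
  next
    case 7
    then have r: "real r = a * n" using R by blast
    have "shape n a s (\<noteq>) [r, q, p]" unfolding 7 by (rule s3) (use r 7 n in simp_all)
    with blowup_swap(3)[OF b] show ?thesis by (rule that)
  qed
qed

context planar_distance begin

lemma pendant_shape:
  assumes t: "triangle u v w \<alpha> \<beta> \<gamma>" and y: "y \<in> V" "\<not> E y v" "\<not> E y w" "y \<notin> {u, v, w}"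
  obtains \<phi> l where "blowup V E plus_edge l \<phi>" "shape (card V) a s plus_edge l"
proof -
  obtain \<phi> p q where b: "blowup V E plus_edge [p, 2, q] \<phi>" and c: "p + q + 2 = card V"
    and or: "p = 1 \<and> a = (real (card V) - 1) / real (card V) \<or> p = q + 2 \<and> a = 1 / 2"
    by (rule pendant_case[OF t y])
  from or have "shape (card V) a s plus_edge [p, 2, q]"
  proof
    assume h: "p = 1 \<and> a = (real (card V) - 1) / real (card V)"
    then have "[p, 2, q] = [1, 2, card V - 3]" using c by simp
    moreover have "a * card V = real (card V) - 1" using h c by simp
    ultimately show ?thesis using shape_intros(5) by simp
  next
    assume h: "p = q + 2 \<and> a = 1 / 2"
    then have "card V = 2 * p" "q = p - 2" using c by simp_all
    moreover have "a = 1 / 2" using h by blast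
    with \<open>card V = 2 * p\<close> have "a * card V = p" by simp
    ultimately show ?thesis using shape_intros(6) by simp
  qed
  with b show ?thesis by (rule that)
qed

theorem classification:
  obtains R l \<phi> where "blowup V E R l \<phi>" "shape (card V) a (\<Sum>y\<in>V. dot (x y) (x y)) R l"
proof (cases "\<exists>u\<in>V. \<exists>v\<in>V. \<exists>w\<in>V. E u v \<and> E v w \<and> E u w")
  case True
  then obtain u v w where "u \<in> V" "v \<in> V" "w \<in> V" "E u v" "E v w" "E u w" by blast
  then obtain \<alpha> \<beta> \<gamma> where t: "triangle u v w \<alpha> \<beta> \<gamma>" by (rule triangle_ex)
  have t1: "triangle v w u \<beta> \<gamma> \<alpha>" and t2: "triangle w u v \<gamma> \<alpha> \<beta>"
    using t triangle_rotate by blast+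
  \<comment> \<open>Either some outside vertex misses two corners, which a rotation of the triangle
    brings to the positions of \<open>v\<close> and \<open>w\<close>, or every outside vertex is
    adjacent to at least two corners.\<close>
  show ?thesis
  proof (cases "\<exists>y\<in>V. y \<notin> {u, v, w} \<and> \<not> (E y u \<and> E y v \<or> E y v \<and> E y w \<or> E y u \<and> E y w)")
    case True
    then obtain y where y: "y \<in> V" "y \<notin> {u, v, w}" "y \<notin> {v, w, u}" "y \<notin> {w, u, v}"
      and "\<not> E y v \<and> \<not> E y w \<or> \<not> E y w \<and> \<not> E y u \<or> \<not> E y u \<and> \<not> E y v" by blast
    from this(5) consider "\<not> E y v" "\<not> E y w" | "\<not> E y w" "\<not> E y u" | "\<not> E y u" "\<not> E y v" by blast
    then show ?thesis
    proof cases
      case 1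
      show ?thesis by (rule pendant_shape[OF t y(1) 1 y(2)]) (rule that)
    next
      case 2
      show ?thesis by (rule pendant_shape[OF t1 y(1) 2 y(3)]) (rule that)
    next
      case 3
      show ?thesis by (rule pendant_shape[OF t2 y(1) 3 y(4)]) (rule that)
    qed
  next
    case False
    then have two: "E y u \<and> E y v \<or> E y v \<and> E y w \<or> E y u \<and> E y w" if "y \<in> V" "y \<notin> {u, v, w}" for y
      using that by blast
    obtain \<phi> p q r where b: "blowup V E (\<noteq>) [p, q, r] \<phi>" "p + q + r = card V" "p \<ge> 1" "q \<ge> 1" "r \<ge> 1"
      "\<forall>s\<in>{p, q, r}. s \<ge> 2 \<longrightarrow> real s = a * card V" "(\<Sum>y\<in>V. dot (x y) (x y)) = 2 * a * card V"
      by (rule tripartite_case[OF t two])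
    show ?thesis
      by (rule tripartite_shape[OF b(1,2) card5 b(3-7)]) (rule that)
  qed
next
  case False
  interpret triangle_free_planar_distance V d a x
    by unfold_locales (use False in blast)
  show ?thesis
  proof (cases rule: bipartite_or_P4)
    case (1 u v w z)
    then obtain \<phi> where "blowup V E pentagon [1, 1, 1, 1, 1] \<phi>" "card V = 5" "5 * a\<^sup>2 - 5 * a + 1 = 0"
      by (rule P4_pentagon)
    moreover from this(2,3) have "(a * card V)\<^sup>2 - 5 * (a * card V) + 5 = 0" by (simp add: power2_eq_square)
    ultimately show ?thesis using that[of pentagon] shape_intros(7) by blast
  next
    case (2 P Q)
    then obtain \<phi> where b: "blowup V E (\<noteq>) [card V - 2, 2] \<phi>"
      and *: "a = (real (card V) - 2) / real (card V)" "(\<Sum>y\<in>V. dot (x y) (x y)) = 2 * real (card V) - 6"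
      by (rule bipartite_case)
    have "a * card V = real (card V) - 2" using * card5 by simp
    from that[OF b shape_intros(4)[OF this *(2)]] show ?thesis .
  qed
qed

end

section \<open>Real symmetric matrices\<close>

text \<open>The characteristic polynomial splits over the complex numbers. The Hermitian form of an
  eigenvector shows that a root is real, and the root then transfers back to the real
  polynomial.\<close>

lemma symmetric_real_eigenvalue:
  fixes A :: "real mat"
  assumes A: "A \<in> carrier_mat n n" and sym: "transpose_mat A = A" and n: "n > 0"
  obtains e where "eigenvalue A e"
proof -
  let ?C = "map_mat complex_of_real A"
  have C: "?C \<in> carrier_mat n n" using A by simp
  have symA: "A $$ (i, j) = A $$ (j, i)" if "i < n" "j < n" for i j
    using arg_cong[OF sym, of "\<lambda>M. M $$ (j, i)"] that A by simp
  obtain cs where cs: "char_poly ?C = (\<Prod>c\<leftarrow>cs. [:- c, 1:])" "length cs = n"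
    using char_poly_factorized[OF C] by blast
  then obtain c where "c \<in> set cs" using n by (cases cs) auto
  then have root: "poly (char_poly ?C) c = 0"
    unfolding cs(1) poly_prod_list by (simp add: prod_list_zero_iff)
  then have "eigenvalue ?C c" using eigenvalue_root_char_poly[OF C] by simp
  then obtain v where v: "v \<in> carrier_vec n" "v \<noteq> 0\<^sub>v n" "?C *\<^sub>v v = c \<cdot>\<^sub>v v"
    using C by (auto simp: eigenvalue_def eigenvector_def)
  have row: "(\<Sum>j<n. of_real (A $$ (i, j)) * v $ j) = c * v $ i" if "i < n" for i
    using arg_cong[OF v(3), of "\<lambda>w. w $ i"] that v(1) A
    by (simp add: scalar_prod_def atLeast0LessThan)
  define N where "N = (\<Sum>i<n. cnj (v $ i) * v $ i)"
  have N: "N = of_real (\<Sum>i<n. (cmod (v $ i))\<^sup>2)"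
    unfolding N_def of_real_sum by (intro sum.cong) (simp_all add: complex_norm_square mult.commute del: of_real_power)
  obtain i where i: "i < n" "v $ i \<noteq> 0"
    using v by (metis carrier_vecD eq_vecI index_zero_vec)
  have "(\<Sum>i<n. (cmod (v $ i))\<^sup>2) > 0"
    by (rule sum_pos2[of _ i]) (use i in auto)
  then have N0: "N \<noteq> 0" unfolding N of_real_eq_0_iff by simp
  define S where "S = (\<Sum>i<n. \<Sum>j<n. cnj (v $ i) * (of_real (A $$ (i, j)) * v $ j))"
  have "S = (\<Sum>i<n. cnj (v $ i) * (\<Sum>j<n. of_real (A $$ (i, j)) * v $ j))"
    by (simp add: S_def sum_distrib_left)
  also have "\<dots> = (\<Sum>i<n. cnj (v $ i) * (c * v $ i))" by (rule sum.cong) (simp_all add: row)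
  also have "\<dots> = c * N" by (simp add: N_def sum_distrib_left mult.left_commute)
  finally have "S = c * N" .
  moreover have "cnj S = S"
  proof -
    have "cnj S = (\<Sum>i<n. \<Sum>j<n. v $ i * (of_real (A $$ (i, j)) * cnj (v $ j)))"
      by (simp add: S_def)
    also have "\<dots> = (\<Sum>j<n. \<Sum>i<n. v $ i * (of_real (A $$ (i, j)) * cnj (v $ j)))" by (rule sum.swap)
    also have "\<dots> = S"
      unfolding S_def by (intro sum.cong refl) (simp add: symA mult.commute mult.left_commute)
    finally show ?thesis .
  qed
  moreover have "cnj N = N" unfolding N by simp
  ultimately have "cnj c * N = c * N" by (metis complex_cnj_mult)
  then have "cnj c = c" using N0 by simp
  then have c: "c = of_real (Re c)" by (metis Reals_cnj_iff of_real_Re)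
  have "char_poly ?C = map_poly of_real (char_poly A)" by (rule of_real_hom.char_poly_hom[OF A])
  then have "of_real (poly (char_poly A) (Re c)) = (0 :: complex)"
    using root c by (metis of_real_hom.poly_map_poly)
  then have "eigenvalue A (Re c)" using eigenvalue_root_char_poly[OF A] by simp
  then show ?thesis by (rule that)
qed

text \<open>Gram-Schmidt on a basis that starts with \<open>v\<close> keeps the first vector; then
  the columns are normalised. The conjugation in its notion of orthogonality is trivial over the
  reals.\<close>

lemma orthonormal_completion:
  fixes v :: "real vec"
  assumes v: "v \<in> carrier_vec n" "v \<noteq> 0\<^sub>v n"
  obtains W c where "W \<in> carrier_mat n n" "transpose_mat W * W = 1\<^sub>m n" "col W 0 = c \<cdot>\<^sub>v v"
proof -
  interpret cof_vec_space n "TYPE(real)" .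
  define b where "b = basis_completion v"
  define ws where "ws = gram_schmidt n b"
  note bc = basis_completion[OF v, folded b_def]
  have "n \<noteq> 0" using v by auto
  then obtain vs where bv: "b = v # vs" using bc by (cases b) auto
  note gs = gram_schmidt_result[OF bc(2,4,5) ws_def]
  have hd: "hd ws = v" unfolding ws_def bv by (rule gram_schmidt_hd[OF v(1)])
  have len: "length ws = n" using gs bc by simp
  have wsc: "ws ! i \<in> carrier_vec n" if "i < n" for i using gs(3) len that by auto
  have conj: "conjugate w = w" for w :: "real vec" by (rule eq_vecI) simp_all
  have orth: "ws ! i \<bullet> ws ! j = 0 \<longleftrightarrow> i \<noteq> j" if "i < n" "j < n" for i j
    using corthogonalD[OF gs(2)] len that conj by simp
  have pos: "ws ! i \<bullet> ws ! i > 0" if "i < n" for i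
  proof -
    have "ws ! i \<bullet> ws ! i \<ge> 0" by (simp add: scalar_prod_def sum_nonneg)
    then show ?thesis using orth[OF that that] by simp
  qed
  define r where "r i = 1 / sqrt (ws ! i \<bullet> ws ! i)" for i
  define W where "W = mat n n (\<lambda>(i, j). r j * ws ! j $ i)"
  have W: "W \<in> carrier_mat n n" by (simp add: W_def)
  have colW: "col W j = r j \<cdot>\<^sub>v ws ! j" if "j < n" for j
    by (rule eq_vecI) (use that wsc[OF that] in \<open>simp_all add: W_def\<close>)
  have "transpose_mat W * W = 1\<^sub>m n"
  proof (rule eq_matI)
    fix i j assume "i < dim_row (1\<^sub>m n :: real mat)" "j < dim_col (1\<^sub>m n :: real mat)"
    then have ij: "i < n" "j < n" by auto
    have "(transpose_mat W * W) $$ (i, j) = col W i \<bullet> col W j" using ij W by simp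
    also have "\<dots> = r i * (r j * (ws ! i \<bullet> ws ! j))"
      unfolding colW[OF ij(1)] colW[OF ij(2)] using wsc[OF ij(1)] wsc[OF ij(2)]
      by (simp add: smult_scalar_prod_distrib[of _ n] scalar_prod_smult_distrib[of _ n])
    also have "\<dots> = (if i = j then 1 else 0)"
      using orth[OF ij] pos[OF ij(1)] by (auto simp: r_def)
    finally show "(transpose_mat W * W) $$ (i, j) = 1\<^sub>m n $$ (i, j)" using ij by simp
  qed (use W in auto)
  moreover have "col W 0 = r 0 \<cdot>\<^sub>v v"
    using colW[of 0] \<open>n \<noteq> 0\<close> hd len by (cases ws) auto
  ultimately show ?thesis using that W by blast
qed

text \<open>Deflation: in an orthonormal basis that starts with an eigenvector, symmetry clears the
  first row along with the first column, and the remaining block is again symmetric.\<close>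

theorem real_spectral_decomposition:
  fixes A :: "real mat"
  assumes "A \<in> carrier_mat n n" "transpose_mat A = A"
  obtains Q D where "Q \<in> carrier_mat n n" "D \<in> carrier_mat n n" "diagonal_mat D"
    "transpose_mat Q * Q = 1\<^sub>m n" "A = Q * D * transpose_mat Q"
  using assms
proof (induction n arbitrary: A thesis)
  case 0
  have "A = 1\<^sub>m 0 * A * transpose_mat (1\<^sub>m 0)" "diagonal_mat A" "transpose_mat (1\<^sub>m 0) * 1\<^sub>m 0 = (1\<^sub>m 0 :: real mat)"
    using "0.prems"(2) by (auto simp: diagonal_mat_def)
  then show ?case by (intro "0.prems"(1)[of "1\<^sub>m 0" A] "0.prems"(2)) simp_all
next
  case (Suc n)
  note A = Suc.prems(2) and sym = Suc.prems(3)
  obtain e where e: "eigenvalue A e" using symmetric_real_eigenvalue[OF A sym] by blast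
  then obtain v where v: "v \<in> carrier_vec (Suc n)" "v \<noteq> 0\<^sub>v (Suc n)" "A *\<^sub>v v = e \<cdot>\<^sub>v v"
    using A by (auto simp: eigenvalue_def eigenvector_def)
  obtain W c where W: "W \<in> carrier_mat (Suc n) (Suc n)" and WW: "transpose_mat W * W = 1\<^sub>m (Suc n)"
    and W0: "col W 0 = c \<cdot>\<^sub>v v" by (rule orthonormal_completion[OF v(1,2)])
  let ?W' = "transpose_mat W"
  have W': "?W' \<in> carrier_mat (Suc n) (Suc n)" using W by simp
  note assoc = assoc_mult_mat[of _ "Suc n" "Suc n" _ "Suc n" _ "Suc n"]
    mult_carrier_mat[of _ "Suc n" "Suc n" _ "Suc n"]
  have WW': "W * ?W' = 1\<^sub>m (Suc n)" by (rule mat_mult_left_right_inverse[OF W' W WW])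
  define B where "B = ?W' * A * W"
  have B: "B \<in> carrier_mat (Suc n) (Suc n)" using A W by (simp add: B_def)
  have symB: "transpose_mat B = B"
  proof -
    have "transpose_mat (?W' * A) = transpose_mat A * transpose_mat ?W'"
      by (rule transpose_mult[OF W' A])
    moreover have "transpose_mat (?W' * A * W) = transpose_mat W * transpose_mat (?W' * A)"
      by (rule transpose_mult[OF mult_carrier_mat[OF W' A] W])
    ultimately have "transpose_mat B = transpose_mat W * (transpose_mat A * transpose_mat ?W')"
      unfolding B_def by (simp only:)
    then show ?thesis unfolding B_def sym using A W by (simp add: assoc)
  qed
  have Bij: "B $$ (i, j) = B $$ (j, i)" if "i < Suc n" "j < Suc n" for i j
    using arg_cong[OF symB, of "\<lambda>M. M $$ (j, i)"] that B by simp
  have colB: "col B 0 = e \<cdot>\<^sub>v col (1\<^sub>m (Suc n)) 0"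
  proof -
    have cW: "col W 0 \<in> carrier_vec (Suc n)" by (rule col_carrier_vec[OF zero_less_Suc W])
    have "col B 0 = (?W' * A) *\<^sub>v col W 0"
      unfolding B_def by (rule col_mult2[OF mult_carrier_mat[OF W' A] W]) simp
    also have "\<dots> = ?W' *\<^sub>v (A *\<^sub>v col W 0)" by (rule assoc_mult_mat_vec[OF W' A cW])
    also have "A *\<^sub>v col W 0 = e \<cdot>\<^sub>v col W 0"
      unfolding W0 mult_mat_vec[OF A v(1)] v(3) by (simp add: smult_smult_assoc mult.commute)
    also have "?W' *\<^sub>v (e \<cdot>\<^sub>v col W 0) = e \<cdot>\<^sub>v (?W' *\<^sub>v col W 0)" by (rule mult_mat_vec[OF W' cW])
    also have "?W' *\<^sub>v col W 0 = col (?W' * W) 0" by (rule col_mult2[OF W' W, symmetric]) simp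
    finally show ?thesis unfolding WW .
  qed
  have B0: "B $$ (i, 0) = (if i = 0 then e else 0)" if "i < Suc n" for i
    using arg_cong[OF colB, of "\<lambda>u. u $ i"] that B by simp
  define A3 where "A3 = mat n n (\<lambda>(i, j). B $$ (Suc i, Suc j))"
  have A3: "A3 \<in> carrier_mat n n" by (simp add: A3_def)
  have symA3: "transpose_mat A3 = A3"
  proof (rule eq_matI)
    fix i j assume "i < dim_row A3" "j < dim_col A3"
    then have ij: "i < n" "j < n" by (simp_all add: A3_def)
    then show "transpose_mat A3 $$ (i, j) = A3 $$ (i, j)"
      using Bij[of "Suc j" "Suc i"] by (simp add: A3_def)
  qed (simp_all add: A3_def)
  obtain P D' where P: "P \<in> carrier_mat n n" and D': "D' \<in> carrier_mat n n" "diagonal_mat D'"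
    and PP: "transpose_mat P * P = 1\<^sub>m n" and A3_eq: "A3 = P * D' * transpose_mat P"
    using Suc.IH[OF _ A3 symA3] by blast
  have P': "transpose_mat P \<in> carrier_mat n n" using P by simp
  define E where "E = mat 1 1 (\<lambda>_. e)"
  \<comment> \<open>The diagonaliser of the block, extended by the identity on the split-off
    eigenvector, so that \<open>W * Z\<close> diagonalises \<open>A\<close>.\<close>
  define Z where "Z = four_block_mat (1\<^sub>m 1) (0\<^sub>m 1 n) (0\<^sub>m n 1) P"
  define D where "D = four_block_mat E (0\<^sub>m 1 n) (0\<^sub>m n 1) D'"
  have E: "E \<in> carrier_mat 1 1" by (simp add: E_def)
  have Z: "Z \<in> carrier_mat (Suc n) (Suc n)" and D: "D \<in> carrier_mat (Suc n) (Suc n)"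
    using P D' E four_block_carrier_mat[of _ 1 1 _ n n] unfolding Z_def D_def by (metis one_carrier_mat plus_1_eq_Suc)+
  have Z': "transpose_mat Z = four_block_mat (1\<^sub>m 1) (0\<^sub>m 1 n) (0\<^sub>m n 1) (transpose_mat P)"
    unfolding Z_def using P by (simp add: transpose_four_block_mat[OF one_carrier_mat zero_carrier_mat zero_carrier_mat P])
  have B_block: "B = four_block_mat E (0\<^sub>m 1 n) (0\<^sub>m n 1) A3"
  proof (rule eq_matI)
    fix i j assume "i < dim_row (four_block_mat E (0\<^sub>m 1 n) (0\<^sub>m n 1) A3)" "j < dim_col (four_block_mat E (0\<^sub>m 1 n) (0\<^sub>m n 1) A3)"
    then have ij: "i < Suc n" "j < Suc n" using E A3 by auto
    then show "B $$ (i, j) = four_block_mat E (0\<^sub>m 1 n) (0\<^sub>m n 1) A3 $$ (i, j)"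
    proof (cases "i = 0 \<or> j = 0")
      case True
      then have "B $$ (i, j) = (if i = 0 \<and> j = 0 then e else 0)"
        using B0[OF ij(1)] B0[OF ij(2)] Bij[OF ij] by (elim disjE) simp_all
      then show ?thesis using True ij by (auto simp: E_def A3_def)
    next
      case False
      then obtain i' j' where "i = Suc i'" "j = Suc j'" by (metis not0_implies_Suc)
      then show ?thesis using ij by (simp add: E_def A3_def)
    qed
  qed (use B E A3 in auto)
  have ZDZ: "Z * D * transpose_mat Z = B"
  proof -
    have ZD: "Z * D = four_block_mat E (0\<^sub>m 1 n) (0\<^sub>m n 1) (P * D')"
      unfolding Z_def D_def
        mult_four_block_mat[OF one_carrier_mat zero_carrier_mat zero_carrier_mat P E zero_carrier_mat zero_carrier_mat D'(1)]
      using P D' E by simp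
    have "Z * D * transpose_mat Z = four_block_mat E (0\<^sub>m 1 n) (0\<^sub>m n 1) (P * D' * transpose_mat P)"
      unfolding ZD Z' mult_four_block_mat[OF E zero_carrier_mat zero_carrier_mat mult_carrier_mat[OF P D'(1)]
        one_carrier_mat zero_carrier_mat zero_carrier_mat P']
      using P D' E by simp
    then show ?thesis unfolding B_block A3_eq .
  qed
  have ZZ: "transpose_mat Z * Z = 1\<^sub>m (Suc n)"
  proof -
    have "transpose_mat Z * Z = four_block_mat (1\<^sub>m 1) (0\<^sub>m 1 n) (0\<^sub>m n 1) (transpose_mat P * P)"
      unfolding Z' unfolding Z_def
        mult_four_block_mat[OF one_carrier_mat zero_carrier_mat zero_carrier_mat P'
          one_carrier_mat zero_carrier_mat zero_carrier_mat P]
      using P by simp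
    then show ?thesis unfolding PP by simp
  qed
  have WBW: "A = W * B * ?W'"
  proof -
    have "W * B * ?W' = (W * ?W') * A * (W * ?W')"
      unfolding B_def using A W W' by (simp add: assoc)
    then show ?thesis unfolding WW' using A by simp
  qed
  have tWZ: "transpose_mat (W * Z) = transpose_mat Z * ?W'" using W Z by (simp add: transpose_mult)
  have "transpose_mat (W * Z) * (W * Z) = transpose_mat Z * (?W' * W) * Z"
    unfolding tWZ using W W' Z by (simp add: assoc)
  then have "transpose_mat (W * Z) * (W * Z) = 1\<^sub>m (Suc n)" unfolding WW using Z ZZ by simp
  moreover have "A = W * Z * D * transpose_mat (W * Z)"
  proof -
    have "W * Z * D * transpose_mat (W * Z) = W * (Z * D * transpose_mat Z) * ?W'"
      unfolding tWZ using W W' Z D by (simp add: assoc)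
    then show ?thesis unfolding ZDZ WBW[symmetric] by simp
  qed
  moreover have "diagonal_mat D"
    unfolding diagonal_mat_def D_def using E D' by (auto simp: diagonal_mat_def)
  moreover have "W * Z \<in> carrier_mat (Suc n) (Suc n)" using W Z by simp
  ultimately show ?case by (intro Suc.prems(1)[of "W * Z" D] D)
qed

lemma proots_linear_factors: "proots (\<Prod>e\<leftarrow>es. [:- e, 1:]) = mset (es :: real list)"
proof (induction es)
  case (Cons e es)
  have "(\<Prod>e\<leftarrow>es. [:- e, 1:]) \<noteq> (0 :: real poly)" by (auto simp: prod_list_zero_iff)
  then show ?case using Cons by (simp add: proots_mult del: mult_pCons_left)
qed simp

text \<open>The eigenvalue list is tied to \<open>proots\<close>, so its multiplicities are those of
  the spectrum. Orthonormality of the rows expands \<mu>I over the eigenvectors; that of the columns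
  serves for spanning and for the trace.\<close>

theorem symmetric_spectrum:
  fixes A :: "real mat"
  assumes A: "A \<in> carrier_mat n n" "transpose_mat A = A"
  obtains q :: "nat \<Rightarrow> nat \<Rightarrow> real" and es where "length es = n" "proots (char_poly A) = mset es"
    "\<And>i j. i < n \<Longrightarrow> j < n \<Longrightarrow> A $$ (i, j) = (\<Sum>k<n. es ! k * q i k * q j k)"
    "\<And>i j. i < n \<Longrightarrow> j < n \<Longrightarrow> (\<Sum>k<n. q i k * q j k) = (if i = j then 1 else 0)"
    "\<And>k l. k < n \<Longrightarrow> l < n \<Longrightarrow> (\<Sum>i<n. q i k * q i l) = (if k = l then 1 else 0)"
proof -
  obtain Q D where Q: "Q \<in> carrier_mat n n" and D: "D \<in> carrier_mat n n" "diagonal_mat D"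
    and QQ: "transpose_mat Q * Q = 1\<^sub>m n" and AQ: "A = Q * D * transpose_mat Q"
    by (rule real_spectral_decomposition[OF A])
  let ?Q' = "transpose_mat Q"
  have Q': "?Q' \<in> carrier_mat n n" using Q by simp
  have QQ': "Q * ?Q' = 1\<^sub>m n" by (rule mat_mult_left_right_inverse[OF Q' Q QQ])
  have "similar_mat_wit A D Q ?Q'"
    by (rule similar_mat_witI[of _ _ n]) (use A Q Q' D QQ QQ' AQ in auto)
  then have "char_poly A = char_poly D" by (intro char_poly_similar) (auto simp: similar_mat_def)
  also have "\<dots> = (\<Prod>e\<leftarrow>diag_mat D. [:- e, 1:])"
    by (rule char_poly_upper_triangular[OF D(1)]) (use D in \<open>auto simp: diagonal_mat_def\<close>)
  finally have pr: "proots (char_poly A) = mset (diag_mat D)" by (simp add: proots_linear_factors)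
  have len: "length (diag_mat D) = n" using D by (simp add: diag_mat_def)
  have entry: "A $$ (i, j) = (\<Sum>k<n. diag_mat D ! k * Q $$ (i, k) * Q $$ (j, k))" if ij: "i < n" "j < n" for i j
  proof -
    have QD: "(Q * D) $$ (i, k) = Q $$ (i, k) * D $$ (k, k)" if k: "k < n" for k
    proof -
      have "(Q * D) $$ (i, k) = (\<Sum>l<n. Q $$ (i, l) * D $$ (l, k))"
        using Q D ij k by (simp add: scalar_prod_def atLeast0LessThan)
      also have "\<dots> = (\<Sum>l<n. if l = k then Q $$ (i, k) * D $$ (k, k) else 0)"
        by (intro sum.cong) (use D k in \<open>auto simp: diagonal_mat_def\<close>)
      finally show ?thesis using k by simp
    qed
    have "A $$ (i, j) = (\<Sum>k<n. (Q * D) $$ (i, k) * Q $$ (j, k))"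
    proof -
      define M where "M = Q * D"
      have "M \<in> carrier_mat n n" using Q D by (simp add: M_def)
      then show ?thesis
        unfolding AQ M_def[symmetric] using Q ij by (simp add: scalar_prod_def atLeast0LessThan)
    qed
    also have "\<dots> = (\<Sum>k<n. diag_mat D ! k * Q $$ (i, k) * Q $$ (j, k))"
      using D by (intro sum.cong) (auto simp: QD diag_mat_def mult_ac)
    finally show ?thesis .
  qed
  have r: "(\<Sum>k<n. Q $$ (i, k) * Q $$ (j, k)) = (if i = j then 1 else 0)" if "i < n" "j < n" for i j
    using arg_cong[OF QQ', of "\<lambda>M. M $$ (i, j)"] that Q by (simp add: scalar_prod_def atLeast0LessThan)
  have c: "(\<Sum>i<n. Q $$ (i, k) * Q $$ (i, l)) = (if k = l then 1 else 0)" if "k < n" "l < n" for k l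
    using arg_cong[OF QQ, of "\<lambda>M. M $$ (k, l)"] that Q by (simp add: scalar_prod_def atLeast0LessThan)
  show ?thesis by (rule that[OF len pr, of "\<lambda>i k. Q $$ (i, k)"]) (use entry r c in auto)
qed

section \<open>From rank three to vectors in the plane\<close>

text \<open>An explicit orthonormal basis of the plane orthogonal to \<open>s\<close>. The last
  identity says that coordinates in it compute inner products after projection along
  \<open>s\<close>.\<close>

lemma orthonormal_complement:
  fixes s1 s2 s3 :: real
  assumes S: "s1\<^sup>2 + s2\<^sup>2 + s3\<^sup>2 > 0"
  obtains e1 e2 e3 f1 f2 f3 :: real where
    "e1\<^sup>2 + e2\<^sup>2 + e3\<^sup>2 = 1" "f1\<^sup>2 + f2\<^sup>2 + f3\<^sup>2 = 1" "e1 * f1 + e2 * f2 + e3 * f3 = 0"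
    "e1 * s1 + e2 * s2 + e3 * s3 = 0" "f1 * s1 + f2 * s2 + f3 * s3 = 0"
    "\<forall>y1 y2 y3 z1 z2 z3. (y1 * e1 + y2 * e2 + y3 * e3) * (z1 * e1 + z2 * e2 + z3 * e3) +
        (y1 * f1 + y2 * f2 + y3 * f3) * (z1 * f1 + z2 * f2 + z3 * f3) =
      y1 * z1 + y2 * z2 + y3 * z3 -
        (y1 * s1 + y2 * s2 + y3 * s3) * (z1 * s1 + z2 * s2 + z3 * s3) / (s1\<^sup>2 + s2\<^sup>2 + s3\<^sup>2)"
proof (cases "s1 = 0 \<and> s2 = 0")
  case True
  show ?thesis
    by (rule that[of 1 0 0 0 1 0]) (use True S in \<open>auto simp: power2_eq_square\<close>)
next
  case False
  define r where "r = sqrt (s1\<^sup>2 + s2\<^sup>2)"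
  define R where "R = sqrt (s1\<^sup>2 + s2\<^sup>2 + s3\<^sup>2)"
  have "s1\<^sup>2 + s2\<^sup>2 > 0" using False by (simp add: sum_power2_gt_zero_iff)
  then have r: "r\<^sup>2 = s1\<^sup>2 + s2\<^sup>2" "r > 0" by (simp_all add: r_def)
  have R: "R\<^sup>2 = s1\<^sup>2 + s2\<^sup>2 + s3\<^sup>2" "R > 0" using S by (simp_all add: R_def)
  \<comment> \<open>Spherical coordinates: s/R = (u w, v w, p), and the basis consists of the unit
    vectors in the directions of longitude and latitude.\<close>
  define u v w p q where "u = s1 / r" and "v = s2 / r" and "w = r / R" and "p = s3 / R" and "q = r * R"
  have "u\<^sup>2 + v\<^sup>2 = (s1\<^sup>2 + s2\<^sup>2) / r\<^sup>2" by (simp add: u_def v_def power_divide add_divide_distrib)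
  then have uv: "u\<^sup>2 + v\<^sup>2 = 1" unfolding r(1)[symmetric] using r(2) by simp
  have "w\<^sup>2 + p\<^sup>2 = (r\<^sup>2 + s3\<^sup>2) / R\<^sup>2" by (simp add: w_def p_def power_divide add_divide_distrib)
  moreover have "r\<^sup>2 + s3\<^sup>2 = R\<^sup>2" unfolding r R by simp
  ultimately have wp: "w\<^sup>2 + p\<^sup>2 = 1" using R(2) by simp
  have s: "s1 = R * (u * w)" "s2 = R * (v * w)" "s3 = R * p"
    using r R by (simp_all add: u_def v_def w_def p_def)
  have Rsq: "s1\<^sup>2 + s2\<^sup>2 + s3\<^sup>2 = R * R" using R by (simp add: power2_eq_square)
  show ?thesis
  proof (rule that[of "- v" u 0 "- u * p" "- v * p" w])
    show "(- v)\<^sup>2 + u\<^sup>2 + 0\<^sup>2 = 1" using uv by simp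
    show "(- u * p)\<^sup>2 + (- v * p)\<^sup>2 + w\<^sup>2 = 1" using uv wp by Groebner_Basis.algebra
    show "- v * (- u * p) + u * (- v * p) + 0 * w = 0" by simp
    show "- v * s1 + u * s2 + 0 * s3 = 0" unfolding s by simp
    show "- u * p * s1 + - v * p * s2 + w * s3 = 0" unfolding s using uv by Groebner_Basis.algebra
    {
      fix y1 y2 y3 z1 z2 z3
      have "(y1 * s1 + y2 * s2 + y3 * s3) * (z1 * s1 + z2 * s2 + z3 * s3) / (s1\<^sup>2 + s2\<^sup>2 + s3\<^sup>2)
        = (y1 * (u * w) + y2 * (v * w) + y3 * p) * (z1 * (u * w) + z2 * (v * w) + z3 * p)"
      proof -
        have "(y1 * s1 + y2 * s2 + y3 * s3) * (z1 * s1 + z2 * s2 + z3 * s3)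
          = (R * R) * ((y1 * (u * w) + y2 * (v * w) + y3 * p) * (z1 * (u * w) + z2 * (v * w) + z3 * p))"
          unfolding s by Groebner_Basis.algebra
        then show ?thesis unfolding Rsq using R by simp
      qed
      moreover have "(y1 * - v + y2 * u + y3 * 0) * (z1 * - v + z2 * u + z3 * 0) +
        (y1 * (- u * p) + y2 * (- v * p) + y3 * w) * (z1 * (- u * p) + z2 * (- v * p) + z3 * w) =
        y1 * z1 + y2 * z2 + y3 * z3 - (y1 * (u * w) + y2 * (v * w) + y3 * p) * (z1 * (u * w) + z2 * (v * w) + z3 * p)"
        using uv wp by Groebner_Basis.algebra
      ultimately have "(y1 * - v + y2 * u + y3 * 0) * (z1 * - v + z2 * u + z3 * 0) +
        (y1 * (- u * p) + y2 * (- v * p) + y3 * w) * (z1 * (- u * p) + z2 * (- v * p) + z3 * w) =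
        y1 * z1 + y2 * z2 + y3 * z3 -
        (y1 * s1 + y2 * s2 + y3 * s3) * (z1 * s1 + z2 * s2 + z3 * s3) / (s1\<^sup>2 + s2\<^sup>2 + s3\<^sup>2)"
        by simp
    }
    then show "\<forall>y1 y2 y3 z1 z2 z3. (y1 * - v + y2 * u + y3 * 0) * (z1 * - v + z2 * u + z3 * 0) +
      (y1 * (- u * p) + y2 * (- v * p) + y3 * w) * (z1 * (- u * p) + z2 * (- v * p) + z3 * w) =
      y1 * z1 + y2 * z2 + y3 * z3 -
      (y1 * s1 + y2 * s2 + y3 * s3) * (z1 * s1 + z2 * s2 + z3 * s3) / (s1\<^sup>2 + s2\<^sup>2 + s3\<^sup>2)"
      by blast
  qed
qed

text \<open>Subtracting from each row of a rank three factor of \<open>\<mu>I - A\<close> its component along the sum of all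
  rows leaves vectors in a plane.\<close>

lemma planar_representation:
  fixes A :: "nat \<Rightarrow> nat \<Rightarrow> real" and q :: "nat \<Rightarrow> nat \<Rightarrow> real" and ev :: "nat \<Rightarrow> real"
  assumes n: "n > 0"
    and A: "\<And>i j. i < n \<Longrightarrow> j < n \<Longrightarrow> A i j = (\<Sum>k<n. ev k * q i k * q j k)"
    and row: "\<And>i j. i < n \<Longrightarrow> j < n \<Longrightarrow> (\<Sum>k<n. q i k * q j k) = (if i = j then 1 else 0)"
    and col: "\<And>k l. k < n \<Longrightarrow> l < n \<Longrightarrow> (\<Sum>i<n. q i k * q i l) = (if k = l then 1 else 0)"
    and row_sum: "\<And>i. i < n \<Longrightarrow> (\<Sum>j<n. A i j) = 0" and diag: "A 0 0 > 0"
    and le: "\<And>k. k < n \<Longrightarrow> ev k \<le> \<mu>" and three: "card {k. k < n \<and> ev k \<noteq> \<mu>} = 3"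
  obtains x :: "nat \<Rightarrow> complex" where
    "\<And>i j. i < n \<Longrightarrow> j < n \<Longrightarrow> dot (x i) (x j) = (if i = j then \<mu> else 0) - A i j - \<mu> / n"
    "(\<Sum>i<n. x i) = 0" "\<And>z. z \<noteq> 0 \<Longrightarrow> \<exists>i<n. dot (x i) z \<noteq> 0"
proof -
  obtain a b c where abc: "{k. k < n \<and> ev k \<noteq> \<mu>} = {a, b, c}" "a \<noteq> b" "b \<noteq> c" "a \<noteq> c"
    using three by (auto simp: card_3_iff)
  then have lt: "a < n" "b < n" "c < n" and "ev a \<noteq> \<mu>" "ev b \<noteq> \<mu>" "ev c \<noteq> \<mu>"
    by blast+
  then have ne: "ev a < \<mu>" "ev b < \<mu>" "ev c < \<mu>" using le[of a] le[of b] le[of c] by simp_all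
  \<comment> \<open>Coordinates of a factor of \<mu>I - A. Only the three indices with an eigenvalue
    other than \<mu> contribute, and the square root is real because \<mu> is an upper
    bound.\<close>
  define y where "y k i = sqrt (\<mu> - ev k) * q i k" for k i
  have yy: "y a i * y a j + y b i * y b j + y c i * y c j = (if i = j then \<mu> else 0) - A i j"
    if ij: "i < n" "j < n" for i j
  proof -
    have s: "y k i * y k j = (\<mu> - ev k) * q i k * q j k" if "k < n" for k
    proof -
      have "sqrt (\<mu> - ev k) * sqrt (\<mu> - ev k) = \<mu> - ev k" using le[OF that] by simp
      then show ?thesis unfolding y_def by (metis mult.assoc mult.left_commute)
    qed
    have "(if i = j then \<mu> else 0) - A i j = (\<Sum>k<n. (\<mu> - ev k) * q i k * q j k)"
    proof -
      have "(\<Sum>k<n. (\<mu> - ev k) * q i k * q j k) = \<mu> * (\<Sum>k<n. q i k * q j k) - (\<Sum>k<n. ev k * q i k * q j k)"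
        by (simp add: sum_distrib_left left_diff_distrib sum_subtractf mult.assoc)
      then show ?thesis using row[OF ij] A[OF ij] by simp
    qed
    also have "\<dots> = (\<Sum>k\<in>{a, b, c}. (\<mu> - ev k) * q i k * q j k)"
    proof (rule sum.mono_neutral_right)
      show "\<forall>k\<in>{..<n} - {a, b, c}. (\<mu> - ev k) * q i k * q j k = 0"
        using abc(1) by auto
    qed (use lt in auto)
    finally show ?thesis using abc lt by (simp add: s)
  qed
  define s where "s k = (\<Sum>i<n. y k i)" for k
  \<comment> \<open>Row sums of \<open>A\<close> vanish, so every coordinate vector has the same
    product \<mu> with their sum \<open>s\<close>, whose squared length is n \<mu>. Removing the
    component along \<open>s\<close> therefore subtracts \<mu>^2 / (n \<mu>) = \<mu>/n from every
    entry.\<close>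
  have ys: "y a i * s a + y b i * s b + y c i * s c = \<mu>" if i: "i < n" for i
  proof -
    have "y a i * s a + y b i * s b + y c i * s c = (\<Sum>j<n. y a i * y a j + y b i * y b j + y c i * y c j)"
      by (simp add: s_def sum_distrib_left sum.distrib)
    also have "\<dots> = (\<Sum>j<n. (if i = j then \<mu> else 0) - A i j)" using i by (simp add: yy)
    also have "\<dots> = \<mu>" using i row_sum[OF i] by (simp add: sum_subtractf)
    finally show ?thesis .
  qed
  have ss: "(s a)\<^sup>2 + (s b)\<^sup>2 + (s c)\<^sup>2 = n * \<mu>"
  proof -
    have "(s a)\<^sup>2 + (s b)\<^sup>2 + (s c)\<^sup>2 = (\<Sum>i<n. y a i * s a + y b i * s b + y c i * s c)"
      by (simp add: power2_eq_square sum.distrib sum_distrib_right[symmetric]) (simp add: s_def)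
    then show ?thesis using ys by simp
  qed
  have "\<mu> - A 0 0 = y a 0 * y a 0 + y b 0 * y b 0 + y c 0 * y c 0" using yy[OF n n] by simp
  then have "\<mu> > 0" using diag by (smt (verit) zero_le_square)
  then have S: "(s a)\<^sup>2 + (s b)\<^sup>2 + (s c)\<^sup>2 > 0" using ss n by simp
  obtain e1 e2 e3 f1 f2 f3 where
    ee: "e1\<^sup>2 + e2\<^sup>2 + e3\<^sup>2 = 1" and ff: "f1\<^sup>2 + f2\<^sup>2 + f3\<^sup>2 = 1" and ef: "e1 * f1 + e2 * f2 + e3 * f3 = 0"
    and es: "e1 * s a + e2 * s b + e3 * s c = 0" and fs: "f1 * s a + f2 * s b + f3 * s c = 0"
    and proj: "\<forall>y1 y2 y3 z1 z2 z3. (y1 * e1 + y2 * e2 + y3 * e3) * (z1 * e1 + z2 * e2 + z3 * e3) +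
        (y1 * f1 + y2 * f2 + y3 * f3) * (z1 * f1 + z2 * f2 + z3 * f3) =
      y1 * z1 + y2 * z2 + y3 * z3 -
        (y1 * s a + y2 * s b + y3 * s c) * (z1 * s a + z2 * s b + z3 * s c) / ((s a)\<^sup>2 + (s b)\<^sup>2 + (s c)\<^sup>2)"
    by (rule orthonormal_complement[OF S])
  define x where "x i = Complex (y a i * e1 + y b i * e2 + y c i * e3) (y a i * f1 + y b i * f2 + y c i * f3)" for i
  show ?thesis
  proof (rule that[of x])
    fix i j assume ij: "i < n" "j < n"
    have "dot (x i) (x j) = y a i * y a j + y b i * y b j + y c i * y c j - \<mu> * \<mu> / (n * \<mu>)"
      by (simp add: dot_def x_def proj[rule_format] ys[OF ij(1)] ys[OF ij(2)] ss)
    then show "dot (x i) (x j) = (if i = j then \<mu> else 0) - A i j - \<mu> / n"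
      using yy[OF ij] \<open>\<mu> > 0\<close> by simp
  next
    have "(\<Sum>i<n. x i) = Complex (s a * e1 + s b * e2 + s c * e3) (s a * f1 + s b * f2 + s c * f3)"
      by (simp add: complex_eq_iff Re_sum Im_sum x_def s_def sum.distrib sum_distrib_right)
    then show "(\<Sum>i<n. x i) = 0" using es fs by (simp add: complex_eq_iff mult.commute)
  next
    fix z :: complex assume z: "z \<noteq> 0"
    show "\<exists>i<n. dot (x i) z \<noteq> 0"
    proof (rule ccontr)
      assume "\<not> ?thesis"
      then have zero: "dot (x i) z = 0" if "i < n" for i using that by blast
      \<comment> \<open>The vector of space that corresponds to \<open>z\<close>. It is orthogonal
        to all coordinate vectors, so it vanishes by orthonormality of the columns of
        \<open>q\<close>, and \<open>z\<close> with it.\<close>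
      define w1 w2 w3 where "w1 = Re z * e1 + Im z * f1" and "w2 = Re z * e2 + Im z * f2" and "w3 = Re z * e3 + Im z * f3"
      have yw: "y a i * w1 + y b i * w2 + y c i * w3 = 0" if "i < n" for i
        using zero[OF that] unfolding dot_def x_def w1_def w2_def w3_def by (simp add: algebra_simps)
      have comb: "q i a * (sqrt (\<mu> - ev a) * w1) + q i b * (sqrt (\<mu> - ev b) * w2) + q i c * (sqrt (\<mu> - ev c) * w3) = 0"
        if "i < n" for i
        using yw[OF that] by (simp add: y_def mult_ac)
      have coef: "(\<Sum>i<n. q i k * q i a) * (sqrt (\<mu> - ev a) * w1) + (\<Sum>i<n. q i k * q i b) * (sqrt (\<mu> - ev b) * w2)
          + (\<Sum>i<n. q i k * q i c) * (sqrt (\<mu> - ev c) * w3) = 0" for k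
      proof -
        have "(\<Sum>i<n. q i k * (q i a * (sqrt (\<mu> - ev a) * w1) + q i b * (sqrt (\<mu> - ev b) * w2) + q i c * (sqrt (\<mu> - ev c) * w3))) = 0"
          using comb by simp
        then show ?thesis
          by (simp add: distrib_left sum.distrib mult.assoc[symmetric] sum_distrib_right[symmetric])
      qed
      have "w1 = 0" "w2 = 0" "w3 = 0"
        using coef[of a] coef[of b] coef[of c] col lt abc(2-4) ne by auto
      then have w: "Re z * e1 + Im z * f1 = 0" "Re z * e2 + Im z * f2 = 0" "Re z * e3 + Im z * f3 = 0"
        by (simp_all add: w1_def w2_def w3_def)
      have "Re z = Re z * (e1\<^sup>2 + e2\<^sup>2 + e3\<^sup>2) + Im z * (e1 * f1 + e2 * f2 + e3 * f3)" using ee ef by simp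
      also have "\<dots> = (Re z * e1 + Im z * f1) * e1 + (Re z * e2 + Im z * f2) * e2 + (Re z * e3 + Im z * f3) * e3"
        by (simp add: algebra_simps power2_eq_square)
      finally have "Re z = 0" unfolding w by simp
      moreover have "Im z = Re z * (e1 * f1 + e2 * f2 + e3 * f3) + Im z * (f1\<^sup>2 + f2\<^sup>2 + f3\<^sup>2)" using ff ef by simp
      then have "Im z = (Re z * e1 + Im z * f1) * f1 + (Re z * e2 + Im z * f2) * f2 + (Re z * e3 + Im z * f3) * f3"
        by (simp add: algebra_simps power2_eq_square)
      then have "Im z = 0" unfolding w by simp
      ultimately show False using z by (simp add: complex_eq_iff)
    qed
  qed
qed

section \<open>Distances in connected graphs\<close>

context wf_digraph
begin

text \<open>Distance is defined through paths. Cutting closed parts out of a walk lets arbitrary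
  walks bound it, so that walks can be concatenated and reversed freely.\<close>

lemma graph_dist_le: "awalk u p v \<Longrightarrow> graph_dist G u v \<le> length p"
proof (induction p rule: length_induct)
  case (1 p)
  show ?case
  proof (cases "distinct (awalk_verts u p)")
    case True
    then have "apath u p v" using 1 by (simp add: apath_def)
    then show ?thesis unfolding graph_dist_def by (intro Least_le) blast
  next
    case False
    then obtain q r s w where p: "p = q @ r @ s" "0 < length r" "awalk u q w" "awalk w s v"
      using awalk_not_distinct_decomp[OF 1(2)] by blast
    then have "awalk u (q @ s) v" by (blast intro: awalk_appendI)
    moreover have "length (q @ s) < length p" using p by simp
    ultimately have "graph_dist G u v \<le> length (q @ s)" using 1(1) by blast
    then show ?thesis using \<open>length (q @ s) < length p\<close> by linarith
  qed
qed

lemma graph_dist_awalk: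
  assumes "u \<rightarrow>\<^sup>* v"
  obtains p where "awalk u p v" "length p = graph_dist G u v"
proof -
  have "\<exists>k p. apath u p v \<and> length p = k" using assms reachable_apath by blast
  then have "\<exists>p. apath u p v \<and> length p = graph_dist G u v"
    unfolding graph_dist_def by (rule LeastI_ex)
  then show ?thesis using that awalkI_apath by blast
qed

lemma awalk_leaves_set:
  assumes "awalk u p w" "u \<in> S" "w \<notin> S"
  shows "\<exists>e\<in>arcs G. tail G e \<in> S \<and> head G e \<notin> S"
  using assms
proof (induction p arbitrary: u)
  case Nil
  then show ?case by (simp add: awalk_Nil_iff)
next
  case (Cons e p)
  then show ?case by (cases "head G e \<in> S") (auto simp: awalk_Cons_iff)
qed

end

lemma (in graph) awalk_reverse:
  "awalk u p v \<Longrightarrow> \<exists>q. awalk v q u \<and> length q = length p"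
proof (induction p arbitrary: u)
  case Nil
  then show ?case by (auto simp: awalk_Nil_iff)
next
  case (Cons e p)
  then obtain q where q: "awalk v q (head G e)" "length q = length p"
    by (auto simp: awalk_Cons_iff)
  have e: "e \<in> arcs G" "u = tail G e" using Cons.prems by (auto simp: awalk_Cons_iff)
  then obtain e' where e': "e' \<in> arcs G" "tail G e' = head G e" "head G e' = u"
    using sym_arcs[unfolded symmetric_conv] by auto
  then have "awalk (head G e) [e'] u" using e by (auto simp: awalk_Cons_iff awalk_Nil_iff)
  then have "awalk v (q @ [e']) u" using q by (blast intro: awalk_appendI)
  then show ?case using q by (intro exI[of _ "q @ [e']"]) simp
qed

locale connected_graph = graph +
  assumes connected: "Digraph_Component.connected G"
begin

lemma reach: "u \<in> verts G \<Longrightarrow> v \<in> verts G \<Longrightarrow> u \<rightarrow>\<^sup>* v"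
  using symmetric_connected_imp_strongly_connected[OF sym_arcs connected] by (simp add: strongly_connected_def)

lemma dist_eq_0_iff: 
  assumes "u \<in> verts G" "v \<in> verts G"
  shows "graph_dist G u v = 0 \<longleftrightarrow> u = v"
proof
  assume d: "graph_dist G u v = 0"
  obtain p where "awalk u p v" "length p = graph_dist G u v" using graph_dist_awalk[OF reach[OF assms]] .
  then show "u = v" using d by (simp add: awalk_Nil_iff)
next
  assume "u = v"
  then have "awalk u [] v" using assms by (simp add: awalk_Nil_iff)
  from graph_dist_le[OF this] show "graph_dist G u v = 0" by simp
qed

lemma dist_eq_1_iff:
  assumes "u \<in> verts G" "v \<in> verts G"
  shows "graph_dist G u v = 1 \<longleftrightarrow> u \<rightarrow>\<^bsub>G\<^esub> v"
proof
  assume d: "graph_dist G u v = 1"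
  obtain p where p: "awalk u p v" "length p = graph_dist G u v" using graph_dist_awalk[OF reach[OF assms]] .
  then obtain e where "p = [e]" using d by (auto simp: length_Suc_conv)
  then show "u \<rightarrow>\<^bsub>G\<^esub> v"
    using p by (auto simp: awalk_Cons_iff awalk_Nil_iff arcs_ends_conv)
next
  assume "u \<rightarrow>\<^bsub>G\<^esub> v"
  then obtain e where e: "e \<in> arcs G" "tail G e = u" "head G e = v" by auto
  then have "awalk u [e] v" by (auto simp: awalk_Cons_iff awalk_Nil_iff)
  from graph_dist_le[OF this] have "graph_dist G u v \<le> 1" by simp
  moreover have "graph_dist G u v \<noteq> 0" using dist_eq_0_iff[OF assms] no_loops[OF e(1)] e by simp
  ultimately show "graph_dist G u v = 1" by simp
qed

lemma dist_sym:
  assumes "u \<in> verts G" "v \<in> verts G"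
  shows "graph_dist G u v = graph_dist G v u"
proof -
  have "graph_dist G u v \<le> graph_dist G v u"
    if uv: "u \<in> verts G" "v \<in> verts G" for u v
  proof -
    obtain p where p: "awalk v p u" "length p = graph_dist G v u"
      using graph_dist_awalk[OF reach[OF uv(2,1)]] .
    from awalk_reverse[OF p(1)] obtain q where "awalk u q v" "length q = length p" by blast
    then show ?thesis using graph_dist_le[of u q v] p by simp
  qed
  then show ?thesis using assms by (simp add: le_antisym)
qed

lemma dist_triangle:
  assumes "u \<in> verts G" "v \<in> verts G" "w \<in> verts G"
  shows "graph_dist G u w \<le> graph_dist G u v + graph_dist G v w"
proof -
  obtain p where p: "awalk u p v" "length p = graph_dist G u v"
    using graph_dist_awalk[OF reach[OF assms(1,2)]] .
  obtain q where q: "awalk v q w" "length q = graph_dist G v w"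
    using graph_dist_awalk[OF reach[OF assms(2,3)]] .
  have "awalk u (p @ q) w" using p q by (blast intro: awalk_appendI)
  from graph_dist_le[OF this] show ?thesis using p q by simp
qed

lemma dist_cut:
  assumes "S \<subseteq> verts G" "S \<noteq> {}" "S \<noteq> verts G"
  shows "\<exists>u\<in>S. \<exists>v\<in>verts G - S. graph_dist G u v = 1"
proof -
  obtain u w where uw: "u \<in> S" "w \<in> verts G" "w \<notin> S" using assms by blast
  then have "u \<rightarrow>\<^sup>* w" using assms reach by blast
  then obtain p where "awalk u p w" unfolding reachable_awalk by blast
  then obtain e where e: "e \<in> arcs G" "tail G e \<in> S" "head G e \<notin> S" using awalk_leaves_set uw by blast
  then have "tail G e \<rightarrow>\<^bsub>G\<^esub> head G e" by (auto simp: arcs_ends_conv)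
  then have "graph_dist G (tail G e) (head G e) = 1"
    using dist_eq_1_iff[OF tail_in_verts[OF e(1)] head_in_verts[OF e(1)]] by blast
  moreover have "head G e \<in> verts G - S" using e by simp
  ultimately show ?thesis using e(2) by blast
qed

end

section \<open>From equal shapes to an isomorphism\<close>

text \<open>Without parallel arcs an arc is determined by its ends, so a vertex bijection that
  respects adjacency extends uniquely to the arcs.\<close>

lemma digraph_isoI:
  assumes G: "graph G" and H: "graph H" and bij: "bij_betw f (verts G) (verts H)"
    and adj: "\<And>u v. u \<in> verts G \<Longrightarrow> v \<in> verts G \<Longrightarrow> u \<rightarrow>\<^bsub>G\<^esub> v \<longleftrightarrow> f u \<rightarrow>\<^bsub>H\<^esub> f v"
  shows "digraph_iso G H"
proof -
  interpret G: graph G by (rule G)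
  interpret H: graph H by (rule H)
  have "\<exists>b\<in>arcs H. tail H b = f (tail G a) \<and> head H b = f (head G a)" if "a \<in> arcs G" for a
  proof -
    have "tail G a \<rightarrow>\<^bsub>G\<^esub> head G a" using that by (auto simp: arcs_ends_conv)
    then have "f (tail G a) \<rightarrow>\<^bsub>H\<^esub> f (head G a)" using adj that by simp
    then show ?thesis by (auto simp: arcs_ends_conv)
  qed
  then obtain g where g: "g a \<in> arcs H" "tail H (g a) = f (tail G a)" "head H (g a) = f (head G a)"
    if "a \<in> arcs G" for a by metis
  have inj: "inj_on f (verts G)" using bij by (rule bij_betw_imp_inj_on)
  \<comment> \<open>\<open>digraph_iso\<close> asks for equality of records, so the incidence
    functions of \<open>H\<close> themselves must be the image functions.\<close>
  let ?h = "\<lparr>iso_verts = f, iso_arcs = g, iso_head = head H, iso_tail = tail H\<rparr>"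
  have "inj_on g (arcs G)"
  proof (rule inj_onI)
    fix a b assume ab: "a \<in> arcs G" "b \<in> arcs G" "g a = g b"
    then have "f (tail G a) = f (tail G b)" "f (head G a) = f (head G b)"
      using g(2,3)[OF ab(1)] g(2,3)[OF ab(2)] by simp_all
    then have "arc_to_ends G a = arc_to_ends G b"
      using inj ab by (auto simp: arc_to_ends_def dest: inj_onD)
    then show "a = b" using G.no_multi_arcs ab by blast
  qed
  then have "G.digraph_isomorphism ?h"
    unfolding G.digraph_isomorphism_def using inj g G.wf_digraph by simp
  moreover have "g ` arcs G = arcs H"
  proof
    show "g ` arcs G \<subseteq> arcs H" using g by auto
    show "arcs H \<subseteq> g ` arcs G"
    proof
      fix b assume b: "b \<in> arcs H"
      obtain u v where uv: "u \<in> verts G" "v \<in> verts G" "f u = tail H b" "f v = head H b"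
      proof -
        have "tail H b \<in> f ` verts G" "head H b \<in> f ` verts G"
          using bij b by (simp_all add: bij_betw_imp_surj_on)
        then show ?thesis using that by (auto simp: image_iff)
      qed
      have "f u \<rightarrow>\<^bsub>H\<^esub> f v" using b uv by (auto simp: arcs_ends_conv)
      then have "u \<rightarrow>\<^bsub>G\<^esub> v" using adj uv by simp
      then obtain a where a: "a \<in> arcs G" "tail G a = u" "head G a = v" by auto
      then have "arc_to_ends H (g a) = arc_to_ends H b" using g[OF a(1)] uv by (simp add: arc_to_ends_def)
      then have "g a = b" using H.no_multi_arcs b g a by blast
      then show "b \<in> g ` arcs G" using a by blast
    qed
  qed
  then have "H = app_iso ?h G"
    using bij by (simp add: app_iso_def bij_betw_imp_surj_on)
  ultimately show ?thesis unfolding digraph_iso_def by blast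
qed

text \<open>Bijections between classes of equal index are glued together. \<open>blowup\<close> says
  nothing about a vertex and itself; there irreflexivity enters.\<close>

lemma blowup_bijection:
  assumes fin: "finite V" "finite W"
    and G: "blowup V adj R l \<phi>" and H: "blowup W adj' R l \<psi>"
    and irrefl: "\<And>y. y \<in> V \<Longrightarrow> \<not> adj y y" "\<And>y. y \<in> W \<Longrightarrow> \<not> adj' y y"
  obtains f where "bij_betw f V W" "\<And>y z. y \<in> V \<Longrightarrow> z \<in> V \<Longrightarrow> adj y z \<longleftrightarrow> adj' (f y) (f z)"
proof -
  have "\<exists>g. bij_betw g {y \<in> V. \<phi> y = c} {y \<in> W. \<psi> y = c}" for c
  proof (rule finite_same_card_bij)
    show "card {y \<in> V. \<phi> y = c} = card {y \<in> W. \<psi> y = c}"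
      using G H by (simp only: blowup_def)
  qed (use fin in simp_all)
  then have "\<exists>g. \<forall>c. bij_betw (g c) {y \<in> V. \<phi> y = c} {y \<in> W. \<psi> y = c}" by (intro choice allI)
  then obtain g where g: "bij_betw (g c) {y \<in> V. \<phi> y = c} {y \<in> W. \<psi> y = c}" for c by blast
  define f where "f y = g (\<phi> y) y" for y
  have f: "f y \<in> W" "\<psi> (f y) = \<phi> y" if "y \<in> V" for y
  proof -
    have "g (\<phi> y) y \<in> {z \<in> W. \<psi> z = \<phi> y}" using bij_betwE[OF g[of "\<phi> y"]] that by blast
    then show "f y \<in> W" "\<psi> (f y) = \<phi> y" by (simp_all add: f_def)
  qed
  have inj: "inj_on f V"
  proof (rule inj_onI)
    fix y z assume yz: "y \<in> V" "z \<in> V" "f y = f z"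
    then have c: "\<phi> y = \<phi> z" using f(2)[OF yz(1)] f(2)[OF yz(2)] by simp
    have "inj_on (g (\<phi> z)) {y \<in> V. \<phi> y = \<phi> z}" using g by (rule bij_betw_imp_inj_on)
    moreover have "g (\<phi> z) y = g (\<phi> z) z" using yz(3) unfolding f_def c .
    ultimately show "y = z" by (rule inj_onD) (use yz c in simp_all)
  qed
  have "W \<subseteq> f ` V"
  proof
    fix w assume "w \<in> W"
    then have "w \<in> g (\<psi> w) ` {y \<in> V. \<phi> y = \<psi> w}"
      unfolding bij_betw_imp_surj_on[OF g] by simp
    then obtain y where "y \<in> V" "\<phi> y = \<psi> w" "w = g (\<psi> w) y" by blast
    then show "w \<in> f ` V" by (intro image_eqI[of _ _ y]) (simp_all add: f_def)
  qed
  then have bij: "bij_betw f V W" using inj f(1) unfolding bij_betw_def by blast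
  have "adj y z \<longleftrightarrow> adj' (f y) (f z)" if yz: "y \<in> V" "z \<in> V" for y z
  proof (cases "y = z")
    case True
    then show ?thesis using irrefl f(1)[OF yz(1)] yz by simp
  next
    case False
    then have "f y \<noteq> f z" using inj_onD[OF inj _ yz] by blast
    then have "adj' (f y) (f z) \<longleftrightarrow> R (\<phi> y) (\<phi> z)"
      using H[unfolded blowup_def, THEN conjunct1, rule_format, OF f(1)[OF yz(1)] f(1)[OF yz(2)]]
        f(2)[OF yz(1)] f(2)[OF yz(2)] by simp
    moreover have "adj y z \<longleftrightarrow> R (\<phi> y) (\<phi> z)" using G yz False unfolding blowup_def by blast
    ultimately show ?thesis by simp
  qed
  with bij show ?thesis by (rule that)
qed

section \<open>Reading the geometry off the spectrum\<close>

context connected_graph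
begin

lemma sum_vertices:
  assumes "vertex_enum G vs"
  shows "(\<Sum>j<length vs. f (vs ! j)) = sum f (verts G)"
proof -
  have "bij_betw ((!) vs) {..<length vs} (verts G)"
    using assms unfolding vertex_enum_def by (intro bij_betw_nth) simp_all
  then show ?thesis by (rule sum.reindex_bij_betw)
qed

lemma vertex_enum_length: "vertex_enum G vs \<Longrightarrow> length vs = card (verts G)"
  using distinct_card[of vs] by (simp add: vertex_enum_def)

lemma vertex_enum_ex: obtains vs where "vertex_enum G vs"
  using finite_distinct_list[OF finite_verts] unfolding vertex_enum_def by blast

lemma dist_laplacian_symmetric:
  assumes vs: "vertex_enum G vs"
  shows "transpose_mat (dist_laplacian_mat G vs) = dist_laplacian_mat G vs"
proof (rule eq_matI)
  note c = dist_laplacian_mat_carrier[of G vs]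
  fix i j assume "i < dim_row (dist_laplacian_mat G vs)" "j < dim_col (dist_laplacian_mat G vs)"
  then have ij: "i < length vs" "j < length vs" using c by simp_all
  then have "vs ! i \<in> verts G" "vs ! j \<in> verts G" using vs nth_mem[of _ vs] by (simp_all add: vertex_enum_def)
  then show "transpose_mat (dist_laplacian_mat G vs) $$ (i, j) = dist_laplacian_mat G vs $$ (i, j)"
    using c ij dist_sym[of "vs ! i" "vs ! j"] by (cases "i = j") (simp_all add: dist_laplacian_mat_index)
qed (use dist_laplacian_mat_carrier[of G vs] in simp_all)

lemma size_spectrum: "size (dist_laplacian_spectrum G) = card (verts G)"
proof -
  obtain vs where vs: "vertex_enum G vs" by (rule vertex_enum_ex)
  obtain q es where "length es = length vs" "proots (char_poly (dist_laplacian_mat G vs)) = mset es"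
    by (rule symmetric_spectrum[OF dist_laplacian_mat_carrier dist_laplacian_symmetric[OF vs]])
  then show ?thesis
    unfolding dist_laplacian_spectrum_eq[OF vs] vertex_enum_length[OF vs, symmetric] by simp
qed

text \<open>The sum of the spectrum is the trace, and the squared norms \<mu> - \<mu>/n - A i i add
  up to (n - 1) \<mu> minus the trace. So the numbers passed to \<open>shape\<close> depend on the
  spectrum alone, \<open>n\<close> being its size.\<close>

lemma spectrum_shape:
  fixes n :: nat and \<mu> :: real
  defines "n \<equiv> card (verts G)" and "\<mu> \<equiv> Max (set_mset (dist_laplacian_spectrum G))"
  assumes n: "n \<ge> 5" and mult: "count (dist_laplacian_spectrum G) \<mu> = n - 3" and vs: "vertex_enum G vs"
  obtains R l \<phi> where "blowup {..<n} (\<lambda>i j. vs ! i \<rightarrow>\<^bsub>G\<^esub> vs ! j) R l \<phi>"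
    "shape n (\<mu> / n - 1) ((real n - 1) * \<mu> - sum_mset (dist_laplacian_spectrum G)) R l"
proof -
  have len: "length vs = n" using vertex_enum_length[OF vs] by (simp add: n_def)
  define A where "A i j = dist_laplacian_mat G vs $$ (i, j)" for i j
  obtain q es where es: "length es = length vs" "proots (char_poly (dist_laplacian_mat G vs)) = mset es"
    and A_sum: "\<And>i j. i < length vs \<Longrightarrow> j < length vs \<Longrightarrow> dist_laplacian_mat G vs $$ (i, j) = (\<Sum>k<length vs. es ! k * q i k * q j k)"
    and row: "\<And>i j. i < length vs \<Longrightarrow> j < length vs \<Longrightarrow> (\<Sum>k<length vs. q i k * q j k) = (if i = j then 1 else 0)"
    and col: "\<And>k l. k < length vs \<Longrightarrow> l < length vs \<Longrightarrow> (\<Sum>i<length vs. q i k * q i l) = (if k = l then 1 else 0)"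
    by (rule symmetric_spectrum[OF dist_laplacian_mat_carrier dist_laplacian_symmetric[OF vs]]) blast
  note A_sum = A_sum[unfolded len, folded A_def] and row = row[unfolded len] and col = col[unfolded len]
  have spec: "dist_laplacian_spectrum G = mset es" using dist_laplacian_spectrum_eq[OF vs] es by simp
  have esn: "length es = n" using es len by simp
  have inV: "vs ! i \<in> verts G" if "i < n" for i
    using that vs len nth_mem[of i vs] by (simp add: vertex_enum_def)
  have neq: "vs ! i \<noteq> vs ! j" if "i < n" "j < n" "i \<noteq> j" for i j
    using that vs len by (simp add: vertex_enum_def nth_eq_iff_index_eq)
  have Aij: "A i j = (if i = j then real (transmission G (vs ! i)) else 0) - real (graph_dist G (vs ! i) (vs ! j))"
    if "i < n" "j < n" for i j
    unfolding A_def by (rule dist_laplacian_mat_index) (use that len in simp_all)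
  have row_sum: "(\<Sum>j<n. A i j) = 0" if i: "i < n" for i
  proof -
    have "(\<Sum>j<n. A i j) = (\<Sum>j<n. (if i = j then real (transmission G (vs ! i)) else 0)) - (\<Sum>j<n. real (graph_dist G (vs ! i) (vs ! j)))"
      using i by (simp add: Aij sum_subtractf)
    also have "(\<Sum>j<n. real (graph_dist G (vs ! i) (vs ! j))) = real (transmission G (vs ! i))"
      unfolding transmission_def len[symmetric] using sum_vertices[OF vs, of "\<lambda>w. real (graph_dist G (vs ! i) w)"] by simp
    finally show ?thesis using i by simp
  qed
  \<comment> \<open>This yields \<mu> > 0 in \<open>planar_representation\<close>, where the
    projection divides by n \<mu>.\<close>
  have diag: "A 0 0 > 0"
  proof -
    have "graph_dist G (vs ! 0) (vs ! 1) \<le> transmission G (vs ! 0)"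
      unfolding transmission_def using inV[of 1] n by (intro member_le_sum) simp_all
    moreover have "graph_dist G (vs ! 0) (vs ! 1) \<noteq> 0"
      using dist_eq_0_iff[OF inV inV, of 0 1] neq[of 0 1] n by simp
    moreover have "graph_dist G (vs ! 0) (vs ! 0) = 0" using dist_eq_0_iff[OF inV inV, of 0 0] n by simp
    ultimately show ?thesis using Aij[of 0 0] n by simp
  qed
  have le: "es ! k \<le> \<mu>" if "k < n" for k
    unfolding \<mu>_def spec using that esn by (intro Max_ge) simp_all
  \<comment> \<open>The list of eigenvalues has length n, so three entries differ from \<mu>; one of
    them is the eigenvalue 0 of the all-ones vector.\<close>
  have three: "card {k. k < n \<and> es ! k \<noteq> \<mu>} = 3"
  proof -
    have "count (mset es) \<mu> = card {k. k < n \<and> es ! k = \<mu>}"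
      by (simp add: count_mset count_list_eq_length_filter length_filter_conv_card esn eq_commute[of \<mu>])
    then have "card {k. k < n \<and> es ! k = \<mu>} = n - 3" using mult spec by simp
    moreover have "card ({k. k < n \<and> es ! k = \<mu>} \<union> {k. k < n \<and> es ! k \<noteq> \<mu>})
        = card {k. k < n \<and> es ! k = \<mu>} + card {k. k < n \<and> es ! k \<noteq> \<mu>}"
      by (rule card_Un_disjoint) auto
    moreover have "{k. k < n \<and> es ! k = \<mu>} \<union> {k. k < n \<and> es ! k \<noteq> \<mu>} = {..<n}" by auto
    then have "card ({k. k < n \<and> es ! k = \<mu>} \<union> {k. k < n \<and> es ! k \<noteq> \<mu>}) = n" by simp
    ultimately show ?thesis using n by linarith
  qed
  have "n > 0" using n by simp
  then obtain x where dot_x: "\<And>i j. i < n \<Longrightarrow> j < n \<Longrightarrow> dot (x i) (x j) = (if i = j then \<mu> else 0) - A i j - \<mu> / n"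
    and sum0: "(\<Sum>i<n. x i) = 0" and span: "\<And>z. z \<noteq> 0 \<Longrightarrow> \<exists>i<n. dot (x i) z \<noteq> 0"
    by (rule planar_representation[OF _ A_sum row col row_sum diag le three]) blast+
  define d where "d i j = graph_dist G (vs ! i) (vs ! j)" for i j
  interpret planar_distance "{..<n}" d "\<mu> / n - 1" x
  proof
    fix u v assume "u \<in> {..<n}" "v \<in> {..<n}"
    then have uv: "u < n" "v < n" by simp_all
    show "d u v = 0 \<longleftrightarrow> u = v"
      unfolding d_def using dist_eq_0_iff[OF inV[OF uv(1)] inV[OF uv(2)]] neq[OF uv] by auto
    show "d u v = d v u" unfolding d_def using dist_sym[OF inV[OF uv(1)] inV[OF uv(2)]] .
    show "dot (x u) (x v) = real (d u v) - 1 - (\<mu> / n - 1)" if "u \<noteq> v"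
      using dot_x[OF uv] Aij[OF uv] that by (simp add: d_def)
    fix w assume "w \<in> {..<n}"
    then show "d u w \<le> d u v + d v w"
      unfolding d_def using dist_triangle[OF inV[OF uv(1)] inV[OF uv(2)] inV[of w]] by simp
  next
    fix S assume S: "S \<subseteq> {..<n}" "S \<noteq> {}" "S \<noteq> {..<n}"
    have "bij_betw ((!) vs) {..<n} (verts G)"
      using vs len unfolding vertex_enum_def by (intro bij_betw_nth) simp_all
    then have img: "(!) vs ` {..<n} = verts G" and inj: "inj_on ((!) vs) {..<n}"
      by (simp_all only: bij_betw_def)
    have "(!) vs ` S \<subseteq> verts G" "(!) vs ` S \<noteq> {}" using S(1,2) img by blast+
    moreover have "(!) vs ` S \<noteq> verts G"
      using inj_on_image_eq_iff[OF inj S(1), of "{..<n}"] S(3) img by simp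
    ultimately obtain y z where yz: "y \<in> (!) vs ` S" "z \<in> verts G" "z \<notin> (!) vs ` S" "graph_dist G y z = 1"
      using dist_cut[of "(!) vs ` S"] by blast
    from yz(2) have "z \<in> (!) vs ` {..<n}" unfolding img .
    then obtain u v where uv: "u \<in> S" "y = vs ! u" "v \<in> {..<n}" "z = vs ! v" using yz(1) by blast
    then have "v \<notin> S" using yz(3) by blast
    then show "\<exists>u\<in>S. \<exists>v\<in>{..<n} - S. d u v = 1"
      unfolding d_def using uv(1,3) yz(4)[unfolded uv(2,4)] by blast
  next
    show "\<exists>v\<in>{..<n}. dot (x v) z \<noteq> 0" if "z \<noteq> 0" for z using span[OF that] by blast
  qed (use n sum0 in simp_all)
  have trace: "(\<Sum>i<n. A i i) = sum_mset (mset es)"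
  proof -
    have "(\<Sum>i<n. A i i) = (\<Sum>i<n. \<Sum>k<n. es ! k * (q i k * q i k))"
      by (intro sum.cong refl) (simp add: A_sum mult.assoc)
    also have "\<dots> = (\<Sum>k<n. es ! k * (\<Sum>i<n. q i k * q i k))"
      by (subst sum.swap) (simp add: sum_distrib_left)
    also have "\<dots> = (\<Sum>k<n. es ! k)" by (intro sum.cong refl) (simp add: col)
    finally show ?thesis
      by (simp add: sum_mset_sum_list sum_list_sum_nth esn atLeast0LessThan)
  qed
  have S: "(\<Sum>y<n. dot (x y) (x y)) = (real n - 1) * \<mu> - sum_mset (dist_laplacian_spectrum G)"
  proof -
    have "(\<Sum>y<n. dot (x y) (x y)) = (\<Sum>y<n. \<mu> - \<mu> / n - A y y)" by (intro sum.cong refl) (simp add: dot_x)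
    also have "\<dots> = n * (\<mu> - \<mu> / n) - (\<Sum>y<n. A y y)" by (simp add: sum_subtractf)
    also have "n * (\<mu> - \<mu> / n) = (real n - 1) * \<mu>" using n by (simp add: field_simps)
    finally show ?thesis unfolding trace spec .
  qed
  obtain R l \<phi> where b: "blowup {..<n} E R l \<phi>"
    and s: "shape (card {..<n}) (\<mu> / n - 1) (\<Sum>y<n. dot (x y) (x y)) R l" by (rule classification)
  have "d i j = 1 \<longleftrightarrow> vs ! i \<rightarrow>\<^bsub>G\<^esub> vs ! j" if "i < n" "j < n" for i j
    unfolding d_def by (rule dist_eq_1_iff[OF inV[OF that(1)] inV[OF that(2)]])
  then have "blowup {..<n} (\<lambda>i j. vs ! i \<rightarrow>\<^bsub>G\<^esub> vs ! j) R l \<phi>"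
    using b unfolding blowup_def by simp
  moreover have "shape n (\<mu> / n - 1) ((real n - 1) * \<mu> - sum_mset (dist_laplacian_spectrum G)) R l"
    using s unfolding S by simp
  ultimately show ?thesis by (rule that)
qed

end

theorem corollary3p3:
  fixes G :: "('a, 'b) pre_digraph" and H :: "('c, 'd) pre_digraph" and n :: nat
  assumes "n \<ge> 5" and "G \<in> graph_class n (n - 3)"
    and "graph H" and "Digraph_Component.connected H"
    and "dist_laplacian_spectrum H = dist_laplacian_spectrum G"
  shows "digraph_iso H G"
proof -
  have G: "graph G" "Digraph_Component.connected G" "card (verts G) = n"
    and mult: "count (dist_laplacian_spectrum G) (Max (set_mset (dist_laplacian_spectrum G))) = n - 3"
    using assms(2) by (simp_all add: graph_class_def largest_eigenvalue_multiplicity_def)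
  interpret G: connected_graph G using G by (simp add: connected_graph_def connected_graph_axioms_def)
  interpret H: connected_graph H using assms(3,4) by (simp add: connected_graph_def connected_graph_axioms_def)
  \<comment> \<open>The size of the spectrum counts the vertices; with equal n the two graphs also
    share \<open>\<mu>\<close> and \<open>s\<close>.\<close>
  have cH: "card (verts H) = n"
    using G.size_spectrum H.size_spectrum assms(5) G(3) by simp
  obtain vs ws where vs: "vertex_enum G vs" and ws: "vertex_enum H ws"
    using G.vertex_enum_ex H.vertex_enum_ex by metis
  define \<mu> where "\<mu> = Max (set_mset (dist_laplacian_spectrum G))"
  define s where "s = (real n - 1) * \<mu> - sum_mset (dist_laplacian_spectrum G)"
  obtain R l \<phi> where bG: "blowup {..<n} (\<lambda>i j. vs ! i \<rightarrow>\<^bsub>G\<^esub> vs ! j) R l \<phi>" and sG: "shape n (\<mu> / n - 1) s R l"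
    using G.spectrum_shape[OF _ _ vs] assms(1) mult unfolding G(3) \<mu>_def[symmetric] s_def[symmetric] by blast
  obtain R' l' \<psi> where bH: "blowup {..<n} (\<lambda>i j. ws ! i \<rightarrow>\<^bsub>H\<^esub> ws ! j) R' l' \<psi>" and sH: "shape n (\<mu> / n - 1) s R' l'"
    using H.spectrum_shape[OF _ _ ws] assms(1) mult unfolding cH assms(5) \<mu>_def[symmetric] s_def[symmetric] by blast
  have RR: "R = R'" "l = l'" using shape_unique[OF assms(1) sG sH] by simp_all
  have len: "length vs = n" "length ws = n"
    using G.vertex_enum_length[OF vs] H.vertex_enum_length[OF ws] G(3) cH by simp_all
  have irrefl: "\<not> vs ! i \<rightarrow>\<^bsub>G\<^esub> vs ! i" "\<not> ws ! i \<rightarrow>\<^bsub>H\<^esub> ws ! i" for i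
    using G.adj_not_same H.adj_not_same by blast+
  obtain f where f: "bij_betw f {..<n} {..<n}"
    "\<And>i j. i \<in> {..<n} \<Longrightarrow> j \<in> {..<n} \<Longrightarrow> ws ! i \<rightarrow>\<^bsub>H\<^esub> ws ! j \<longleftrightarrow> vs ! f i \<rightarrow>\<^bsub>G\<^esub> vs ! f j"
    by (rule blowup_bijection[OF _ _ bH[folded RR] bG]) (use irrefl in simp_all)
  have bv: "bij_betw ((!) vs) {..<n} (verts G)" and bw: "bij_betw ((!) ws) {..<n} (verts H)"
    using bij_betw_nth[of vs] bij_betw_nth[of ws] vs ws len by (auto simp: vertex_enum_def)
  define g where "g = (!) vs \<circ> f \<circ> inv_into {..<n} ((!) ws)"
  have inv: "inv_into {..<n} ((!) ws) u \<in> {..<n}" "ws ! inv_into {..<n} ((!) ws) u = u" if "u \<in> verts H" for u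
  proof -
    have "u \<in> (!) ws ` {..<n}" using that bij_betw_imp_surj_on[OF bw] by simp
    then show "inv_into {..<n} ((!) ws) u \<in> {..<n}" "ws ! inv_into {..<n} ((!) ws) u = u"
      by (rule inv_into_into, rule f_inv_into_f)
  qed
  show ?thesis
  proof (rule digraph_isoI[OF assms(3) G(1)])
    show "bij_betw g (verts H) (verts G)"
      unfolding g_def using bij_betw_inv_into[OF bw] f(1) bv by (blast intro: bij_betw_trans)
    fix u v assume uv: "u \<in> verts H" "v \<in> verts H"
    show "u \<rightarrow>\<^bsub>H\<^esub> v \<longleftrightarrow> g u \<rightarrow>\<^bsub>G\<^esub> g v"
      using f(2)[OF inv(1)[OF uv(1)] inv(1)[OF uv(2)]] unfolding inv(2)[OF uv(1)] inv(2)[OF uv(2)] g_def comp_def .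
  qed
qed

end
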